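(* There is a constant $C>0$ such that for every positive integer $N$, every set $A\subseteq\{1,\ldots,N\}$ with $$|A|\geq \frac58 N+C$$ contains a pairwise-sum triple, i.e. there are distinct $a,b,c\in A$ such that $a+b,\ a+c,\ b+c\in A$.
   Context: For a positive integer $N$, $[1,N]$ denotes $\{1,\ldots,N\}$. A set $A\subseteq[1,N]$ contains a pairwise-sum triple if there are (pairwise) distinct $a,b,c\in A$ such that $a+b$, $a+c$ and $b+c$ all belong to $A$ (ordinary integer addition). The constant $C$ is absolute (independent of $N$ and $A$). *)

theory Defs
  imports Complex_Main
begin

definition has_pairwise_sum_triple :: "nat set \<Rightarrow> bool" where
  "has_pairwise_sum_triple A \<longleftrightarrow>
     (\<exists>a\<in>A. \<exists>b\<in>A. \<exists>c\<in>A. a \<noteq> b \<and> a \<noteq> c \<and> b \<noteq> c \<and>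
        a + b \<in> A \<and> a + c \<in> A \<and> b + c \<in> A)"

end

theory Submission
  imports Defs
begin

text \<open>
  Call A triple-free if it contains no pairwise-sum triple. It suffices to find C such that every
  triple-free A inside {1..N} has fewer than 5N/8 + C elements. Let N be least such that this fails
  for A, and let M be the set of missing elements of {1..N}, so that |M| \<le> 3N/8 - C. If v, c, c'
  are distinct elements of A and v + c, v + c' lie in A, then c + c' is missing. So the
  neighbourhood {c. v + c \<in> A} of every v is independent: its restricted sums (sums of two
  distinct elements) all lie in M, provided that they do not exceed N. An independent set P in the
  lower half of {1..N} with about N/8 elements therefore has at most about 3|P| restricted sums,
  three times its size, where 2|P| - 3 is always reached. The proof separates two cases, with the
  threshold (3 - 1/200)|P|.

  Few restricted sums. A Freiman-type theorem, small_rsum_progression, shows that up to boundedly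
  many elements P is a dense piece Q of an arithmetic progression, and then Q has at least |Q| + l -
  2 restricted sums, where l + 1 is the number of terms of the progression from the least to the
  greatest element of Q. Such a Q cannot exist (no_progression). A step g \<ge> 4 does not fit into
  {1..N/2}; if g \<ge> 2 divides the elements of Q, the maximum of Q would be a restricted sum; for
  g = 3 minimality of N, applied to the multiples of 3, produces too many missing elements; for g =
  2 the odd elements of A outside the range of Q do; for g = 1 the elements missing below twice the
  minimum and above twice the maximum of Q do.

  Many restricted sums. By the first case every independent set of at least about N/8 elements has
  more than (3 - 1/200)|P| restricted sums. So no independent set is much larger than N/8, and the
  restricted sums of one that is as large as N/8 account for nearly all of M. Let v be the least
  element of A above N/2 and P its neighbourhood in {1..N - v}. Counting shows that P is that large,
  that v is close to N/2, that the least element u of P is small, and that for nearly all c \<le> N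
  - v at least one of c, v + c lies in A. Comparing c with c + u, nearly every c has either both c
  and c + u in A, or both v + c and v + c + u. The c of the first kind form an independent set. If d
  is its least element, then d translates the second kind off itself, hence d is at least about N/4,
  as the first kind has at most about N/8 elements, so that the restricted sums of the first kind
  are missing elements above N/2. Their number is about twice the number of c of the first kind,
  while that number is about the number of missing elements above N/2. So there are few missing
  elements above N/2, and many_missing_above says that there are at least about N/12.

  The Freiman-type theorem is proved modulo the diameter l of P, where the two end points coincide.
  If U is the set of restricted sums modulo l, then P has at least |U| + |P| - 2 restricted sums, so
  |U| is less than (2 - 1/q)|P| up to a constant. An isoperimetric argument in the manner of Kneser
  and Hamidoune, in which a small number of forbidden incidences is tolerated because diagonal sums
  are excluded from U, produces a modulus d such that P, up to boundedly many elements, meets j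
  residue classes modulo d and these have at least 2j - 1 sums. Counting sums class by class gives
  about 3|P| sums as soon as j \<ge> 2 (class_count). So j = 1, unless l is already below 2|P|, and
  the argument is repeated in the class.
\<close>

section \<open>Restricted sumsets and periodic functions\<close>

text \<open>
  The restricted sumset, often written with a hat over the plus sign. A pairwise-sum triple concerns
  distinct elements, so sums x + x carry no information.
\<close>

definition rsum :: "'a::plus set \<Rightarrow> 'a set" where
  "rsum P = {x + y | x y. x \<in> P \<and> y \<in> P \<and> x \<noteq> y}"

lemma rsumI: "x \<in> P \<Longrightarrow> y \<in> P \<Longrightarrow> x \<noteq> y \<Longrightarrow> x + y \<in> rsum P"
  unfolding rsum_def by blast

lemma rsum_mono: "P \<subseteq> Q \<Longrightarrow> rsum P \<subseteq> rsum Q"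
  unfolding rsum_def by blast

lemma finite_rsum: "finite P \<Longrightarrow> finite (rsum P)"
proof -
  assume "finite P"
  then have "finite ((\<lambda>(x, y). x + y) ` (P \<times> P))" by blast
  moreover have "rsum P \<subseteq> (\<lambda>(x, y). x + y) ` (P \<times> P)" unfolding rsum_def by auto
  ultimately show ?thesis by (rule rev_finite_subset)
qed

text \<open>
  With a = min X and z = max Y, the translates a + Y and X + z have only the sum a + z in common.
  Excluding equal summands removes at most one element from each translate.
\<close>

lemma card_distinct_sums:
  fixes X Y :: "'a::linordered_cancel_ab_semigroup_add set"
  assumes fin: "finite X" "finite Y" and ne: "X \<noteq> {}" "Y \<noteq> {}"
  shows "card X + card Y \<le> card {x + y | x y. x \<in> X \<and> y \<in> Y \<and> x \<noteq> y} + 3"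
proof -
  define a where "a = Min X"
  define z where "z = Max Y"
  let ?S = "{x + y | x y. x \<in> X \<and> y \<in> Y \<and> x \<noteq> y}"
  have a: "a \<in> X" "\<And>x. x \<in> X \<Longrightarrow> a \<le> x" unfolding a_def using fin ne by auto
  have z: "z \<in> Y" "\<And>y. y \<in> Y \<Longrightarrow> y \<le> z" unfolding z_def using fin ne by auto
  let ?L = "(\<lambda>y. a + y) ` (Y - {a})"
  let ?R = "(\<lambda>x. x + z) ` (X - {z})"
  have "?S \<subseteq> (\<lambda>(x, y). x + y) ` (X \<times> Y)" by auto
  then have finS: "finite ?S" using fin by (meson finite_SigmaI finite_imageI finite_subset)
  have cL: "card ?L = card (Y - {a})" by (rule card_image) (simp add: inj_on_def)
  have cR: "card ?R = card (X - {z})" by (rule card_image) (simp add: inj_on_def)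
  have "?L \<inter> ?R \<subseteq> {a + z}"
  proof
    fix s assume "s \<in> ?L \<inter> ?R"
    then obtain x y where *: "y \<in> Y" "x \<in> X" "s = a + y" "s = x + z" by blast
    then have "a + y = x + z" by simp
    moreover have "a \<le> x" "y \<le> z" using * a z by auto
    ultimately have "y = z"
      using add_le_less_mono[of a x y z] by (metis order_less_irrefl order_le_imp_less_or_eq)
    then show "s \<in> {a + z}" using * by simp
  qed
  then have i: "card (?L \<inter> ?R) \<le> 1" using card_mono[of "{a + z}" "?L \<inter> ?R"] by simp
  have "card ?L + card ?R = card (?L \<union> ?R) + card (?L \<inter> ?R)"
    by (rule card_Un_Int) (use fin in auto)
  moreover have "?L \<union> ?R \<subseteq> ?S" using a z by auto
  then have "card (?L \<union> ?R) \<le> card ?S" using finS by (rule card_mono[rotated])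
  moreover have "card Y \<le> card (Y - {a}) + 1" "card X \<le> card (X - {z}) + 1"
    by (auto simp: card_Diff_singleton_if)
  ultimately show ?thesis using i cL cR by linarith
qed

lemma card_rsum_ge:
  fixes P :: "'a::linordered_cancel_ab_semigroup_add set"
  assumes "finite P"
  shows "2 * card P \<le> card (rsum P) + 3"
proof (cases "P = {}")
  case False
  then show ?thesis using card_distinct_sums[OF assms assms] unfolding rsum_def by simp
qed simp

lemma periodic_mod:
  fixes f :: "int \<Rightarrow> 'b"
  assumes "\<And>x. f (x + n) = f x"
  shows "f (x mod n) = f x"
proof -
  have p: "f (x + n * int m) = f x" for x m
  proof (induction m)
    case (Suc m)
    have "f (x + n * int (Suc m)) = f (x + n * int m + n)" by (simp add: algebra_simps)
    then show ?case using assms Suc by simp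
  qed simp
  have q: "f (x + n * m) = f x" for x m
  proof (cases "m \<ge> 0")
    case True
    then show ?thesis using p[of x "nat m"] by simp
  next
    case False
    then show ?thesis using p[of "x + n * m" "nat (- m)"] by (simp add: algebra_simps)
  qed
  have "x mod n + n * (x div n) = x" by simp
  then show ?thesis using q[of "x mod n" "x div n"] by simp
qed

lemma sum_periodic_shift:
  fixes f :: "int \<Rightarrow> 'b::comm_monoid_add"
  assumes "\<And>x. f (x + n) = f x" and n: "n > 0"
  shows "(\<Sum>x\<in>{0..<n}. f (x + g)) = (\<Sum>x\<in>{0..<n}. f x)"
proof (rule sum.reindex_bij_witness[where i = "\<lambda>x. (x - g) mod n" and j = "\<lambda>x. (x + g) mod n"])
  fix a assume "a \<in> {0..<n}"
  then show "((a + g) mod n - g) mod n = a" "((a - g) mod n + g) mod n = a"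
    by (simp_all add: mod_simps)
  show "(a + g) mod n \<in> {0..<n}" "(a - g) mod n \<in> {0..<n}" using n by auto
  show "f ((a + g) mod n) = f (a + g)" by (rule periodic_mod) (rule assms)
qed

lemma sum_periodic_neg:
  fixes f :: "int \<Rightarrow> 'b::comm_monoid_add"
  assumes p: "\<And>x. f (x + n) = f x" and n: "n > 0"
  shows "(\<Sum>x\<in>{0..<n}. f (- x)) = (\<Sum>x\<in>{0..<n}. f x)"
proof (rule sum.reindex_bij_witness[where i = "\<lambda>x. (- x) mod n" and j = "\<lambda>x. (- x) mod n"])
  fix a assume "a \<in> {0..<n}"
  then show "(- ((- a) mod n)) mod n = a" "(- ((- a) mod n)) mod n = a"
    by (simp_all add: mod_simps)
  show "(- a) mod n \<in> {0..<n}" "(- a) mod n \<in> {0..<n}" using n by auto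
  show "f ((- a) mod n) = f (- a)" by (rule periodic_mod) (rule p)
qed

section \<open>An isoperimetric functional on pairs of periodic sets\<close>

text \<open>
  Subsets of the cyclic group of order n are represented by n-periodic sets of integers, and cnt
  counts elements in one period. An incidence of a pair (X, Y) is a solution of x + c = y with x
  \<in> X, c \<in> B, y \<in> Y, and inc counts incidences. Without incidences Y avoids X + B, and n
  - |X| - |Y| is the excess of the complement of Y over X, the quantity that isoperimetric arguments
  minimise.
\<close>

locale cyclic_pairs =
  fixes n k :: int and B :: "int set"
  assumes n_pos: "n > 0" and k_pos: "k > 0" and B_sub: "B \<subseteq> {0..<n}"
begin

definition periodic :: "int set \<Rightarrow> bool" where
  "periodic X \<longleftrightarrow> (\<forall>x. x + n \<in> X \<longleftrightarrow> x \<in> X)"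

definition cnt :: "int set \<Rightarrow> int" where
  "cnt X = (\<Sum>x\<in>{0..<n}. of_bool (x \<in> X))"

definition sh :: "int \<Rightarrow> int set \<Rightarrow> int set" where
  "sh g X = {x. x + g \<in> X}"

definition inc :: "int set \<Rightarrow> int set \<Rightarrow> int" where
  "inc X Y = (\<Sum>c\<in>B. cnt (X \<inter> sh c Y))"

text \<open>
  One unit of excess costs as much as k incidences. Tolerating incidences makes room for the
  restricted sums of B, which differ from its full sums in the diagonal.
\<close>

definition Phi :: "int set \<Rightarrow> int set \<Rightarrow> int" where
  "Phi X Y = k * (n - cnt X - cnt Y) + inc X Y"

text \<open>
  Without the lower bounds the set of all integers together with the empty set would make Phi zero.
\<close>

definition adm :: "int set \<Rightarrow> int set \<Rightarrow> bool" where
  "adm X Y \<longleftrightarrow> periodic X \<and> periodic Y \<and> k \<le> cnt X \<and> k \<le> cnt Y"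

text \<open>
  Among the pairs with least Phi, X is as small as possible. This turns an inequality into an
  equality in minim_translate.
\<close>

definition minim :: "int set \<Rightarrow> int set \<Rightarrow> bool" where
  "minim X Y \<longleftrightarrow> adm X Y \<and> (\<forall>X' Y'. adm X' Y' \<longrightarrow> Phi X Y \<le> Phi X' Y') \<and>
     (\<forall>X' Y'. adm X' Y' \<longrightarrow> Phi X' Y' = Phi X Y \<longrightarrow> cnt X \<le> cnt X')"

lemma fin_B: "finite B"
  using B_sub finite_subset by blast

lemma sh_iff [simp]: "x \<in> sh g X \<longleftrightarrow> x + g \<in> X"
  by (simp add: sh_def)

lemma cnt_card: "cnt X = int (card (X \<inter> {0..<n}))"
proof -
  have "cnt X = (\<Sum>x\<in>{0..<n} \<inter> {x. x \<in> X}. 1)"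
    unfolding cnt_def of_bool_def by (subst sum.inter_restrict) auto
  then show ?thesis by (simp add: Int_commute)
qed

lemma cnt_nonneg [simp]: "0 \<le> cnt X"
  by (simp add: cnt_card)

lemma cnt_empty [simp]: "cnt {} = 0"
  by (simp add: cnt_card)

lemma cnt_mono: "X \<subseteq> Y \<Longrightarrow> cnt X \<le> cnt Y"
  unfolding cnt_def by (rule sum_mono) auto

lemma cnt_Un_Int: "cnt (X \<union> Y) + cnt (X \<inter> Y) = cnt X + cnt Y"
  unfolding cnt_def sum.distrib[symmetric] by (rule sum.cong) auto

lemma cnt_compl: "cnt (- X) = n - cnt X"
proof -
  have "cnt (- X) + cnt X = (\<Sum>x\<in>{0..<n}. 1)"
    unfolding cnt_def sum.distrib[symmetric] by (rule sum.cong) auto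
  then show ?thesis using n_pos by simp
qed

lemma cnt_le: "cnt X \<le> n"
  using cnt_compl[of X] cnt_nonneg[of "- X"] by linarith

lemma periodic_simps [simp]:
  "periodic X \<Longrightarrow> periodic (sh g X)"
  "periodic X \<Longrightarrow> periodic (- X)"
  "periodic X \<Longrightarrow> periodic Y \<Longrightarrow> periodic (X \<union> Y)"
  "periodic X \<Longrightarrow> periodic Y \<Longrightarrow> periodic (X \<inter> Y)"
  "periodic X \<Longrightarrow> periodic (uminus -` X)"
proof -
  show "periodic (sh g X)" if p: "periodic X"
  proof -
    have "x + n + g \<in> X \<longleftrightarrow> x + g \<in> X" for x
    proof -
      have "x + g + n \<in> X \<longleftrightarrow> x + g \<in> X" using p unfolding periodic_def by blast
      then show ?thesis by (simp add: algebra_simps)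
    qed
    then show ?thesis unfolding periodic_def by simp
  qed
  assume p: "periodic X"
  have "- (x + n) \<in> X \<longleftrightarrow> - x \<in> X" for x
  proof -
    have "- (x + n) + n \<in> X \<longleftrightarrow> - (x + n) \<in> X" using p unfolding periodic_def by blast
    then show ?thesis by simp
  qed
  then show "periodic (uminus -` X)" unfolding periodic_def by simp
qed (auto simp: periodic_def)

lemma of_bool_periodic: "periodic X \<Longrightarrow> (of_bool (x + n \<in> X) :: int) = of_bool (x \<in> X)"
  by (simp add: periodic_def)

lemma cnt_sh: "periodic X \<Longrightarrow> cnt (sh g X) = cnt X"
  unfolding cnt_def sh_iff
  by (rule sum_periodic_shift[where f = "\<lambda>x. of_bool (x \<in> X)"]) (simp_all add: of_bool_periodic n_pos)

lemma cnt_neg: "periodic X \<Longrightarrow> cnt (uminus -` X) = cnt X"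
  unfolding cnt_def vimage_eq
  by (rule sum_periodic_neg[where f = "\<lambda>x. of_bool (x \<in> X)"]) (simp_all add: of_bool_periodic n_pos)

lemma periodic_mod_iff: "periodic X \<Longrightarrow> x mod n \<in> X \<longleftrightarrow> x \<in> X"
  using periodic_mod[of "\<lambda>x. x \<in> X" n x] unfolding periodic_def by auto

lemma periodic_eqI:
  assumes "periodic X" "periodic Y" "X \<subseteq> Y" "cnt Y \<le> cnt X"
  shows "X = Y"
proof -
  have "X \<inter> {0..<n} \<subseteq> Y \<inter> {0..<n}" using assms(3) by blast
  moreover have "card (Y \<inter> {0..<n}) \<le> card (X \<inter> {0..<n})"
    using assms(4) unfolding cnt_card by linarith
  ultimately have eq: "X \<inter> {0..<n} = Y \<inter> {0..<n}"
    by (intro card_seteq) simp_all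
  have "x \<in> X \<longleftrightarrow> x \<in> Y" for x
  proof -
    have "x mod n \<in> {0..<n}" using n_pos by simp
    then have "x mod n \<in> X \<longleftrightarrow> x mod n \<in> Y" using eq by blast
    then show ?thesis using assms(1,2) periodic_mod_iff by simp
  qed
  then show ?thesis by blast
qed

lemma inc_nonneg [simp]: "0 \<le> inc X Y"
  unfolding inc_def by (simp add: sum_nonneg)

lemma inc_empty [simp]: "inc X {} = 0"
  unfolding inc_def by (simp add: sh_def)

text \<open>
  x + c = y is equivalent to -y + c = -x. This symmetry is the reason why X is no larger than Y in a
  minimal pair.
\<close>

lemma Phi_dual:
  assumes "periodic X" "periodic Y"
  shows "Phi (uminus -` Y) (uminus -` X) = Phi X Y"
proof -
  have "cnt (uminus -` Y \<inter> sh c (uminus -` X)) = cnt (X \<inter> sh c Y)" for c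
  proof -
    have e: "uminus -` Y \<inter> sh c (uminus -` X) = uminus -` (Y \<inter> sh (- c) X)" by auto
    have "cnt (uminus -` (Y \<inter> sh (- c) X)) = cnt (Y \<inter> sh (- c) X)"
      by (rule cnt_neg) (use assms in simp)
    also have "\<dots> = cnt (sh c (Y \<inter> sh (- c) X))"
      by (rule cnt_sh[symmetric]) (use assms in simp)
    also have "sh c (Y \<inter> sh (- c) X) = X \<inter> sh c Y" by auto
    finally show ?thesis using e by simp
  qed
  then show ?thesis unfolding Phi_def inc_def using assms by (simp add: cnt_neg)
qed

lemma Phi_sh:
  assumes "periodic X" "periodic Y"
  shows "Phi (sh g X) (sh g Y) = Phi X Y"
proof -
  have "cnt (sh g X \<inter> sh c (sh g Y)) = cnt (X \<inter> sh c Y)" for c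
  proof -
    have e: "sh g X \<inter> sh c (sh g Y) = sh g (X \<inter> sh c Y)" by (auto simp: algebra_simps)
    have "cnt (sh g (X \<inter> sh c Y)) = cnt (X \<inter> sh c Y)" by (rule cnt_sh) (use assms in simp)
    then show ?thesis using e by simp
  qed
  then show ?thesis unfolding Phi_def inc_def using assms by (simp add: cnt_sh)
qed

text \<open>
  Incidences are submodular pointwise in x and c, and the linear part of Phi is modular.
\<close>

lemma Phi_submodular:
  "Phi (X \<inter> X') (Y \<union> Y') + Phi (X \<union> X') (Y \<inter> Y') \<le> Phi X Y + Phi X' Y'"
proof -
  have "cnt (X \<inter> X' \<inter> sh c (Y \<union> Y')) + cnt ((X \<union> X') \<inter> sh c (Y \<inter> Y'))
      \<le> cnt (X \<inter> sh c Y) + cnt (X' \<inter> sh c Y')" for c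
    unfolding cnt_def sum.distrib[symmetric] by (rule sum_mono) auto
  then have "inc (X \<inter> X') (Y \<union> Y') + inc (X \<union> X') (Y \<inter> Y') \<le> inc X Y + inc X' Y'"
    unfolding inc_def sum.distrib[symmetric] by (intro sum_mono)
  moreover have "k * (n - cnt (X \<inter> X') - cnt (Y \<union> Y')) + k * (n - cnt (X \<union> X') - cnt (Y \<inter> Y'))
      = k * (n - cnt X - cnt Y) + k * (n - cnt X' - cnt Y')"
    using cnt_Un_Int[of X X'] cnt_Un_Int[of Y Y'] by (simp add: distrib_left[symmetric])
  ultimately show ?thesis unfolding Phi_def by linarith
qed

text \<open>
  Of the |B| sums x + c with x fixed, at most n - |Y| can miss Y, so each x takes part in at least
  |B| - (n - |Y|) incidences, and there are at least k choices of x. In applications the bound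
  forces a pair with small Phi to have large X.
\<close>

lemma Phi_ge:
  assumes pX: "periodic X" and pY: "periodic Y" and kX: "k \<le> cnt X"
  shows "k * int (card B) - k * cnt X \<le> Phi X Y"
proof -
  let ?y = "cnt (- Y)"
  have "inc X Y + inc X (- Y) = (\<Sum>c\<in>B. cnt X)"
    unfolding inc_def cnt_def sum.distrib[symmetric] by (intro sum.cong) auto
  then have tot: "inc X Y + inc X (- Y) = int (card B) * cnt X" by simp
  have "inc X (- Y) = (\<Sum>x\<in>{0..<n}. \<Sum>c\<in>B. of_bool (x \<in> X) * of_bool (c + x \<in> - Y))"
    unfolding inc_def cnt_def by (subst sum.swap) (auto intro!: sum.cong simp: add.commute)
  also have "\<dots> \<le> (\<Sum>x\<in>{0..<n}. of_bool (x \<in> X) * ?y)"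
  proof (rule sum_mono)
    fix x
    have "(\<Sum>c\<in>B. of_bool (c + x \<in> - Y) :: int) \<le> (\<Sum>c\<in>{0..<n}. of_bool (c + x \<in> - Y))"
      by (rule sum_mono2) (use B_sub in auto)
    also have "\<dots> = ?y" using cnt_sh[of "- Y" x] pY by (simp add: cnt_def)
    finally show "(\<Sum>c\<in>B. of_bool (x \<in> X) * of_bool (c + x \<in> - Y)) \<le> of_bool (x \<in> X) * ?y"
      by (simp add: sum_distrib_left[symmetric])
  qed
  also have "\<dots> = cnt X * ?y" by (simp add: cnt_def sum_distrib_right)
  finally have le: "inc X (- Y) \<le> cnt X * ?y" .
  have "k * (int (card B) - ?y) \<le> inc X Y"
  proof (cases "?y \<ge> int (card B)")
    case True
    then have "k * (int (card B) - ?y) \<le> 0" using k_pos by (simp add: mult_nonneg_nonpos)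
    then show ?thesis using inc_nonneg[of X Y] by linarith
  next
    case False
    then have "k * (int (card B) - ?y) \<le> cnt X * (int (card B) - ?y)"
      using kX by (intro mult_right_mono) auto
    also have "\<dots> = int (card B) * cnt X - cnt X * ?y" by (simp add: algebra_simps)
    finally show ?thesis using tot le by linarith
  qed
  then show ?thesis unfolding Phi_def using cnt_compl[of Y] by (simp add: algebra_simps)
qed

lemma autocorrelation_sum:
  assumes p: "periodic X"
  shows "(\<Sum>g\<in>{0..<n}. cnt (X \<inter> sh g X)) = cnt X * cnt X"
proof -
  have "(\<Sum>g\<in>{0..<n}. cnt (X \<inter> sh g X))
      = (\<Sum>x\<in>{0..<n}. \<Sum>g\<in>{0..<n}. of_bool (x \<in> X) * of_bool (g + x \<in> X))"
    unfolding cnt_def by (subst sum.swap) (auto intro!: sum.cong simp: add.commute)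
  also have "\<dots> = (\<Sum>x\<in>{0..<n}. of_bool (x \<in> X) * cnt X)"
    using cnt_sh[OF p] by (simp add: sum_distrib_left[symmetric] cnt_def)
  finally show ?thesis by (simp add: cnt_def sum_distrib_right)
qed

lemma sum_squares_ge:
  fixes r :: "int \<Rightarrow> int"
  shows "(\<Sum>s\<in>{0..<n}. r s)\<^sup>2 \<le> n * (\<Sum>s\<in>{0..<n}. (r s)\<^sup>2)"
proof -
  let ?T = "\<Sum>s\<in>{0..<n}. r s" and ?Q = "\<Sum>s\<in>{0..<n}. (r s)\<^sup>2"
  \<comment> \<open>A multiple of the variance of r.\<close>
  have "0 \<le> (\<Sum>s\<in>{0..<n}. (n * r s - ?T)\<^sup>2)" by (simp add: sum_nonneg)
  also have "\<dots> = (\<Sum>s\<in>{0..<n}. n\<^sup>2 * (r s)\<^sup>2 - 2 * n * ?T * r s + ?T\<^sup>2)"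
    by (rule sum.cong) (auto simp: power2_eq_square algebra_simps)
  also have "\<dots> = n\<^sup>2 * ?Q - 2 * n * ?T * ?T + n * ?T\<^sup>2"
    using n_pos by (simp add: sum.distrib sum_subtractf sum_distrib_left[symmetric])
  also have "\<dots> = n * (n * ?Q - ?T\<^sup>2)" by (simp add: power2_eq_square algebra_simps)
  finally have "0 \<le> n * (n * ?Q - ?T\<^sup>2)" .
  then show ?thesis using n_pos by (simp add: zero_le_mult_iff)
qed

text \<open>
  Let r(s) be the number of x in X with x + s in Y. The sum of the r(s) is |X| |Y|, and the sum of
  the squares counts pairs (x, x + g) in X together with pairs (y, y + g) in Y for the same g. The
  inequality is Cauchy-Schwarz.
\<close>

lemma energy:
  assumes pX: "periodic X" and pY: "periodic Y"
  shows "(cnt X * cnt Y)\<^sup>2 \<le> n * (\<Sum>g\<in>{0..<n}. cnt (X \<inter> sh g X) * cnt (Y \<inter> sh g Y))"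
proof -
  let ?N = "{0..<n}"
  define f :: "int \<Rightarrow> int" where "f x = of_bool (x \<in> X)" for x
  define h :: "int \<Rightarrow> int" where "h x = of_bool (x \<in> Y)" for x
  have pf: "f (x + n) = f x" and ph: "h (x + n) = h x" for x
    using pX pY by (simp_all add: f_def h_def of_bool_periodic)
  have ph': "h (x + n + y) = h (x + y)" "h (x + (n + y)) = h (x + y)" for x y
    using ph[of "x + y"] by (simp_all add: algebra_simps)
  define r where "r s = (\<Sum>x\<in>?N. f x * h (x + s))" for s
  have "(\<Sum>s\<in>?N. r s) = (\<Sum>x\<in>?N. f x * (\<Sum>s\<in>?N. h (s + x)))"
    unfolding r_def by (subst sum.swap) (simp add: sum_distrib_left add.commute)
  also have "\<dots> = (\<Sum>x\<in>?N. f x * (\<Sum>s\<in>?N. h s))"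
    using sum_periodic_shift[of h n, OF ph n_pos] by simp
  also have "\<dots> = cnt X * cnt Y"
    by (simp add: sum_distrib_right[symmetric] f_def h_def cnt_def)
  finally have tot: "(\<Sum>s\<in>?N. r s) = cnt X * cnt Y" .
  have "(\<Sum>s\<in>?N. (r s)\<^sup>2) = (\<Sum>s\<in>?N. \<Sum>x\<in>?N. \<Sum>g\<in>?N. f x * f (g + x) * (h (x + s) * h (g + x + s)))"
  proof (rule sum.cong[OF refl])
    fix s
    have "(r s)\<^sup>2 = (\<Sum>x\<in>?N. f x * h (x + s) * r s)"
      by (simp add: power2_eq_square r_def sum_distrib_right)
    also have "\<dots> = (\<Sum>x\<in>?N. \<Sum>g\<in>?N. f x * f (g + x) * (h (x + s) * h (g + x + s)))"
    proof (rule sum.cong[OF refl])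
      fix x
      have "r s = (\<Sum>g\<in>?N. f (g + x) * h (g + x + s))"
        unfolding r_def
        by (rule sum_periodic_shift[where f = "\<lambda>x. f x * h (x + s)", symmetric])
           (simp_all add: pf ph' n_pos)
      then show "f x * h (x + s) * r s = (\<Sum>g\<in>?N. f x * f (g + x) * (h (x + s) * h (g + x + s)))"
        by (simp add: sum_distrib_left mult_ac)
    qed
    finally show "(r s)\<^sup>2 = (\<Sum>x\<in>?N. \<Sum>g\<in>?N. f x * f (g + x) * (h (x + s) * h (g + x + s)))" .
  qed
  also have "\<dots> = (\<Sum>g\<in>?N. \<Sum>x\<in>?N. \<Sum>s\<in>?N. f x * f (g + x) * (h (x + s) * h (g + x + s)))"
  proof -
    have "(\<Sum>s\<in>?N. \<Sum>x\<in>?N. \<Sum>g\<in>?N. F s x g) = (\<Sum>g\<in>?N. \<Sum>x\<in>?N. \<Sum>s\<in>?N. F s x g)"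
      for F :: "int \<Rightarrow> int \<Rightarrow> int \<Rightarrow> int"
    proof -
      have "(\<Sum>s\<in>?N. \<Sum>x\<in>?N. \<Sum>g\<in>?N. F s x g) = (\<Sum>x\<in>?N. \<Sum>s\<in>?N. \<Sum>g\<in>?N. F s x g)"
        by (rule sum.swap)
      also have "\<dots> = (\<Sum>x\<in>?N. \<Sum>g\<in>?N. \<Sum>s\<in>?N. F s x g)"
        by (rule sum.cong[OF refl]) (rule sum.swap)
      also have "\<dots> = (\<Sum>g\<in>?N. \<Sum>x\<in>?N. \<Sum>s\<in>?N. F s x g)" by (rule sum.swap)
      finally show ?thesis .
    qed
    then show ?thesis .
  qed
  also have "\<dots> = (\<Sum>g\<in>?N. \<Sum>x\<in>?N. f x * f (g + x) * cnt (Y \<inter> sh g Y))"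
  proof (intro sum.cong[OF refl])
    fix g x
    have "(\<Sum>s\<in>?N. h (s + x) * h (s + x + g)) = (\<Sum>s\<in>?N. h s * h (s + g))"
      by (rule sum_periodic_shift[where f = "\<lambda>s. h s * h (s + g)"])
         (simp_all add: ph ph' n_pos)
    also have "\<dots> = cnt (Y \<inter> sh g Y)" unfolding cnt_def h_def by (intro sum.cong) auto
    finally have "(\<Sum>s\<in>?N. h (x + s) * h (g + x + s)) = cnt (Y \<inter> sh g Y)"
      by (simp add: algebra_simps)
    then show "(\<Sum>s\<in>?N. f x * f (g + x) * (h (x + s) * h (g + x + s)))
        = f x * f (g + x) * cnt (Y \<inter> sh g Y)"
      by (simp add: sum_distrib_left[symmetric])
  qed
  also have "\<dots> = (\<Sum>g\<in>?N. cnt (X \<inter> sh g X) * cnt (Y \<inter> sh g Y))"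
  proof (rule sum.cong[OF refl])
    fix g
    have "(\<Sum>x\<in>?N. f x * f (g + x)) = cnt (X \<inter> sh g X)"
      unfolding cnt_def f_def by (rule sum.cong) (auto simp: add.commute)
    then show "(\<Sum>x\<in>?N. f x * f (g + x) * cnt (Y \<inter> sh g Y)) = cnt (X \<inter> sh g X) * cnt (Y \<inter> sh g Y)"
      by (simp add: sum_distrib_right[symmetric])
  qed
  finally have "(\<Sum>s\<in>?N. (r s)\<^sup>2) = (\<Sum>g\<in>?N. cnt (X \<inter> sh g X) * cnt (Y \<inter> sh g Y))" .
  then show ?thesis using sum_squares_ge[of r] tot by simp
qed

end

section \<open>Minimal pairs are cosets\<close>

lemma card_residue_classes:
  fixes d h :: int
  assumes d: "d > 0" and S: "S \<subseteq> {0..<d}" and h: "h \<ge> 0"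
  shows "int (card {y \<in> {0..<d * h}. y mod d \<in> S}) = h * int (card S)"
proof -
  have fS: "finite S" using S finite_subset by blast
  have "{y \<in> {0..<d * h}. y mod d \<in> S} = (\<lambda>(s, q). s + d * q) ` (S \<times> {0..<h})"
  proof (intro equalityI subsetI)
    fix y assume y: "y \<in> {y \<in> {0..<d * h}. y mod d \<in> S}"
    have "y div d < h"
    proof (rule ccontr)
      assume "\<not> y div d < h"
      then have "d * h \<le> d * (y div d)" using d by (intro mult_left_mono) auto
      also have "\<dots> \<le> y" using d mult_div_mod_eq[of d y] pos_mod_sign[OF d, of y] by linarith
      finally show False using y by simp
    qed
    moreover have "0 \<le> y div d" using y d by (simp add: pos_imp_zdiv_nonneg_iff)
    moreover have "y = y mod d + d * (y div d)" by simp
    ultimately show "y \<in> (\<lambda>(s, q). s + d * q) ` (S \<times> {0..<h})" using y by force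
  next
    fix y assume "y \<in> (\<lambda>(s, q). s + d * q) ` (S \<times> {0..<h})"
    then obtain s q where *: "s \<in> S" "0 \<le> q" "q < h" "y = s + d * q" by auto
    have s: "0 \<le> s" "s < d" using * S by auto
    have "d * q + d \<le> d * h"
    proof -
      have "d * (q + 1) \<le> d * h" using * d by (intro mult_left_mono) auto
      then show ?thesis by (simp add: algebra_simps)
    qed
    then have "y < d * h" using * s by linarith
    moreover have "0 \<le> y" using * s d by simp
    moreover have "y mod d = s" using * s by simp
    ultimately show "y \<in> {y \<in> {0..<d * h}. y mod d \<in> S}" using * by simp
  qed
  moreover have "inj_on (\<lambda>(s, q). s + d * q) (S \<times> {0..<h})"
  proof (rule inj_onI, clarify)
    fix s q s' q' assume a: "s \<in> S" "s' \<in> S" "s + d * q = s' + d * q'"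
    have "0 \<le> s" "s < d" "0 \<le> s'" "s' < d" using a S by auto
    then have "(s + d * q) mod d = s" "(s' + d * q') mod d = s'" by simp_all
    then have "s = s'" using a by simp
    then show "s = s' \<and> q = q'" using a d by simp
  qed
  ultimately have "card {y \<in> {0..<d * h}. y mod d \<in> S} = card S * card {0..<h}"
    using fS by (simp add: card_image card_cartesian_product)
  then show ?thesis using h by (simp add: mult.commute)
qed

context cyclic_pairs
begin

lemma cnt_residue_classes:
  assumes d: "d > 0" "d dvd n" and S: "S \<subseteq> {0..<d}"
  shows "cnt {y. (y - x) mod d \<in> S} = (n div d) * int (card S)"
proof -
  have n: "n = d * (n div d)" using d by simp
  have p: "periodic {y. y mod d \<in> S}"
    unfolding periodic_def using d by (auto simp: mod_add_right_eq[symmetric] mod_eq_0_iff_dvd)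
  have "{y. (y - x) mod d \<in> S} = sh (- x) {y. y mod d \<in> S}" by auto
  then have "cnt {y. (y - x) mod d \<in> S} = cnt {y. y mod d \<in> S}" using cnt_sh[OF p] by simp
  also have "\<dots> = int (card {y \<in> {0..<n}. y mod d \<in> S})"
    unfolding cnt_card by (rule arg_cong[where f = "\<lambda>A. int (card A)"]) auto
  also have "\<dots> = (n div d) * int (card S)"
    using card_residue_classes[OF d(1) S, of "n div d"] n d n_pos
    by (simp add: pos_imp_zdiv_nonneg_iff)
  finally show ?thesis .
qed

lemma periodic_residue_classes:
  assumes "d dvd n"
  shows "periodic {y. (y - x) mod d \<in> S}"
proof -
  have "(y + n - x) mod d = (y - x) mod d" for y
  proof -
    have "(y + n - x) mod d = ((y - x) + n) mod d" by (simp add: algebra_simps)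
    then show ?thesis using assms by (metis add.right_neutral dvd_eq_mod_eq_0 mod_add_right_eq)
  qed
  then show ?thesis unfolding periodic_def by simp
qed

lemma exists_minim:
  assumes "adm X0 Y0"
  shows "\<exists>X Y. minim X Y"
proof -
  have lb: "0 \<le> Phi X Y + k * n" for X Y
  proof -
    have "k * (n - cnt X - cnt Y) + k * n \<ge> 0"
      using cnt_le[of X] cnt_le[of Y] k_pos by (simp add: distrib_left[symmetric])
    then show ?thesis unfolding Phi_def using inc_nonneg[of X Y] by linarith
  qed
  \<comment> \<open>Adding k * n makes the functional nonnegative, so that a least value exists among natural
    numbers.\<close>
  define f where "f p = nat (Phi (fst p) (snd p) + k * n)" for p
  obtain p where p: "adm (fst p) (snd p)" "\<And>q. adm (fst q) (snd q) \<Longrightarrow> f p \<le> f q"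
    using ex_has_least_nat[of "\<lambda>p. adm (fst p) (snd p)" "(X0, Y0)" f] assms by auto
  have pmin: "Phi (fst p) (snd p) \<le> Phi X Y" if "adm X Y" for X Y
    using p(2)[of "(X, Y)"] that lb unfolding f_def by (simp add: nat_le_eq_zle)
  obtain q where q: "adm (fst q) (snd q) \<and> Phi (fst q) (snd q) = Phi (fst p) (snd p)"
    "\<And>r. adm (fst r) (snd r) \<and> Phi (fst r) (snd r) = Phi (fst p) (snd p)
        \<Longrightarrow> nat (cnt (fst q)) \<le> nat (cnt (fst r))"
    using ex_has_least_nat[of "\<lambda>q. adm (fst q) (snd q) \<and> Phi (fst q) (snd q) = Phi (fst p) (snd p)"
        p "\<lambda>q. nat (cnt (fst q))"] p(1) by blast
  have "minim (fst q) (snd q)"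
    unfolding minim_def
  proof (intro conjI allI impI)
    show "adm (fst q) (snd q)" using q by blast
    fix X' Y' assume a: "adm X' Y'"
    then show "Phi (fst q) (snd q) \<le> Phi X' Y'" using pmin q by simp
    assume "Phi X' Y' = Phi (fst q) (snd q)"
    then have "nat (cnt (fst q)) \<le> nat (cnt X')" using q(2)[of "(X', Y')"] a q(1) by simp
    then show "cnt (fst q) \<le> cnt X'" by (simp add: nat_le_eq_zle)
  qed
  then show ?thesis by blast
qed

lemma minim_dual:
  assumes "minim X Y"
  shows "cnt X \<le> cnt Y"
proof -
  have p: "periodic X" "periodic Y" using assms by (auto simp: minim_def adm_def)
  then have "adm (uminus -` Y) (uminus -` X)"
    using assms by (auto simp: minim_def adm_def cnt_neg)
  then have "cnt X \<le> cnt (uminus -` Y)"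
    using assms Phi_dual[OF p] unfolding minim_def by blast
  then show ?thesis using p by (simp add: cnt_neg)
qed

text \<open>
  If both intersections have at least k elements, then submodularity for (X, Y) and its translate by
  g produces two admissible pairs whose values have average at most the minimum. So both are
  minimal, and X cannot be larger than X \<inter> sh g X because X is the smallest first component.
\<close>

lemma minim_translate:
  assumes m: "minim X Y"
  shows "sh g X = X \<or> cnt (X \<inter> sh g X) < k \<or> cnt (Y \<inter> sh g Y) < k"
proof (rule ccontr)
  assume c: "\<not> ?thesis"
  have p: "periodic X" "periodic Y" and kk: "k \<le> cnt X" "k \<le> cnt Y"
    using m by (auto simp: minim_def adm_def)
  have "cnt (X \<inter> sh g X) \<le> cnt (X \<union> sh g X)" "cnt (Y \<inter> sh g Y) \<le> cnt (Y \<union> sh g Y)"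
    by (intro cnt_mono; blast)+
  then have a: "adm (X \<inter> sh g X) (Y \<union> sh g Y)" "adm (X \<union> sh g X) (Y \<inter> sh g Y)"
    using c p unfolding adm_def by auto
  have "Phi (X \<inter> sh g X) (Y \<union> sh g Y) + Phi (X \<union> sh g X) (Y \<inter> sh g Y) \<le> Phi X Y + Phi X Y"
    using Phi_submodular[of X "sh g X" Y "sh g Y"] Phi_sh[OF p] by simp
  moreover have "Phi X Y \<le> Phi (X \<inter> sh g X) (Y \<union> sh g Y)" "Phi X Y \<le> Phi (X \<union> sh g X) (Y \<inter> sh g Y)"
    using m a unfolding minim_def by blast+
  ultimately have "Phi (X \<inter> sh g X) (Y \<union> sh g Y) = Phi X Y" by linarith
  then have le: "cnt X \<le> cnt (X \<inter> sh g X)" using m a unfolding minim_def by blast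
  then have "X \<inter> sh g X = X" using p by (intro periodic_eqI) auto
  then have "X \<subseteq> sh g X" by blast
  then have "X = sh g X" using p cnt_sh[OF p(1)] by (intro periodic_eqI) auto
  then show False using c by blast
qed

definition stab :: "int set \<Rightarrow> int set" where
  "stab X = {g. sh g X = X}"

lemma stab_iff: "g \<in> stab X \<longleftrightarrow> (\<forall>x. x + g \<in> X \<longleftrightarrow> x \<in> X)"
  unfolding stab_def by (auto simp: set_eq_iff)

lemma stab_multiples:
  assumes "periodic X"
  obtains d where "d > 0" "d dvd n" "\<And>g. g \<in> stab X \<longleftrightarrow> d dvd g"
proof -
  have nst: "n \<in> stab X" using assms by (simp add: stab_iff periodic_def)
  have add: "g + g' \<in> stab X" if "g \<in> stab X" "g' \<in> stab X" for g g'
    using that unfolding stab_iff by (metis add.assoc)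
  have neg: "- g \<in> stab X" if "g \<in> stab X" for g
    using that unfolding stab_iff by (metis diff_add_cancel uminus_add_conv_diff add.commute)
  have mul: "g * m \<in> stab X" if g: "g \<in> stab X" for g m
  proof -
    have nn: "g * int j \<in> stab X" for j
    proof (induction j)
      case 0 then show ?case by (simp add: stab_iff)
    next
      case (Suc j)
      then show ?case using add[OF g Suc] by (simp add: algebra_simps)
    qed
    show ?thesis
    proof (cases "m \<ge> 0")
      case True then show ?thesis using nn[of "nat m"] by simp
    next
      case False then show ?thesis using neg[OF nn[of "nat (- m)"]] by simp
    qed
  qed
  define P where "P j \<longleftrightarrow> j > 0 \<and> int j \<in> stab X" for j
  have "P (nat n)" using nst n_pos by (simp add: P_def)
  then have L: "P (LEAST j. P j)" and min: "\<And>j. P j \<Longrightarrow> (LEAST j. P j) \<le> j"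
    by (auto intro: LeastI Least_le)
  define d where "d = int (LEAST j. P j)"
  have d0: "d > 0" and dst: "d \<in> stab X" using L by (auto simp: P_def d_def)
  have dv: "g \<in> stab X \<longleftrightarrow> d dvd g" for g
  proof
    assume g: "g \<in> stab X"
    have "g mod d = g + d * (- (g div d))" by (simp add: minus_mult_div_eq_mod[symmetric])
    then have st: "g mod d \<in> stab X" using add[OF g mul[OF dst, of "- (g div d)"]] by simp
    show "d dvd g"
    proof (rule ccontr)
      assume "\<not> d dvd g"
      then have "g mod d > 0" using d0 by (metis dvd_eq_mod_eq_0 pos_mod_sign le_less)
      then have "P (nat (g mod d))" using st by (simp add: P_def)
      then have "d \<le> g mod d" using min[of "nat (g mod d)"] \<open>g mod d > 0\<close> unfolding d_def by linarith
      then show False using pos_mod_bound[OF d0, of g] by linarith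
    qed
  next
    assume "d dvd g"
    then show "g \<in> stab X" using mul[OF dst] by (auto elim: dvdE)
  qed
  show ?thesis using that[OF d0] dv nst by blast
qed

lemma cnt_multiples:
  assumes "d > 0" "d dvd n"
  shows "cnt {y. d dvd y - x} = n div d"
  using cnt_residue_classes[OF assms, of "{0}" x] assms by (simp add: dvd_eq_mod_eq_0)

text \<open>
  By minim_translate, a shift outside the stabiliser of X has autocorrelation below k on X or on Y,
  so that these shifts contribute little to the energy. The lower bound for the energy must then
  come from the stabiliser.
\<close>

lemma stab_large:
  assumes m: "minim X Y" and big: "n \<le> 4 * cnt Y" "4 * n * k < cnt X * cnt X"
    and d: "d > 0" "d dvd n" "\<And>g. g \<in> stab X \<longleftrightarrow> d dvd g"
  shows "cnt X \<le> 8 * (n div d)"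
proof (rule ccontr)
  assume "\<not> ?thesis"
  then have con: "8 * (n div d) < cnt X" by simp
  let ?x = "cnt X" and ?y = "cnt Y" and ?h = "n div d"
  have p: "periodic X" "periodic Y" using m by (auto simp: minim_def adm_def)
  have xy: "?x \<le> ?y" using minim_dual[OF m] .
  have "(\<Sum>g\<in>{0..<n}. cnt (X \<inter> sh g X) * cnt (Y \<inter> sh g Y))
      \<le> (\<Sum>g\<in>{0..<n}. of_bool (d dvd g) * (?x * ?y) + k * cnt (X \<inter> sh g X) + k * cnt (Y \<inter> sh g Y))"
  proof (rule sum_mono)
    fix g
    let ?a = "cnt (X \<inter> sh g X)" and ?b = "cnt (Y \<inter> sh g Y)"
    have ab: "?a \<le> ?x" "?b \<le> ?y" by (auto intro: cnt_mono)
    consider "d dvd g" | "?a \<le> k" | "?b \<le> k"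
      using minim_translate[OF m, of g] d(3)[of g] unfolding stab_def by auto
    then show "?a * ?b \<le> of_bool (d dvd g) * (?x * ?y) + k * ?a + k * ?b"
    proof cases
      case 1
      then show ?thesis using ab k_pos mult_mono[of ?a ?x ?b ?y] by (simp add: add_increasing2)
    next
      case 2
      then have "?a * ?b \<le> k * ?b" by (rule mult_right_mono) simp
      then show ?thesis using k_pos by (simp add: add_increasing)
    next
      case 3
      then have "?a * ?b \<le> ?a * k" by (rule mult_left_mono) simp
      then have "?a * ?b \<le> k * ?a" by (simp add: mult.commute)
      moreover have "0 \<le> of_bool (d dvd g) * (?x * ?y)" "0 \<le> k * ?b" using k_pos by simp_all
      ultimately show ?thesis by linarith
    qed
  qed
  also have "\<dots> = ?h * (?x * ?y) + k * (?x * ?x) + k * (?y * ?y)"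
    using autocorrelation_sum[OF p(1)] autocorrelation_sum[OF p(2)] cnt_multiples[OF d(1,2), of 0]
    by (simp add: sum.distrib sum_distrib_left[symmetric] sum_distrib_right[symmetric] cnt_def)
  finally have "(?x * ?y)\<^sup>2 \<le> n * (?h * (?x * ?y) + k * (?x * ?x) + k * (?y * ?y))"
    using energy[OF p] n_pos by (smt (verit) mult_left_mono)
  also have "\<dots> \<le> n * (?h * (?x * ?y) + k * (?y * ?y) + k * (?y * ?y))"
    using n_pos k_pos xy d(1) by (intro mult_left_mono add_mono mult_mono) (auto simp: pos_imp_zdiv_nonneg_iff)
  finally have 1: "?y * (?x * ?x * ?y) \<le> ?y * (n * ?h * ?x + 2 * n * k * ?y)"
    by (simp add: power2_eq_square algebra_simps)
  have y0: "?y > 0" using big(1) n_pos by linarith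
  have 2: "?x * ?x * ?y \<le> n * ?h * ?x + 2 * n * k * ?y"
    using 1 y0 by (rule mult_left_le_imp_le)
  have "8 * ?h * (n * ?x) \<le> ?x * (n * ?x)" using con n_pos by (intro mult_right_mono) auto
  also have "\<dots> \<le> ?x * (4 * ?y * ?x)" using big(1) by (intro mult_left_mono mult_right_mono) auto
  finally have 3: "2 * (n * ?h * ?x) \<le> ?x * ?x * ?y" by (simp add: algebra_simps)
  have "?x * ?x * ?y \<le> 4 * n * k * ?y" using 2 3 by linarith
  then have "?x * ?x \<le> 4 * n * k" using y0 by simp
  then show False using big(2) by simp
qed

text \<open>
  The number of representations of r in B + X, which is the number of incidences that r adds when it
  is put into Y.
\<close>

definition nu :: "int set \<Rightarrow> int \<Rightarrow> int" where
  "nu X r = int (card {c \<in> B. r - c \<in> X})"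

text \<open>
  For fixed X the functional is additive over the elements of Y, and r contributes nu X r - k. So
  the best Y contains exactly those r with less than k representations.
\<close>

lemma Phi_nu:
  assumes p: "periodic X" "periodic Y"
  shows "Phi X Y = k * (n - cnt X) + (\<Sum>r\<in>{0..<n}. of_bool (r \<in> Y) * (nu X r - k))"
proof -
  have "inc X Y = (\<Sum>c\<in>B. \<Sum>r\<in>{0..<n}. of_bool (r \<in> Y) * of_bool (r - c \<in> X))"
    unfolding inc_def
  proof (rule sum.cong[OF refl])
    fix c
    have "cnt (X \<inter> sh c Y) = cnt (sh (- c) (X \<inter> sh c Y))"
      by (rule cnt_sh[symmetric]) (use p in simp)
    also have "\<dots> = (\<Sum>r\<in>{0..<n}. of_bool (r \<in> Y) * of_bool (r - c \<in> X))"
      unfolding cnt_def by (rule sum.cong) auto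
    finally show "cnt (X \<inter> sh c Y) = (\<Sum>r\<in>{0..<n}. of_bool (r \<in> Y) * of_bool (r - c \<in> X))" .
  qed
  also have "\<dots> = (\<Sum>r\<in>{0..<n}. of_bool (r \<in> Y) * nu X r)"
  proof (subst sum.swap, rule sum.cong[OF refl])
    fix r
    have "(\<Sum>c\<in>B. of_bool (r - c \<in> X)) = nu X r"
      unfolding nu_def using fin_B by (simp add: Int_def)
    then show "(\<Sum>c\<in>B. of_bool (r \<in> Y) * of_bool (r - c \<in> X)) = of_bool (r \<in> Y) * nu X r"
      by (simp add: sum_distrib_left[symmetric])
  qed
  finally have i: "inc X Y = (\<Sum>r\<in>{0..<n}. of_bool (r \<in> Y) * nu X r)" .
  have "(\<Sum>r\<in>{0..<n}. of_bool (r \<in> Y) * (nu X r - k))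
      = (\<Sum>r\<in>{0..<n}. of_bool (r \<in> Y) * nu X r) - cnt Y * k"
    unfolding cnt_def sum_distrib_right sum_subtractf[symmetric]
    by (rule sum.cong) (auto simp: algebra_simps)
  then show ?thesis unfolding Phi_def i by (simp add: algebra_simps)
qed

lemma inc_zero: "Y \<subseteq> {r. \<forall>c\<in>B. r - c \<notin> X} \<Longrightarrow> inc X Y = 0"
proof -
  assume "Y \<subseteq> {r. \<forall>c\<in>B. r - c \<notin> X}"
  then have "X \<inter> sh c Y = {}" if "c \<in> B" for c using that by force
  then show "inc X Y = 0" unfolding inc_def by simp
qed

lemma periodic_nonsums: "periodic X \<Longrightarrow> periodic {r. \<forall>c\<in>B. r - c \<notin> X}"
proof -
  assume p: "periodic X"
  have "r + n - c \<in> X \<longleftrightarrow> r - c \<in> X" for r c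
  proof -
    have "r - c + n \<in> X \<longleftrightarrow> r - c \<in> X" using p unfolding periodic_def by blast
    then show ?thesis by (simp add: algebra_simps)
  qed
  then show ?thesis unfolding periodic_def by simp
qed

text \<open>
  If no r has between 1 and k - 1 representations, the best Y is the complement of B + X. It could
  fail to be admissible only by having less than k elements. In that case it is padded to a set with
  exactly k elements, and in the dual pair this set becomes a first component of size k, which
  contradicts the lower bound s on first components.
\<close>

lemma minim_nonsums:
  assumes m: "minim X Y" and s: "k < s"
    and big: "\<And>X' Y'. adm X' Y' \<Longrightarrow> Phi X' Y' \<le> Phi X Y \<Longrightarrow> s \<le> cnt X'"
    and gap: "\<And>r. nu X r = 0 \<or> k \<le> nu X r"
  shows "minim X {r. \<forall>c\<in>B. r - c \<notin> X}"
proof -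
  define Y1 where "Y1 = {r. \<forall>c\<in>B. r - c \<notin> X}"
  have p: "periodic X" "periodic Y" and kk: "k \<le> cnt X" "k \<le> cnt Y"
    using m by (auto simp: minim_def adm_def)
  have p1: "periodic Y1" unfolding Y1_def by (rule periodic_nonsums) (rule p)
  have Y1: "r \<in> Y1 \<longleftrightarrow> nu X r = 0" for r
    unfolding Y1_def nu_def using fin_B by auto
  have less: "Phi X Z \<le> Phi X Y" if Z: "periodic Z" "Y1 \<subseteq> Z" "Z \<subseteq> Y \<union> Y1" for Z
  proof -
    have "(\<Sum>r\<in>{0..<n}. of_bool (r \<in> Z) * (nu X r - k)) \<le> (\<Sum>r\<in>{0..<n}. of_bool (r \<in> Y) * (nu X r - k))"
    proof (rule sum_mono)
      fix r
      show "of_bool (r \<in> Z) * (nu X r - k) \<le> of_bool (r \<in> Y) * (nu X r - k)"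
      proof (cases "r \<in> Y1")
        case True
        then show ?thesis using Z Y1[of r] k_pos by auto
      next
        case False
        then have "k \<le> nu X r" using Y1[of r] gap[of r] by simp
        then show ?thesis using Z False by auto
      qed
    qed
    then show ?thesis unfolding Phi_nu[OF p(1) Z(1)] Phi_nu[OF p] by simp
  qed
  have "k \<le> cnt Y1"
  proof (rule ccontr)
    assume "\<not> k \<le> cnt Y1"
    then have lt: "cnt Y1 < k" by simp
    let ?U = "(Y \<union> Y1) \<inter> {0..<n}"
    have "cnt Y \<le> cnt (Y \<union> Y1)" by (rule cnt_mono) blast
    then have "nat k \<le> card ?U" using kk(2) unfolding cnt_card by linarith
    moreover have "card (Y1 \<inter> {0..<n}) \<le> nat k" using lt unfolding cnt_card by linarith
    moreover have "Y1 \<inter> {0..<n} \<subseteq> ?U" by blast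
    \<comment> \<open>Every set between Y1 and Y \<union> Y1 has value at most Phi X Y, so one with exactly k
      elements may be chosen.\<close>
    ultimately obtain Z0 where Z0: "Y1 \<inter> {0..<n} \<subseteq> Z0" "Z0 \<subseteq> ?U" "card Z0 = nat k"
      using exists_subset_between[of "Y1 \<inter> {0..<n}" "nat k" ?U] by auto
    define Z where "Z = {x. x mod n \<in> Z0}"
    have pZ: "periodic Z" unfolding periodic_def Z_def by simp
    have "Z \<inter> {0..<n} = Z0" using Z0(2) unfolding Z_def by auto
    then have cZ: "cnt Z = k" using Z0(3) k_pos unfolding cnt_card by simp
    have m0: "x mod n \<in> {0..<n}" for x using n_pos by simp
    have sub: "Y1 \<subseteq> Z" "Z \<subseteq> Y \<union> Y1"
    proof -
      show "Y1 \<subseteq> Z" unfolding Z_def using Z0(1) m0 periodic_mod_iff[OF p1] by blast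
      show "Z \<subseteq> Y \<union> Y1"
        unfolding Z_def using Z0(2) periodic_mod_iff[OF p1] periodic_mod_iff[OF p(2)] by blast
    qed
    have "adm (uminus -` Z) (uminus -` X)"
      unfolding adm_def using pZ p cZ kk by (simp add: cnt_neg)
    moreover have "Phi (uminus -` Z) (uminus -` X) \<le> Phi X Y"
      using less[OF pZ sub] Phi_dual[OF p(1) pZ] by simp
    ultimately have "s \<le> cnt (uminus -` Z)" by (rule big)
    then show False using cnt_neg[OF pZ] cZ s by simp
  qed
  then have a: "adm X Y1" using p p1 kk unfolding adm_def by simp
  have "Phi X Y1 \<le> Phi X Y" by (rule less) (use p1 in auto)
  moreover have "Phi X Y \<le> Phi X Y1" using m a unfolding minim_def by blast
  ultimately have "Phi X Y1 = Phi X Y" by simp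
  then show ?thesis using m a unfolding minim_def Y1_def by simp
qed

text \<open>
  Suppose that X contains x and x + g with g outside its stabiliser H. Then X \<inter> sh g X
  contains a coset of H and has at least k elements, so Y \<inter> sh g Y has fewer than k elements.
  Being a union of cosets of H it is empty. Submodularity now bounds Phi at (X \<union> sh g X, {})
  by Phi X Y, whence |X| + |Y| \<le> |X \<union> sh g X| < 2 |X|, which contradicts |X| \<le> |Y|.
\<close>

lemma minim_coset:
  assumes m: "minim X Y" and Y: "Y = {r. \<forall>c\<in>B. r - c \<notin> X}"
    and d: "d > 0" "d dvd n" "\<And>g. g \<in> stab X \<longleftrightarrow> d dvd g" and hk: "k \<le> n div d"
  shows "\<exists>x. X = {y. d dvd y - x}"
proof -
  have p: "periodic X" "periodic Y" and kk: "k \<le> cnt X" "k \<le> cnt Y"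
    using m by (auto simp: minim_def adm_def)
  have stX: "z + t \<in> X \<longleftrightarrow> z \<in> X" if "d dvd t" for z t
    using d(3)[of t] that unfolding stab_iff by blast
  have stY: "z + t \<in> Y \<longleftrightarrow> z \<in> Y" if "d dvd t" for z t
  proof -
    have "z + t - c \<in> X \<longleftrightarrow> z - c \<in> X" for c
      using stX[OF that, of "z - c"] by (simp add: algebra_simps)
    then show ?thesis unfolding Y by simp
  qed
  have coset_le: "n div d \<le> cnt S" if S: "x \<in> S" "\<And>z t. d dvd t \<Longrightarrow> z \<in> S \<Longrightarrow> z + t \<in> S" for S x
  proof -
    have "{y. d dvd y - x} \<subseteq> S"
    proof
      fix y assume "y \<in> {y. d dvd y - x}"
      then have "x + (y - x) \<in> S" using S by blast
      then show "y \<in> S" by simp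
    qed
    then have "cnt {y. d dvd y - x} \<le> cnt S" by (rule cnt_mono)
    then show ?thesis using cnt_multiples[OF d(1,2), of x] by simp
  qed
  have "X \<noteq> {}" using kk k_pos by auto
  then obtain x where x: "x \<in> X" by blast
  have "X = {y. d dvd y - x}"
  proof (intro equalityI subsetI)
    fix y assume "y \<in> {y. d dvd y - x}"
    then show "y \<in> X" using stX[of "y - x" x] x by simp
  next
    fix y assume y: "y \<in> X"
    show "y \<in> {y. d dvd y - x}"
    proof (rule ccontr)
      assume "y \<notin> {y. d dvd y - x}"
      then have nd: "\<not> d dvd y - x" by simp
      define g where "g = y - x"
      let ?XX = "X \<inter> sh g X" and ?YY = "Y \<inter> sh g Y"
      have hX: "n div d \<le> cnt ?XX"
      proof (rule coset_le)
        show "x \<in> ?XX" using x y by (simp add: g_def)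
        show "z + t \<in> ?XX" if "d dvd t" "z \<in> ?XX" for z t
          using that stX[of t z] stX[of t "z + g"] by (simp add: algebra_simps)
      qed
      have ne: "sh g X \<noteq> X" using nd d(3)[of g] unfolding g_def stab_def by blast
      have "?YY = {}"
      proof (rule ccontr)
        assume "?YY \<noteq> {}"
        then obtain r where r: "r \<in> ?YY" by blast
        have "n div d \<le> cnt ?YY"
        proof (rule coset_le[OF r])
          show "z + t \<in> ?YY" if "d dvd t" "z \<in> ?YY" for z t
            using that stY[of t z] stY[of t "z + g"] by (simp add: algebra_simps)
        qed
        then show False using minim_translate[OF m, of g] ne hX hk by linarith
      qed
      then have "Phi ?XX (Y \<union> sh g Y) + Phi (X \<union> sh g X) {} \<le> Phi X Y + Phi X Y"
        using Phi_submodular[of X "sh g X" Y "sh g Y"] Phi_sh[OF p] by simp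
      moreover have "Phi X Y \<le> Phi ?XX (Y \<union> sh g Y)"
      proof -
        have "cnt Y \<le> cnt (Y \<union> sh g Y)" by (rule cnt_mono) blast
        then have "adm ?XX (Y \<union> sh g Y)" unfolding adm_def using p hX hk kk by simp
        then show ?thesis using m unfolding minim_def by blast
      qed
      ultimately have "Phi (X \<union> sh g X) {} \<le> Phi X Y" by linarith
      moreover have "inc X Y = 0" by (rule inc_zero) (simp add: Y)
      ultimately have "k * (n - cnt (X \<union> sh g X)) \<le> k * (n - cnt X - cnt Y)"
        unfolding Phi_def by simp
      then have "cnt X + cnt Y \<le> cnt (X \<union> sh g X)" using k_pos by simp
      then show False
        using cnt_Un_Int[of X "sh g X"] cnt_sh[OF p(1), of g] minim_dual[OF m] hX hk k_pos by linarith
    qed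
  qed
  then show ?thesis by blast
qed

text \<open>
  The pair (X0, Y0) in the applications consists of B and the complement of its restricted sumset. A
  minimal pair has a large X (Phi_ge), hence a large stabiliser, the multiples of a divisor d of n
  that is at most g0 (stab_large). X is invariant under this subgroup, so every r has either no
  representation in B + X or at least as many as some class of B modulo d has elements, at least k
  by the gap hypothesis. So Y may be taken to be the complement of B + X, X is a coset of the
  subgroup, and the minimum of Phi can be computed: it is k (j - 1) n / d, where j is the number of
  classes modulo d that B meets. The last alternative compares the minimal pair with the pair formed
  by the union of the classes of B and the complement of the union of their sums.
\<close>

theorem few_classes:
  assumes gap: "\<And>d r. 0 < d \<Longrightarrow> d \<le> g0 \<Longrightarrow> {c \<in> B. c mod d = r} \<noteq> {} \<Longrightarrow> k \<le> int (card {c \<in> B. c mod d = r})"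
    and a0: "adm X0 Y0" "Phi X0 Y0 \<le> L"
    and L: "k * s \<le> k * int (card B) - L" "2 * L \<le> k * n"
    and s: "8 * k \<le> s" "4 * n * k < s * s" "8 * n \<le> g0 * s" and B: "B \<noteq> {}"
  obtains d where "d > 0" "d dvd n" "int (card ((\<lambda>c. c mod d) ` B)) < d" "d \<le> g0"
    "k * ((int (card ((\<lambda>c. c mod d) ` B)) - 1) * (n div d)) \<le> L"
    "int (card {(a + b) mod d | a b. a \<in> B \<and> b \<in> B}) = d \<or>
     2 * int (card ((\<lambda>c. c mod d) ` B)) - 1 \<le> int (card {(a + b) mod d | a b. a \<in> B \<and> b \<in> B})"
proof -
  obtain X Y where m: "minim X Y" using exists_minim[OF a0(1)] by blast
  have le: "Phi X Y \<le> L" using m a0 unfolding minim_def by fastforce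
  have big: "s \<le> cnt X'" if "adm X' Y'" "Phi X' Y' \<le> Phi X Y" for X' Y'
  proof -
    have "k * int (card B) - k * cnt X' \<le> L"
      using Phi_ge[of X' Y'] that le unfolding adm_def by force
    then have "k * s \<le> k * cnt X'" using L(1) by linarith
    then show ?thesis using k_pos by simp
  qed
  have p: "periodic X" "periodic Y" and kk: "k \<le> cnt X" "k \<le> cnt Y"
    using m by (auto simp: minim_def adm_def)
  have sX: "s \<le> cnt X" using big m unfolding minim_def by blast
  have "k * (n - cnt X - cnt Y) \<le> L" using le inc_nonneg[of X Y] unfolding Phi_def by linarith
  then have "k * (2 * (n - cnt X - cnt Y)) \<le> k * n" using L(2) by (simp add: algebra_simps)
  then have "2 * (n - cnt X - cnt Y) \<le> n" using k_pos by simp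
  then have nY: "n \<le> 4 * cnt Y" using minim_dual[OF m] by (simp add: algebra_simps)
  obtain d where d: "d > 0" "d dvd n" "\<And>g. g \<in> stab X \<longleftrightarrow> d dvd g"
    using stab_multiples[OF p(1)] by blast
  let ?h = "n div d"
  have nd: "n = d * ?h" using d by simp
  have "s * s \<le> cnt X * cnt X" using sX s k_pos by (intro mult_mono) auto
  then have hX: "cnt X \<le> 8 * ?h" using stab_large[OF m nY _ d] s(2) by linarith
  have hk: "k \<le> ?h" using hX sX s(1) by linarith
  have h0: "?h > 0" using hk k_pos by linarith
  have dg: "d \<le> g0"
  proof -
    have "d * s \<le> d * (8 * ?h)" using sX hX d(1) by (intro mult_left_mono) auto
    also have "\<dots> = 8 * n" using nd by (simp add: algebra_simps)
    finally have "d * s \<le> g0 * s" using s(3) by linarith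
    then show ?thesis using s(1) k_pos by (simp add: mult_le_cancel_right)
  qed
  have stX: "z \<in> X \<Longrightarrow> d dvd t \<Longrightarrow> z + t \<in> X" for z t
    using d(3)[of t] unfolding stab_iff by blast
  have "nu X r = 0 \<or> k \<le> nu X r" for r
  proof (cases "\<exists>c\<in>B. r - c \<in> X")
    case True
    then obtain c where c: "c \<in> B" "r - c \<in> X" by blast
    have "{e \<in> B. e mod d = c mod d} \<subseteq> {e \<in> B. r - e \<in> X}"
    proof
      fix e assume e: "e \<in> {e \<in> B. e mod d = c mod d}"
      then have "d dvd e - c" by (simp add: mod_eq_dvd_iff)
      then have "d dvd c - e" by (subst dvd_diff_commute)
      then have "(r - c) + (c - e) \<in> X" using stX c by blast
      then show "e \<in> {e \<in> B. r - e \<in> X}" using e by simp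
    qed
    then have "card {e \<in> B. e mod d = c mod d} \<le> card {e \<in> B. r - e \<in> X}"
      using fin_B by (intro card_mono) auto
    moreover have "k \<le> int (card {e \<in> B. e mod d = c mod d})"
      using gap[OF d(1) dg, of "c mod d"] c by blast
    ultimately show ?thesis unfolding nu_def by linarith
  next
    case False
    then have "{c \<in> B. r - c \<in> X} = {}" by blast
    then have "nu X r = 0" unfolding nu_def by (simp only: card.empty of_nat_0)
    then show ?thesis by blast
  qed
  then have m1: "minim X {r. \<forall>c\<in>B. r - c \<notin> X}" (is "minim X ?Y1")
  proof -
    assume "\<And>r. nu X r = 0 \<or> k \<le> nu X r"
    then show ?thesis using s(1) k_pos by (intro minim_nonsums[OF m, of s] big) auto
  qed
  obtain x where x: "X = {y. d dvd y - x}" using minim_coset[OF m1 refl d hk] by blast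
  define J where "J = (\<lambda>c. c mod d) ` B"
  define JJ where "JJ = {(a + b) mod d | a b. a \<in> B \<and> b \<in> B}"
  have J: "J \<subseteq> {0..<d}" and JJ: "JJ \<subseteq> {0..<d}" using d(1) unfolding J_def JJ_def by auto
  have fJ: "finite J" "finite JJ" using J JJ finite_subset by blast+
  have "?Y1 = {r. (r - x) mod d \<in> {0..<d} - J}"
  proof (rule set_eqI)
    fix r
    have "(r - c \<notin> X) \<longleftrightarrow> c mod d \<noteq> (r - x) mod d" for c
    proof -
      have "r - c \<in> X \<longleftrightarrow> d dvd (r - x) - c" unfolding x by (simp add: algebra_simps)
      moreover have "(r - x) mod d = c mod d \<longleftrightarrow> d dvd (r - x) - c" by (rule mod_eq_dvd_iff)
      ultimately show ?thesis by metis
    qed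
    then have "r \<in> ?Y1 \<longleftrightarrow> (\<forall>c\<in>B. c mod d \<noteq> (r - x) mod d)" by blast
    also have "\<dots> \<longleftrightarrow> (r - x) mod d \<notin> J" unfolding J_def by (auto simp: image_iff)
    finally show "r \<in> ?Y1 \<longleftrightarrow> r \<in> {r. (r - x) mod d \<in> {0..<d} - J}"
      using d(1) by simp
  qed
  then have "cnt ?Y1 = ?h * int (card ({0..<d} - J))"
    using cnt_residue_classes[OF d(1,2), of "{0..<d} - J" x] by simp
  also have "int (card ({0..<d} - J)) = d - int (card J)"
    using J fJ d(1) card_mono[OF _ J] by (simp add: card_Diff_subset of_nat_diff)
  finally have cY1: "cnt ?Y1 = ?h * (d - int (card J))" .
  have PhiX: "Phi X ?Y1 = k * ((int (card J) - 1) * ?h)"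
  proof -
    have "inc X ?Y1 = 0" by (rule inc_zero) simp
    moreover have "n - cnt X - cnt ?Y1 = (int (card J) - 1) * ?h"
      using cY1 nd cnt_multiples[OF d(1,2), of x] x by (simp add: algebra_simps)
    ultimately show ?thesis unfolding Phi_def by simp
  qed
  have "0 < cnt ?Y1" using m1 k_pos unfolding minim_def adm_def by linarith
  then have jd: "int (card J) < d" using cY1 h0 by (simp add: zero_less_mult_iff)
  have PhiL: "k * ((int (card J) - 1) * ?h) \<le> L"
    using PhiX m1 a0 unfolding minim_def by fastforce
  have "int (card JJ) = d \<or> 2 * int (card J) - 1 \<le> int (card JJ)"
  proof (cases "JJ = {0..<d}")
    case True
    then show ?thesis using d(1) by simp
  next
    case False
    let ?X' = "{y. y mod d \<in> J}" and ?Y' = "{y. y mod d \<in> {0..<d} - JJ}"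
    have cX': "cnt ?X' = ?h * int (card J)"
      using cnt_residue_classes[OF d(1,2) J, of 0] by simp
    have "int (card ({0..<d} - JJ)) = d - int (card JJ)"
      using JJ fJ d(1) card_mono[OF _ JJ] by (simp add: card_Diff_subset of_nat_diff)
    then have cY': "cnt ?Y' = ?h * (d - int (card JJ))"
      using cnt_residue_classes[OF d(1,2), of "{0..<d} - JJ" 0] by simp
    have j1: "1 \<le> int (card J)" using B fJ unfolding J_def by (simp add: Suc_leI card_gt_0_iff)
    have jj1: "1 \<le> d - int (card JJ)"
      using False JJ d(1) psubset_card_mono[of "{0..<d}" JJ] by fastforce
    have "?h * 1 \<le> cnt ?X'" "?h * 1 \<le> cnt ?Y'"
      unfolding cX' cY' using j1 jj1 h0 by (intro mult_left_mono; simp)+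
    moreover have "periodic ?X'" "periodic ?Y'"
      using periodic_residue_classes[OF d(2), of 0 J] periodic_residue_classes[OF d(2), of 0 "{0..<d} - JJ"]
      by (simp_all only: diff_0_right)
    ultimately have "adm ?X' ?Y'" unfolding adm_def using hk by simp
    then have "k * ((int (card J) - 1) * ?h) \<le> Phi ?X' ?Y'"
      using PhiX m1 unfolding minim_def by fastforce
    moreover have "inc ?X' ?Y' = 0"
    proof (rule inc_zero, rule subsetI)
      fix r assume r: "r \<in> ?Y'"
      have "r - c \<notin> ?X'" if c: "c \<in> B" for c
      proof
        assume "r - c \<in> ?X'"
        then obtain b where b: "b \<in> B" "(r - c) mod d = b mod d" unfolding J_def by auto
        then have "(r - c + c) mod d = (b + c) mod d" by (metis mod_add_left_eq)
        then have "r mod d \<in> JJ" unfolding JJ_def using b c by force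
        then show False using r by simp
      qed
      then show "r \<in> {r. \<forall>c\<in>B. r - c \<notin> ?X'}" by blast
    qed
    moreover have "n - cnt ?X' - cnt ?Y' = (int (card JJ) - int (card J)) * ?h"
      unfolding cX' cY' using nd by (simp add: algebra_simps)
    ultimately have "k * ((int (card J) - 1) * ?h) \<le> k * ((int (card JJ) - int (card J)) * ?h)"
      unfolding Phi_def by simp
    then have "int (card J) - 1 \<le> int (card JJ) - int (card J)" using k_pos h0 by simp
    then show ?thesis by linarith
  qed
  then show ?thesis using that[OF d(1,2) _ dg] jd PhiL unfolding J_def JJ_def by blast
qed

end

section \<open>Counting restricted sums by residue classes\<close>

text \<open>
  Choose a largest family T of residue classes to moduli up to g0 that covers at most k |T| elements
  of B, and delete these elements. A class that met the rest in fewer than k elements could be added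
  to T.
\<close>

lemma remove_sparse_classes:
  fixes B :: "int set" and k g0 :: nat
  assumes fin: "finite B"
  obtains B1 where "B1 \<subseteq> B" "card B \<le> card B1 + k * g0\<^sup>2"
    "\<And>d r. 0 < d \<Longrightarrow> d \<le> int g0 \<Longrightarrow> {c \<in> B1. c mod d = r} \<noteq> {} \<Longrightarrow> k \<le> card {c \<in> B1. c mod d = r}"
proof -
  define cl :: "int \<times> int \<Rightarrow> int set" where "cl p = {c. c mod fst p = snd p}" for p
  let ?T0 = "{1..int g0} \<times> {0..<int g0}"
  have fT0: "finite ?T0" and cT0: "card ?T0 = g0\<^sup>2" by (simp_all add: power2_eq_square)
  define good where "good T \<longleftrightarrow> T \<subseteq> ?T0 \<and> card (B \<inter> \<Union>(cl ` T)) \<le> k * card T" for T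
  have "good {}" by (simp add: good_def)
  moreover have "good T \<Longrightarrow> card T \<le> g0\<^sup>2" for T
    unfolding good_def using card_mono[OF fT0, of T] cT0 by simp
  then have "\<forall>S. good S \<longrightarrow> card S < g0\<^sup>2 + 1" by (simp add: less_Suc_eq_le)
  ultimately obtain T where T: "good T" "\<And>S. good S \<Longrightarrow> card S \<le> card T"
    using ex_has_greatest_nat[of good "{}" card "g0\<^sup>2 + 1"] by blast
  have T0: "T \<subseteq> ?T0" using T(1) by (simp add: good_def)
  have fT: "finite T" using T0 fT0 by (rule finite_subset)
  define B1 where "B1 = B - \<Union>(cl ` T)"
  have "card B = card (B \<inter> \<Union>(cl ` T)) + card B1"
    unfolding B1_def using fin by (metis card_Int_Diff)
  moreover have "k * card T \<le> k * g0\<^sup>2" using card_mono[OF fT0 T0] cT0 by simp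
  ultimately have c: "card B \<le> card B1 + k * g0\<^sup>2" using T(1) unfolding good_def by linarith
  have "k \<le> card {c \<in> B1. c mod d = r}"
    if d: "0 < d" "d \<le> int g0" and ne: "{c \<in> B1. c mod d = r} \<noteq> {}" for d r
  proof (rule ccontr)
    assume "\<not> ?thesis"
    then have lt: "card {c \<in> B1. c mod d = r} \<le> k" by simp
    obtain c where c: "c \<in> B1" "c mod d = r" using ne by blast
    have nT: "(d, r) \<notin> T" using c unfolding B1_def cl_def by force
    have rr: "0 \<le> r" "r < d" using c d by auto
    have "B \<inter> \<Union>(cl ` insert (d, r) T) \<subseteq> (B \<inter> \<Union>(cl ` T)) \<union> {c \<in> B1. c mod d = r}"
      unfolding B1_def cl_def by auto
    then have "card (B \<inter> \<Union>(cl ` insert (d, r) T)) \<le> card ((B \<inter> \<Union>(cl ` T)) \<union> {c \<in> B1. c mod d = r})"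
      using fin unfolding B1_def by (intro card_mono) auto
    also have "\<dots> \<le> card (B \<inter> \<Union>(cl ` T)) + card {c \<in> B1. c mod d = r}" by (rule card_Un_le)
    also have "\<dots> \<le> k * card T + k" using T(1) lt unfolding good_def by simp
    also have "\<dots> = k * card (insert (d, r) T)" using nT fT by simp
    finally have "good (insert (d, r) T)"
      unfolding good_def using T0 d rr by auto
    then have "card (insert (d, r) T) \<le> card T" by (rule T(2))
    then show False using nT fT by simp
  qed
  then show ?thesis using that[of B1] c unfolding B1_def by blast
qed

lemma card_fibres:
  fixes S :: "int set"
  assumes "finite S" "d > 0"
  shows "card S = (\<Sum>r\<in>{0..<d}. card {s \<in> S. s mod d = r})"
proof -
  have "S = (\<Union>r\<in>{0..<d}. {s \<in> S. s mod d = r})" using assms by auto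
  then have "card S = card (\<Union>r\<in>{0..<d}. {s \<in> S. s mod d = r})" by simp
  also have "\<dots> = (\<Sum>r\<in>{0..<d}. card {s \<in> S. s mod d = r})"
    by (rule card_UN_disjoint) (use assms in auto)
  finally show ?thesis .
qed

text \<open>
  Every residue in U is hit by a restricted sum of P, and the residues r in B other than 0 are hit
  twice, by 0 + r and by l + r.
\<close>

lemma cyclic_count:
  fixes l :: int
  assumes P: "P \<subseteq> {0..l}" "0 \<in> P" "l \<in> P" and l: "l > 0"
    and B: "B = P - {l}"
    and U: "U = {r \<in> {0..<l}. \<exists>x\<in>B. \<exists>y\<in>B. x \<noteq> y \<and> (x + y) mod l = r}"
  shows "card U + card B \<le> card (rsum P) + 1"
proof -
  have fP: "finite P" using P(1) finite_subset by blast
  have fR: "finite (rsum P)" using fP by (rule finite_rsum)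
  have Bs: "B \<subseteq> {0..<l}" using P(1) B by auto
  have B0: "0 \<in> B" using P(2) B l by simp
  have Us: "U \<subseteq> {0..<l}" using U by blast
  have "(\<Sum>r\<in>{0..<l}. of_bool (r \<in> U) + of_bool (r \<in> B - {0})) \<le> (\<Sum>r\<in>{0..<l}. card {s \<in> rsum P. s mod l = r})"
  proof (rule sum_mono)
    fix r assume r: "r \<in> {0..<l}"
    have fin: "finite {s \<in> rsum P. s mod l = r}" using fR by simp
    show "of_bool (r \<in> U) + of_bool (r \<in> B - {0}) \<le> card {s \<in> rsum P. s mod l = r}"
    proof (cases "r \<in> B - {0}")
      case True
      then have "r \<in> P" "r \<noteq> l" "r \<noteq> 0" using B by auto
      then have "0 + r \<in> rsum P" "l + r \<in> rsum P" using P by (intro rsumI; simp)+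
      then have "{r, l + r} \<subseteq> {s \<in> rsum P. s mod l = r}" using r by auto
      then have "card {r, l + r} \<le> card {s \<in> rsum P. s mod l = r}" using fin by (rule card_mono[rotated])
      then show ?thesis using l by auto
    next
      case F: False
      show ?thesis
      proof (cases "r \<in> U")
        case True
        then obtain x y where "x \<in> B" "y \<in> B" "x \<noteq> y" "(x + y) mod l = r" using U by blast
        then have "x + y \<in> {s \<in> rsum P. s mod l = r}" using B by (auto intro: rsumI)
        then have "card {s \<in> rsum P. s mod l = r} \<noteq> 0" using fin by (metis card_eq_0_iff empty_iff)
        then show ?thesis by (simp only: F True of_bool_eq)
      qed (simp only: F of_bool_eq)
    qed
  qed
  moreover have "(\<Sum>r\<in>{0..<l}. of_bool (r \<in> U) + of_bool (r \<in> B - {0})) = card U + card (B - {0})"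
  proof -
    have "{0..<l} \<inter> U = U" "{0..<l} \<inter> (B - {0}) = B - {0}" using Us Bs by auto
    moreover have "(\<Sum>r\<in>{0..<l}. of_bool (r \<in> W)) = card ({0..<l} \<inter> W)" for W
      by (simp add: Int_def)
    ultimately show ?thesis unfolding sum.distrib by metis
  qed
  moreover have "card (rsum P) = (\<Sum>r\<in>{0..<l}. card {s \<in> rsum P. s mod l = r})"
    by (rule card_fibres[OF fR l])
  moreover have "card B \<le> card (B - {0}) + 1" by (auto simp: card_Diff_singleton_if)
  ultimately show ?thesis by linarith
qed

text \<open>
  For each r the set B and its reflection r - B modulo l have at least l + 3 elements, counted with
  multiplicity. So at least three x in B have r - x in B modulo l, while r = 2x modulo l for at most
  two of them. Hence every residue is a restricted sum, and the double residues of cyclic_count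
  supply the rest.
\<close>

lemma dense_rsum:
  fixes l :: int
  assumes P: "P \<subseteq> {0..l}" "0 \<in> P" "l \<in> P" and l: "l + 5 \<le> 2 * int (card P)"
  shows "int (card P) + l \<le> int (card (rsum P)) + 2"
proof (cases "l > 0")
  case True
  define B where "B = P - {l}"
  define U where "U = {r \<in> {0..<l}. \<exists>x\<in>B. \<exists>y\<in>B. x \<noteq> y \<and> (x + y) mod l = r}"
  have fP: "finite P" using P(1) finite_subset by blast
  have Bs: "B \<subseteq> {0..<l}" using P(1) unfolding B_def by auto
  have fB: "finite B" using fP unfolding B_def by simp
  have cB: "int (card B) = int (card P) - 1"
  proof -
    have "card P > 0" using P(2) fP card_gt_0_iff by blast
    then show ?thesis unfolding B_def using P(3) by (simp add: of_nat_diff)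
  qed
  have "{0..<l} \<subseteq> U"
  proof
    fix r assume r: "r \<in> {0..<l}"
    define \<phi> where "\<phi> x = (r - x) mod l" for x
    have inj: "inj_on \<phi> B"
    proof (rule inj_onI)
      fix x y assume "x \<in> B" "y \<in> B" "\<phi> x = \<phi> y"
      then have "l dvd y - x" unfolding \<phi>_def by (simp add: mod_eq_dvd_iff)
      moreover have "\<bar>y - x\<bar> < l"
      proof -
        have "0 \<le> x" "x < l" "0 \<le> y" "y < l" using Bs \<open>x \<in> B\<close> \<open>y \<in> B\<close> by auto
        then show ?thesis by linarith
      qed
      ultimately show "x = y" using dvd_imp_le_int[of "y - x" l] True by fastforce
    qed
    have im: "\<phi> ` B \<subseteq> {0..<l}" using True unfolding \<phi>_def by auto
    have "card (B \<union> \<phi> ` B) \<le> card {0..<l}" using im Bs by (intro card_mono) auto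
    moreover have "card (B \<union> \<phi> ` B) + card (B \<inter> \<phi> ` B) = card B + card (\<phi> ` B)"
      by (rule card_Un_Int[symmetric]) (use fB in auto)
    moreover have "card (\<phi> ` B) = card B" by (rule card_image[OF inj])
    ultimately have "2 * int (card B) \<le> l + int (card (B \<inter> \<phi> ` B))" using True by simp
    then have three: "3 \<le> card (B \<inter> \<phi> ` B)" using cB l by linarith
    have fB': "finite {x \<in> B. \<phi> x \<in> B}" using fB by simp
    have "card (B \<inter> \<phi> ` B) \<le> card (\<phi> ` {x \<in> B. \<phi> x \<in> B})" using fB' by (intro card_mono) auto
    also have "\<dots> \<le> card {x \<in> B. \<phi> x \<in> B}" using fB' by (rule card_image_le)
    finally have "card (B \<inter> \<phi> ` B) \<le> card {x \<in> B. \<phi> x \<in> B}" .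
    moreover have "card {x \<in> B. \<phi> x = x} \<le> 2"
    proof -
      have "{x \<in> B. \<phi> x = x} \<subseteq> {r div 2, (r + l) div 2}"
      proof
        fix x assume x: "x \<in> {x \<in> B. \<phi> x = x}"
        then have xl: "0 \<le> x" "x < l" using Bs by auto
        have "(r - x) mod l = x mod l" using x xl unfolding \<phi>_def by simp
        then have "l dvd r - 2 * x" by (simp add: mod_eq_dvd_iff algebra_simps)
        then obtain m where m: "r - 2 * x = l * m" by (rule dvdE)
        have "0 \<le> r" "r < l" using r by auto
        then have "l * (- 2) < l * m" "l * m < l * 1" using m xl by linarith+
        then have "- 2 < m" "m < 1" using True by (simp_all only: mult_less_cancel_left_pos)
        then have "m = 0 \<or> m = - 1" by linarith
        then show "x \<in> {r div 2, (r + l) div 2}" using m by auto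
      qed
      then have "card {x \<in> B. \<phi> x = x} \<le> card {r div 2, (r + l) div 2}" by (intro card_mono) auto
      also have "\<dots> \<le> 2" by (simp add: card_insert_if)
      finally show ?thesis .
    qed
    ultimately have "card {x \<in> B. \<phi> x = x} < card {x \<in> B. \<phi> x \<in> B}" using three by linarith
    then have "\<not> {x \<in> B. \<phi> x \<in> B} \<subseteq> {x \<in> B. \<phi> x = x}"
      using fB card_mono[of "{x \<in> B. \<phi> x = x}" "{x \<in> B. \<phi> x \<in> B}"] by auto
    then obtain x where x: "x \<in> B" "\<phi> x \<in> B" "\<phi> x \<noteq> x" by blast
    moreover have "(x + \<phi> x) mod l = r" using r unfolding \<phi>_def by (simp add: mod_simps)
    ultimately show "r \<in> U" unfolding U_def using r by (metis (mono_tags, lifting) mem_Collect_eq)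
  qed
  moreover have "finite U" by (rule finite_subset[of _ "{0..<l}"]) (auto simp: U_def)
  ultimately have "card {0..<l} \<le> card U" by (intro card_mono)
  then have "l \<le> int (card U)" using True by simp
  then show ?thesis using cyclic_count[OF P True B_def U_def] cB by linarith
next
  case False
  have fP: "finite P" using P(1) finite_subset by blast
  have "P \<subseteq> {0}" using P(1) False by auto
  then have "card P \<le> 1" using card_mono[of "{0}" P] by simp
  moreover have "l \<ge> 0" using P by auto
  ultimately show ?thesis using False by linarith
qed

text \<open>
  Let beta be the size of a largest class and D i the deficit of the class i, with sum s. Adding the
  largest class to all classes gives restricted sums in j classes, and at least j - 1 further
  classes of sums are filled by two classes each. The full size of these is about 2 beta (j - 1),
  diminished by deficits. A class sum uses two classes, so the loss is at most s for each further
  class of sums, except when both classes agree; since the sums i + i are determined by i, these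
  exceptions cost at most s altogether. The remaining count is (j + 1) |B| - (j - 2) (j - 1) beta,
  up to a multiple of j, and the last hypothesis gives (j - 1) beta \<le> |B|.
\<close>

lemma class_count:
  fixes B :: "int set" and d :: int
  defines "J \<equiv> (\<lambda>c. c mod d) ` B" and "JJ \<equiv> {(a + b) mod d | a b. a \<in> B \<and> b \<in> B}"
  assumes fin: "finite B" and d: "d > 0" and j2: "2 \<le> card J" and jj: "2 * card J \<le> card JJ + 1"
    and h: "\<And>i. int (card {c \<in> B. c mod d = i}) \<le> h" and hj: "(int (card J) - 1) * h \<le> int (card B)"
  shows "3 * int (card B) \<le> int (card (rsum B)) + 6 * int (card J)"
proof -
  define cl where "cl i = {c \<in> B. c mod d = i}" for i
  define b where "b i = int (card (cl i))" for i
  define N where "N i = int (card {s \<in> rsum B. s mod d = i})" for i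
  have fJ: "finite J" unfolding J_def using fin by simp
  have Js: "J \<subseteq> {0..<d}" unfolding J_def using d by auto
  have JJs: "JJ \<subseteq> {0..<d}" unfolding JJ_def using d by auto
  have fJJ: "finite JJ" using JJs finite_subset by blast
  have fR: "finite (rsum B)" using fin by (rule finite_rsum)
  have fcl: "finite (cl i)" for i unfolding cl_def using fin by simp
  have cne: "cl i \<noteq> {}" if "i \<in> J" for i using that unfolding J_def cl_def by auto
  have pair: "b i + b i' \<le> N ((i + i') mod d) + 3" if "i \<in> J" "i' \<in> J" for i i'
  proof -
    have "{x + y | x y. x \<in> cl i \<and> y \<in> cl i' \<and> x \<noteq> y} \<subseteq> {s \<in> rsum B. s mod d = (i + i') mod d}"
      unfolding cl_def rsum_def by (auto simp: mod_simps)
    then have "card {x + y | x y. x \<in> cl i \<and> y \<in> cl i' \<and> x \<noteq> y} \<le> card {s \<in> rsum B. s mod d = (i + i') mod d}"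
      using fR by (intro card_mono) auto
    then show ?thesis
      using card_distinct_sums[OF fcl fcl cne[OF that(1)] cne[OF that(2)]] unfolding b_def N_def by linarith
  qed
  have bsum: "(\<Sum>i\<in>J. b i) = int (card B)"
  proof -
    have "card B = card (\<Union>i\<in>J. cl i)" by (rule arg_cong[where f = card]) (auto simp: cl_def J_def)
    also have "\<dots> = (\<Sum>i\<in>J. card (cl i))"
      by (rule card_UN_disjoint) (use fJ fcl in \<open>auto simp: cl_def\<close>)
    finally show ?thesis unfolding b_def by simp
  qed
  have Jne: "J \<noteq> {}" using j2 by auto
  define \<beta> where "\<beta> = Max (b ` J)"
  have "\<beta> \<in> b ` J" unfolding \<beta>_def using fJ Jne by (intro Max_in) auto
  then obtain i0 where i0: "i0 \<in> J" "b i0 = \<beta>" by blast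
  have \<beta>: "b i \<le> \<beta>" if "i \<in> J" for i unfolding \<beta>_def using fJ that by simp
  define D where "D i = \<beta> - b i" for i
  have D0: "0 \<le> D i" if "i \<in> J" for i using \<beta>[OF that] by (simp add: D_def)
  let ?j = "int (card J)"
  define s where "s = (\<Sum>i\<in>J. D i)"
  have s: "s = ?j * \<beta> - int (card B)" unfolding s_def D_def by (simp add: sum_subtractf bsum)
  \<comment> \<open>S1 are the classes reached from the largest class i0, S2 further classes of sums.\<close>
  define S1 where "S1 = (\<lambda>i. (i0 + i) mod d) ` J"
  have inj: "inj_on (\<lambda>i. (i0 + i) mod d) J"
  proof (rule inj_onI)
    fix i i' assume a: "i \<in> J" "i' \<in> J" "(i0 + i) mod d = (i0 + i') mod d"
    then have "d dvd i - i'" by (simp add: mod_eq_dvd_iff)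
    then have "i mod d = i' mod d" by (simp add: mod_eq_dvd_iff)
    then show "i = i'" using a Js by (metis atLeastLessThan_iff mod_pos_pos_trivial subsetD)
  qed
  have JJ': "JJ = {(i + i') mod d | i i'. i \<in> J \<and> i' \<in> J}"
  proof (intro set_eqI iffI)
    fix t assume "t \<in> JJ"
    then obtain a b where "a \<in> B" "b \<in> B" "t = (a + b) mod d" unfolding JJ_def by blast
    then have "a mod d \<in> J" "b mod d \<in> J" "t = (a mod d + b mod d) mod d"
      unfolding J_def by (auto simp: mod_add_eq)
    then show "t \<in> {(i + i') mod d | i i'. i \<in> J \<and> i' \<in> J}" by blast
  next
    fix t assume "t \<in> {(i + i') mod d | i i'. i \<in> J \<and> i' \<in> J}"
    then obtain a b where "a \<in> B" "b \<in> B" "t = (a mod d + b mod d) mod d" unfolding J_def by blast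
    then have "a \<in> B" "b \<in> B" "t = (a + b) mod d" by (auto simp: mod_add_eq)
    then show "t \<in> JJ" unfolding JJ_def by blast
  qed
  have S1s: "S1 \<subseteq> JJ" unfolding S1_def JJ' using i0 by blast
  have cS1: "card S1 = card J" unfolding S1_def by (rule card_image[OF inj])
  have "card J - 1 \<le> card (JJ - S1)"
    using S1s jj cS1 fJJ finite_subset[OF S1s fJJ] by (simp add: card_Diff_subset)
  then obtain S2 where S2: "S2 \<subseteq> JJ - S1" "card S2 = card J - 1" "finite S2"
    by (rule obtain_subset_with_card_n)
  have cS2: "int (card S2) = ?j - 1" using S2(2) j2 by simp
  have "\<exists>i i'. i \<in> J \<and> i' \<in> J \<and> (i + i') mod d = t" if "t \<in> S2" for t
    using that S2(1) unfolding JJ' by blast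
  then obtain f g where fg: "\<And>t. t \<in> S2 \<Longrightarrow> f t \<in> J \<and> g t \<in> J \<and> (f t + g t) mod d = t"
    by metis
  have "(\<Sum>t\<in>S2. D (f t) + D (g t)) \<le> (\<Sum>t\<in>S2. s + of_bool (f t = g t) * D (f t))"
  proof (rule sum_mono)
    fix t assume t: "t \<in> S2"
    have Dle: "D (f t) \<le> s" unfolding s_def using fg[OF t] D0 fJ by (intro member_le_sum) auto
    show "D (f t) + D (g t) \<le> s + of_bool (f t = g t) * D (f t)"
    proof (cases "f t = g t")
      case True
      then show ?thesis using Dle by simp
    next
      case False
      then have "D (f t) + D (g t) = (\<Sum>i\<in>{f t, g t}. D i)" by simp
      also have "\<dots> \<le> s" unfolding s_def using fg[OF t] D0 fJ by (intro sum_mono2) auto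
      finally show ?thesis using False by simp
    qed
  qed
  also have "\<dots> = (?j - 1) * s + (\<Sum>t\<in>S2. of_bool (f t = g t) * D (f t))"
    by (simp add: sum.distrib cS2)
  also have "(\<Sum>t\<in>S2. of_bool (f t = g t) * D (f t)) = (\<Sum>t\<in>{t \<in> S2. f t = g t}. D (f t))"
    unfolding sum.inter_filter[OF S2(3)] by (rule sum.cong) auto
  also have "\<dots> = (\<Sum>i\<in>f ` {t \<in> S2. f t = g t}. D i)"
  proof (rule sum.reindex[symmetric, unfolded comp_def])
    show "inj_on f {t \<in> S2. f t = g t}"
      using fg by (intro inj_onI) (metis (mono_tags, lifting) mem_Collect_eq)
  qed
  also have "\<dots> \<le> s" unfolding s_def using fJ D0 fg by (intro sum_mono2) auto
  finally have loss: "(\<Sum>t\<in>S2. D (f t) + D (g t)) \<le> ?j * s" by (simp add: algebra_simps)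
  have "?j * \<beta> + int (card B) - 3 * ?j = (\<Sum>i\<in>J. b i0 + b i - 3)"
    using i0 by (simp add: sum.distrib sum_subtractf bsum)
  also have "\<dots> \<le> (\<Sum>i\<in>J. N ((i0 + i) mod d))"
    using pair i0 by (intro sum_mono) force
  also have "\<dots> = (\<Sum>t\<in>S1. N t)" unfolding S1_def using inj by (simp add: sum.reindex)
  finally have 1: "?j * \<beta> + int (card B) - 3 * ?j \<le> (\<Sum>t\<in>S1. N t)" .
  have "(?j - 1) * (2 * \<beta> - 3) - (\<Sum>t\<in>S2. D (f t) + D (g t)) = (\<Sum>t\<in>S2. b (f t) + b (g t) - 3)"
    by (simp add: D_def sum.distrib sum_subtractf cS2 algebra_simps)
  also have "\<dots> \<le> (\<Sum>t\<in>S2. N t)"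
    using pair fg by (intro sum_mono) (smt (verit) fg pair)
  finally have 2: "(?j - 1) * (2 * \<beta> - 3) - (\<Sum>t\<in>S2. D (f t) + D (g t)) \<le> (\<Sum>t\<in>S2. N t)" .
  have "(\<Sum>t\<in>S1. N t) + (\<Sum>t\<in>S2. N t) = (\<Sum>t\<in>S1 \<union> S2. N t)"
    by (rule sum.union_disjoint[symmetric]) (use S2 finite_subset[OF S1s fJJ] in auto)
  also have "\<dots> \<le> (\<Sum>t\<in>{0..<d}. N t)"
    by (rule sum_mono2) (use S1s S2 JJs in \<open>auto simp: N_def\<close>)
  also have "\<dots> = int (card (rsum B))" using card_fibres[OF fR d] unfolding N_def by simp
  finally have 3: "(\<Sum>t\<in>S1. N t) + (\<Sum>t\<in>S2. N t) \<le> int (card (rsum B))" .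
  have "(?j - 1) * \<beta> \<le> (?j - 1) * h"
    using h[of i0] i0 j2 unfolding b_def cl_def by (intro mult_left_mono) auto
  then have "(?j - 1) * \<beta> \<le> int (card B)" using hj by linarith
  then have "(?j - 2) * ((?j - 1) * \<beta>) \<le> (?j - 2) * int (card B)"
    using j2 by (intro mult_left_mono) auto
  moreover have "?j * \<beta> + int (card B) - 3 * ?j + (?j - 1) * (2 * \<beta> - 3) - ?j * s
      = (?j + 1) * int (card B) - (?j - 2) * ((?j - 1) * \<beta>) - 6 * ?j + 3"
    unfolding s by (simp add: algebra_simps)
  \<comment> \<open>The bound on h turns (j + 1) |B| - (j - 2) (j - 1) beta into at least 3 |B|.\<close>
  ultimately have "3 * int (card B) - 6 * ?j + 3 \<le> ?j * \<beta> + int (card B) - 3 * ?j + (?j - 1) * (2 * \<beta> - 3) - ?j * s"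
    by (simp add: algebra_simps)
  then show ?thesis using 1 2 3 loss by linarith
qed

section \<open>Few restricted sums force a residue class\<close>

text \<open>
  Here b and b1 are the sizes of a set before and after the deletion of at most R elements, n is the
  modulus and u the number of restricted sums modulo n. With weight k = 4q, class bound g0 = 384q
  and s = b / (4q), rounded down, all requirements of few_classes hold as soon as b is large in
  terms of q. The bound on u leaves a margin: 2 k b1 - k u - b1 is at least about 3b, more than k s
  \<le> b.
\<close>

lemma parameter_inequalities:
  fixes q R b u b1 s n :: int
  assumes q: "q \<ge> 1" and R: "R \<ge> 0" and b: "b \<ge> 20 * (q * R) + 10000 * q ^ 3"
    and u: "q * u \<le> (2 * q - 1) * b + 4 * q" and b1: "b - R \<le> b1" "b1 \<le> b"
    and s: "4 * q * s \<le> b" "b < 4 * q * (s + 1)" and n: "2 * b - 2 \<le> n" "n \<le> 5 * b + 5"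
  shows "4 * q \<le> n - u" "4 * q \<le> b1"
    "4 * q * s \<le> 4 * q * b1 - (4 * q * (u - b1) + b1)"
    "2 * (4 * q * (u - b1) + b1) < 4 * q * n"
    "8 * (4 * q) \<le> s" "4 * n * (4 * q) < s * s" "8 * n \<le> 384 * q * s" "0 \<le> s"
    "q * (3 * R + 3 + 6 * (384 * q)) < b"
proof -
  have qq: "q * q \<ge> q" using q mult_mono[of 1 q q q] by simp
  have q3: "q ^ 3 \<ge> q * q" using q qq mult_left_mono[of q "q * q" q] mult_left_mono[of 1 q "q * q"]
    by (simp add: power3_eq_cube mult.assoc)
  have qR: "q * R \<ge> R" using q R mult_right_mono[of 1 q R] by simp
  have bigb: "b \<ge> 10000" using b qR q3 qq q R by linarith
  have qb1: "q * b1 \<le> q * b" using mult_left_mono[of b1 b q] b1 q by simp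
  have qb2: "q * b - q * R \<le> q * b1" using mult_left_mono[of "b - R" b1 q] b1 q by (simp add: algebra_simps)
  have qn: "2 * (q * b) - 2 * q \<le> q * n" using mult_left_mono[of "2 * b - 2" n q] n q by (simp add: algebra_simps)
  have qn': "q * n \<le> 5 * (q * b) + 5 * q" using mult_left_mono[of n "5 * b + 5" q] n q by (simp add: algebra_simps)
  have u': "q * u \<le> 2 * (q * b) - b + 4 * q" using u by (simp add: algebra_simps)
  show "4 * q \<le> n - u"
  proof -
    have "4 * (q * q) + q * u \<le> q * n" using u' qn b q3 qq q qR R by linarith
    then have "q * (4 * q) \<le> q * (n - u)" by (simp add: algebra_simps)
    then show ?thesis using q by simp
  qed
  show "4 * q \<le> b1" using b b1 q3 qq q qR R by linarith
  have s': "4 * (q * s) \<le> b" "b < 4 * (q * s) + 4 * q" using s by (simp_all add: algebra_simps)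
  show "4 * q * s \<le> 4 * q * b1 - (4 * q * (u - b1) + b1)"
  proof -
    have "4 * (q * s) + 4 * (q * u) + b1 \<le> 8 * (q * b1)" using s' u' qb2 b1 b q3 qq q qR R by linarith
    then show ?thesis by (simp add: algebra_simps)
  qed
  show "2 * (4 * q * (u - b1) + b1) < 4 * q * n"
  proof -
    have "8 * (q * u) + 2 * b1 < 4 * (q * n) + 8 * (q * b1)" using qn u' qb2 b1 b q3 qq q qR R by linarith
    then show ?thesis by (simp add: algebra_simps)
  qed
  have sb: "641 * (q * q) \<le> s"
  proof (rule ccontr)
    assume "\<not> ?thesis"
    then have "q * (s + 1) \<le> q * (641 * (q * q))" using q by (intro mult_left_mono) auto
    then have "q * s + q \<le> 641 * q ^ 3" by (simp add: algebra_simps power3_eq_cube)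
    then show False using s' b q3 qq q qR R by linarith
  qed
  show "8 * (4 * q) \<le> s" using sb qq q by linarith
  show s0: "0 \<le> s" using sb qq q by linarith
  show "8 * n \<le> 384 * q * s" using s' n b q3 qq q qR R by linarith
  show "4 * n * (4 * q) < s * s"
  proof -
    have "q * b \<le> q * (4 * (q * s) + 4 * q)" using s' q by (intro mult_left_mono) auto
    then have 1: "q * b \<le> 4 * (q * q * s) + 4 * (q * q)" by (simp add: algebra_simps)
    have 2: "641 * (q * q) * s \<le> s * s" using sb s0 by (intro mult_right_mono)
    have 3: "q * q * 641 \<le> q * q * s" using sb qq q by (intro mult_left_mono) linarith+
    have 4: "641 * (q * q * s) \<le> s * s" using 2 by (simp add: mult.assoc)
    have "16 * (q * n) < s * s" using 1 3 4 qn' qq q by linarith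
    then show ?thesis by (simp add: algebra_simps)
  qed
  show "q * (3 * R + 3 + 6 * (384 * q)) < b"
  proof -
    have "q * 3 + 3 * (q * R) + 2304 * (q * q) < b" using b q3 qq q qR R by linarith
    then show ?thesis by (simp add: algebra_simps)
  qed
qed

text \<open>
  Unless l is below 2|P|, the modulus l leaves room for the isoperimetric argument. B is P modulo l
  with the two end points identified, and few_classes is applied to the set B1 left after the sparse
  classes have been removed, with X0 = B1 and Y0 the complement of U. The only incidences x + c = y
  have x = c, hence there are at most |B1| of them. If B1 met j \<ge> 2 classes, class_count would
  give about 3|P| restricted sums, too many.
\<close>

lemma few_classes_of_small_rsum:
  fixes q :: nat
  assumes q: "q \<ge> 1"
  obtains K :: nat where "\<forall>P l. P \<subseteq> {0..l} \<longrightarrow> 0 \<in> P \<longrightarrow> l \<in> P \<longrightarrow> K \<le> card P \<longrightarrow> l \<le> 5 * int (card P) \<longrightarrow>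
     q * card (rsum P) + card P \<le> 3 * q * card P \<longrightarrow>
     l + 5 \<le> 2 * int (card P) \<or>
     (\<exists>Q d::int. Q \<subseteq> P \<and> d \<ge> 2 \<and> card P \<le> card Q + K \<and> (\<forall>x\<in>Q. \<forall>y\<in>Q. d dvd x - y))"
proof -
  define R where "R = 4 * q * (384 * q)\<^sup>2"
  define K where "K = 20 * (q * R) + 10000 * q ^ 3 + 1"
  have main: "l + 5 \<le> 2 * int (card P) \<or>
     (\<exists>Q d::int. Q \<subseteq> P \<and> d \<ge> 2 \<and> card P \<le> card Q + K \<and> (\<forall>x\<in>Q. \<forall>y\<in>Q. d dvd x - y))"
    if P: "P \<subseteq> {0..l}" "0 \<in> P" "l \<in> P" "K \<le> card P" "l \<le> 5 * int (card P)"
      and sm: "q * card (rsum P) + card P \<le> 3 * q * card P" for P l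
  proof (subst disj_commute, rule disjCI)
    assume nl: "\<not> l + 5 \<le> 2 * int (card P)"
    have fP: "finite P" using P(1) finite_subset by blast
    have "q ^ 3 \<ge> 1" using q by simp
    then have l: "l > 0" using nl P(4) unfolding K_def by linarith
    define B where "B = P - {l}"
    define U where "U = {r \<in> {0..<l}. \<exists>x\<in>B. \<exists>y\<in>B. x \<noteq> y \<and> (x + y) mod l = r}"
    have Bs: "B \<subseteq> {0..<l}" using P(1) unfolding B_def by auto
    have fB: "finite B" using fP unfolding B_def by simp
    have cB: "card P = card B + 1" unfolding B_def using card.remove[OF fP P(3)] by simp
    define u where "u = int (card U)"
    define b where "b = int (card B)"
    define p where "p = int (card P)"
    have pb: "p = b + 1" using cB unfolding p_def b_def by simp
    have uq: "int q * u \<le> (2 * int q - 1) * b + 4 * int q"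
    proof -
      have "u + b \<le> int (card (rsum P)) + 1"
        using cyclic_count[OF P(1-3) l B_def U_def] unfolding u_def b_def by linarith
      then have "int q * (u + b) \<le> int q * (int (card (rsum P)) + 1)" by (intro mult_left_mono) auto
      moreover have "int q * int (card (rsum P)) + p \<le> 3 * int q * p"
      proof -
        have "int (q * card (rsum P) + card P) \<le> int (3 * q * card P)" using sm by (simp only: of_nat_le_iff)
        then show ?thesis unfolding p_def by simp
      qed
      ultimately show ?thesis unfolding pb using q by (simp add: algebra_simps)
    qed
    obtain B1 where B1: "B1 \<subseteq> B" "card B \<le> card B1 + R"
      and gap: "\<And>d r. 0 < d \<Longrightarrow> d \<le> int (384 * q) \<Longrightarrow> {c \<in> B1. c mod d = r} \<noteq> {} \<Longrightarrow>
        4 * q \<le> card {c \<in> B1. c mod d = r}"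
      using remove_sparse_classes[OF fB, of "4 * q" "384 * q"] unfolding R_def by blast
    have fB1: "finite B1" using B1 fB finite_subset by blast
    have B1s: "B1 \<subseteq> {0..<l}" using B1 Bs by blast
    define b1 where "b1 = int (card B1)"
    have b1: "b - int R \<le> b1" "b1 \<le> b" using B1 card_mono[OF fB B1(1)] unfolding b_def b1_def by simp_all
    define s where "s = b div (4 * int q)"
    have s: "4 * int q * s \<le> b" "b < 4 * int q * (s + 1)"
    proof -
      have "0 \<le> b mod (4 * int q)" "b mod (4 * int q) < 4 * int q" using q by auto
      moreover have "b = 4 * int q * s + b mod (4 * int q)" unfolding s_def by simp
      ultimately show "4 * int q * s \<le> b" "b < 4 * int q * (s + 1)" by (simp_all only: distrib_left mult_1_right; linarith)+
    qed
    have bK: "b \<ge> 20 * (int q * int R) + 10000 * int q ^ 3"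
    proof -
      have "20 * (q * R) + 10000 * q ^ 3 \<le> card B" using P(4) cB unfolding K_def by linarith
      then have "int (20 * (q * R) + 10000 * q ^ 3) \<le> int (card B)" by (simp only: of_nat_le_iff)
      then show ?thesis unfolding b_def by simp
    qed
    have n: "2 * b - 2 \<le> l" "l \<le> 5 * b + 5" using nl P(5) pb unfolding p_def by linarith+
    have q1: "int q \<ge> 1" using q by simp
    note num = parameter_inequalities[OF q1 _ bK uq b1 s n, simplified]
    have B1ne: "B1 \<noteq> {}" using num(2) q unfolding b1_def by auto
    interpret cyclic_pairs l "4 * int q" B1 by unfold_locales (use l q B1s in auto)
    define X0 where "X0 = {x. x mod l \<in> B1}"
    define Y0 where "Y0 = {x. x mod l \<notin> U}"
    have Us: "U \<subseteq> {0..<l}" unfolding U_def by blast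
    have cX: "cnt X0 = b1"
    proof -
      have "X0 \<inter> {0..<l} = B1" using B1s unfolding X0_def by auto
      then show ?thesis by (simp add: cnt_card b1_def)
    qed
    have cY: "cnt Y0 = l - u"
    proof -
      have "- Y0 \<inter> {0..<l} = U" using Us unfolding Y0_def by auto
      then have "cnt (- Y0) = u" by (simp add: cnt_card u_def)
      then show ?thesis by (simp add: cnt_compl)
    qed
    have per: "periodic X0" "periodic Y0" by (simp_all add: periodic_def X0_def Y0_def)
    have adm: "adm X0 Y0" unfolding adm_def cX cY using per num by simp
    have "inc X0 Y0 \<le> (\<Sum>c\<in>B1. 1)" unfolding inc_def
    proof (rule sum_mono)
      fix c assume c: "c \<in> B1"
      have "(X0 \<inter> sh c Y0) \<inter> {0..<l} \<subseteq> {c}"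
      proof
        fix x assume "x \<in> (X0 \<inter> sh c Y0) \<inter> {0..<l}"
        then have x: "x \<in> B1" "(x + c) mod l \<notin> U" by (auto simp: X0_def Y0_def)
        have "(x + c) mod l \<in> {0..<l}" using l by auto
        then have "x = c" using x c B1(1) unfolding U_def by blast
        then show "x \<in> {c}" by simp
      qed
      then have "card ((X0 \<inter> sh c Y0) \<inter> {0..<l}) \<le> card {c}" by (intro card_mono) auto
      then show "cnt (X0 \<inter> sh c Y0) \<le> 1" by (simp add: cnt_card)
    qed
    then have Phi: "Phi X0 Y0 \<le> 4 * int q * (u - b1) + b1"
      unfolding Phi_def cX cY by (simp add: b1_def algebra_simps)
    define L where "L = 4 * int q * (u - b1) + b1"
    obtain d where d: "d > 0" "d dvd l" "int (card ((\<lambda>c. c mod d) ` B1)) < d" "d \<le> 384 * int q"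
      "4 * int q * ((int (card ((\<lambda>c. c mod d) ` B1)) - 1) * (l div d)) \<le> L"
      "int (card {(a + b) mod d | a b. a \<in> B1 \<and> b \<in> B1}) = d \<or>
       2 * int (card ((\<lambda>c. c mod d) ` B1)) - 1 \<le> int (card {(a + b) mod d | a b. a \<in> B1 \<and> b \<in> B1})"
    proof (rule few_classes[of "384 * int q" X0 Y0 L s])
      show "4 * int q \<le> int (card {c \<in> B1. c mod d = r})"
        if "0 < d" "d \<le> 384 * int q" "{c \<in> B1. c mod d = r} \<noteq> {}" for d r
        using gap[of d r] that by simp
      show "adm X0 Y0" by (rule adm)
      show "Phi X0 Y0 \<le> L" using Phi unfolding L_def .
      show "4 * int q * s \<le> 4 * int q * int (card B1) - L" using num(3) unfolding L_def b1_def by simp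
      show "2 * L \<le> 4 * int q * l" using num(4) unfolding L_def by simp
      show "8 * (4 * int q) \<le> s" "4 * l * (4 * int q) < s * s" "8 * l \<le> 384 * int q * s"
        using num by simp_all
      show "B1 \<noteq> {}" by (rule B1ne)
    qed (rule that)
    define J where "J = (\<lambda>c. c mod d) ` B1"
    define JJ where "JJ = {(a + b) mod d | a b. a \<in> B1 \<and> b \<in> B1}"
    have J0: "card J > 0" unfolding J_def using B1ne fB1 by (simp add: card_gt_0_iff)
    define h where "h = l div d"
    have ldh: "l = d * h" using d(2) unfolding h_def by simp
    have h0: "h > 0" using l d(1) ldh by (metis zero_less_mult_pos)
    have "card J = 1"
    proof (rule ccontr)
      assume "card J \<noteq> 1"
      then have j2: "2 \<le> card J" using J0 by simp
      have hj: "4 * int q * ((int (card J) - 1) * h) \<le> L" using d(5) unfolding J_def h_def .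
      have "2 * card J \<le> card JJ + 1"
      proof -
        have "2 * int (card J) - 1 \<le> int (card JJ)"
        proof (cases "int (card JJ) = d")
          case True
          have "4 * int q * (2 * (int (card J) - 1) * h) < 4 * int q * (d * h)"
            using hj num(4) unfolding L_def ldh[symmetric] by linarith
          then have "2 * (int (card J) - 1) * h < d * h" using q by (simp add: mult_less_cancel_left)
          then have "2 * (int (card J) - 1) < d" using h0 by (simp add: mult_less_cancel_right)
          then have "2 * int (card J) - 1 \<le> d" by simp
          then show ?thesis using True by simp
        next
          case False
          then show ?thesis using d(6) unfolding J_def JJ_def by blast
        qed
        then show ?thesis by linarith
      qed
      moreover have "(int (card J) - 1) * h \<le> b1"
      proof -
        have "4 * int q * s \<ge> 0" using num(8) by simp
        then have "L \<le> 4 * int q * b1" using num(3) unfolding L_def by linarith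
        then have "4 * int q * ((int (card J) - 1) * h) \<le> 4 * int q * b1" using hj by linarith
        then show ?thesis using q by simp
      qed
      moreover have "int (card {c \<in> B1. c mod d = i}) \<le> h" for i
      proof (cases "0 \<le> i \<and> i < d")
        case True
        have sub: "{c \<in> B1. c mod d = i} \<subseteq> {y \<in> {0..<d * h}. y mod d \<in> {i}}" using B1s ldh by auto
        have "finite {y \<in> {0..<d * h}. y mod d \<in> {i}}" by (rule finite_subset[of _ "{0..<d * h}"]) auto
        then have "card {c \<in> B1. c mod d = i} \<le> card {y \<in> {0..<d * h}. y mod d \<in> {i}}"
          using sub by (rule card_mono)
        then have "int (card {c \<in> B1. c mod d = i}) \<le> int (card {y \<in> {0..<d * h}. y mod d \<in> {i}})" by simp
        also have "\<dots> = h * int (card {i})" by (rule card_residue_classes) (use d(1) True h0 in auto)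
        finally show ?thesis by simp
      next
        case False
        have "c mod d \<noteq> i" for c using False pos_mod_sign[OF d(1), of c] pos_mod_bound[OF d(1), of c] by auto
        then have "{c \<in> B1. c mod d = i} = {}" by blast
        then show ?thesis using h0 by (simp only:) simp
      qed
      ultimately have "3 * b1 \<le> int (card (rsum B1)) + 6 * int (card J)"
        using class_count[OF fB1 d(1), of h] j2 unfolding J_def JJ_def b1_def by blast
      moreover have "card (rsum B1) \<le> card (rsum P)"
        using finite_rsum[OF fP] rsum_mono[of B1 P] B1(1) unfolding B_def by (intro card_mono) auto
      moreover have "int (card J) \<le> 384 * int q" using d(3,4) unfolding J_def by linarith
      ultimately have 1: "3 * b - 3 * int R \<le> int (card (rsum P)) + 6 * (384 * int q)" using b1(1) by linarith
      have "int q * (3 * b - 3 * int R) \<le> int q * (int (card (rsum P)) + 6 * (384 * int q))"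
        using 1 by (intro mult_left_mono) auto
      moreover have "int q * int (card (rsum P)) + p \<le> 3 * int q * p"
      proof -
        have "int (q * card (rsum P) + card P) \<le> int (3 * q * card P)" using sm by (simp only: of_nat_le_iff)
        then show ?thesis unfolding p_def by simp
      qed
      ultimately have "b + 1 \<le> int q * (3 * int R + 3 + 6 * (384 * int q))"
        unfolding pb by (simp add: algebra_simps)
      then show False using num(9) by simp
    qed
    then obtain r where r: "J = {r}" by (rule card_1_singletonE)
    have "\<forall>x\<in>B1. \<forall>y\<in>B1. d dvd x - y"
    proof (intro ballI)
      fix x y assume "x \<in> B1" "y \<in> B1"
      then have "x mod d \<in> J" "y mod d \<in> J" unfolding J_def by auto
      then have "x mod d = y mod d" using r by auto
      then show "d dvd x - y" by (simp only: mod_eq_dvd_iff)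
    qed
    moreover have "d \<ge> 2" using d(3) \<open>card J = 1\<close> unfolding J_def by simp
    moreover have "B1 \<subseteq> P" using B1(1) unfolding B_def by blast
    moreover have "card P \<le> card B1 + K"
    proof -
      have "R \<le> q * R" using q by simp
      then show ?thesis using B1(2) cB unfolding K_def by linarith
    qed
    ultimately show "\<exists>Q d::int. Q \<subseteq> P \<and> d \<ge> 2 \<and> card P \<le> card Q + K \<and> (\<forall>x\<in>Q. \<forall>y\<in>Q. d dvd x - y)" by blast
  qed
  show ?thesis by (rule that[of K], intro allI impI, rule main)
qed

section \<open>Few restricted sums force an arithmetic progression\<close>

lemma card_rsum_affine:
  fixes S :: "int set"
  assumes g: "g > 0"
  shows "card (rsum ((\<lambda>y. u + g * y) ` S)) = card (rsum S)"
proof -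
  have "rsum ((\<lambda>y. u + g * y) ` S) = (\<lambda>s. 2 * u + g * s) ` rsum S"
  proof (intro equalityI subsetI)
    fix t assume "t \<in> rsum ((\<lambda>y. u + g * y) ` S)"
    then obtain x y where xy: "x \<in> S" "y \<in> S" "u + g * x \<noteq> u + g * y" "t = (u + g * x) + (u + g * y)"
      unfolding rsum_def by blast
    then have "x + y \<in> rsum S" by (intro rsumI) auto
    moreover have "t = 2 * u + g * (x + y)" using xy by (simp add: algebra_simps)
    ultimately show "t \<in> (\<lambda>s. 2 * u + g * s) ` rsum S" by blast
  next
    fix t assume "t \<in> (\<lambda>s. 2 * u + g * s) ` rsum S"
    then obtain x y where xy: "x \<in> S" "y \<in> S" "x \<noteq> y" "t = 2 * u + g * (x + y)"
      unfolding rsum_def by blast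
    then have "(u + g * x) + (u + g * y) \<in> rsum ((\<lambda>y. u + g * y) ` S)"
      using g by (intro rsumI) auto
    moreover have "t = (u + g * x) + (u + g * y)" using xy by (simp add: algebra_simps)
    ultimately show "t \<in> rsum ((\<lambda>y. u + g * y) ` S)" by simp
  qed
  moreover have "inj_on (\<lambda>s. 2 * u + g * s) (rsum S)" using g by (simp add: inj_on_def)
  ultimately show ?thesis by (simp add: card_image)
qed

lemma normal_form:
  fixes P :: "int set"
  assumes fin: "finite P" and ne: "P \<noteq> {}" and g: "g > 0" and dv: "\<forall>x\<in>P. \<forall>y\<in>P. g dvd x - y"
  obtains S u l where "P = (\<lambda>y. u + g * y) ` S" "S \<subseteq> {0..l}" "0 \<in> S" "l \<in> S"
    "card S = card P" "card (rsum S) = card (rsum P)"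
proof -
  define u where "u = Min P"
  define S where "S = (\<lambda>x. (x - u) div g) ` P"
  define l where "l = (Max P - u) div g"
  have u: "u \<in> P" "\<And>x. x \<in> P \<Longrightarrow> u \<le> x" unfolding u_def using fin ne by auto
  have recover: "u + g * ((x - u) div g) = x" if "x \<in> P" for x
  proof -
    have "g dvd x - u" using dv that u(1) by blast
    then have "g * ((x - u) div g) = x - u" by (rule dvd_mult_div_cancel)
    then show ?thesis by simp
  qed
  have im: "P = (\<lambda>y. u + g * y) ` S"
  proof -
    have "(\<lambda>y. u + g * y) ` S = (\<lambda>x. u + g * ((x - u) div g)) ` P" unfolding S_def by (simp add: image_image)
    also have "\<dots> = (\<lambda>x. x) ` P" by (rule image_cong) (simp_all add: recover)
    finally show ?thesis by simp
  qed
  have "S \<subseteq> {0..l}"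
  proof
    fix y assume "y \<in> S"
    then obtain x where x: "x \<in> P" "y = (x - u) div g" unfolding S_def by blast
    have "x \<le> Max P" using fin x(1) by simp
    then have "y \<le> l" unfolding l_def x(2) using g by (intro zdiv_mono1) auto
    moreover have "0 \<le> y" using u(2)[OF x(1)] g unfolding x(2) by (simp add: pos_imp_zdiv_nonneg_iff)
    ultimately show "y \<in> {0..l}" by simp
  qed
  moreover have "0 \<in> S" unfolding S_def using u(1) by (intro image_eqI[of _ _ u]) auto
  moreover have "l \<in> S" unfolding S_def l_def using fin ne by (intro imageI Max_in)
  moreover have "card S = card P"
  proof -
    have "inj_on (\<lambda>y. u + g * y) S" using g by (simp add: inj_on_def)
    then show ?thesis by (subst im) (simp add: card_image)
  qed
  moreover have "card (rsum S) = card (rsum P)" by (subst im) (simp add: card_rsum_affine g)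
  ultimately show ?thesis using im that by blast
qed

text \<open>
  The previous result for a set inside one residue class modulo g, transported back from the
  rescaled set.
\<close>

lemma progression_or_subclass:
  fixes q :: nat
  assumes q: "q \<ge> 1"
  obtains K :: nat where "\<forall>P g D. finite P \<longrightarrow> P \<noteq> {} \<longrightarrow> 0 < g \<longrightarrow> (\<forall>x\<in>P. \<forall>y\<in>P. g dvd x - y) \<longrightarrow>
     K \<le> card P \<longrightarrow> P \<subseteq> {a..a + g * D} \<longrightarrow> D \<le> 5 * int (card P) \<longrightarrow>
     q * card (rsum P) + card P \<le> 3 * q * card P \<longrightarrow>
     (\<exists>u l. P \<subseteq> (\<lambda>y. u + g * y) ` {0..l} \<and> u \<in> P \<and> u + g * l \<in> P \<and> l + 5 \<le> 2 * int (card P)) \<or>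
     (\<exists>Q d::int. Q \<subseteq> P \<and> d \<ge> 2 \<and> card P \<le> card Q + K \<and> (\<forall>x\<in>Q. \<forall>y\<in>Q. g * d dvd x - y))"
proof -
  obtain K where K: "\<forall>P l. P \<subseteq> {0..l} \<longrightarrow> 0 \<in> P \<longrightarrow> l \<in> P \<longrightarrow> K \<le> card P \<longrightarrow> l \<le> 5 * int (card P) \<longrightarrow>
     q * card (rsum P) + card P \<le> 3 * q * card P \<longrightarrow>
     l + 5 \<le> 2 * int (card P) \<or>
     (\<exists>Q d::int. Q \<subseteq> P \<and> d \<ge> 2 \<and> card P \<le> card Q + K \<and> (\<forall>x\<in>Q. \<forall>y\<in>Q. d dvd x - y))"
    by (rule few_classes_of_small_rsum[OF q]) (rule that)
  show ?thesis
  proof (rule that[of K], intro allI impI)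
    fix P :: "int set" and g D :: int
    assume fin: "finite P" and ne: "P \<noteq> {}" and g: "0 < g" and dv: "\<forall>x\<in>P. \<forall>y\<in>P. g dvd x - y"
      and cK: "K \<le> card P" and rng: "P \<subseteq> {a..a + g * D}" and D: "D \<le> 5 * int (card P)"
      and sm: "q * card (rsum P) + card P \<le> 3 * q * card P"
    obtain S u l where S: "P = (\<lambda>y. u + g * y) ` S" "S \<subseteq> {0..l}" "0 \<in> S" "l \<in> S"
      "card S = card P" "card (rsum S) = card (rsum P)"
      by (rule normal_form[OF fin ne g dv]) (rule that)
    have uP: "u \<in> P" "u + g * l \<in> P" using S(1,3,4) by (auto intro: image_eqI[of _ _ 0])
    have "g * l \<le> g * D"
    proof -
      have "a \<le> u" "u + g * l \<le> a + g * D" using uP rng by auto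
      then show ?thesis by linarith
    qed
    then have "l \<le> D" using g by simp
    then have "l \<le> 5 * int (card S)" using D S(5) by simp
    then consider "l + 5 \<le> 2 * int (card S)" |
      Q d where "Q \<subseteq> S" "d \<ge> 2" "card S \<le> card Q + K" "\<forall>x\<in>Q. \<forall>y\<in>Q. d dvd x - y"
      using K[rule_format, OF S(2-4)] cK sm S(5,6) by auto
    then show "(\<exists>u l. P \<subseteq> (\<lambda>y. u + g * y) ` {0..l} \<and> u \<in> P \<and> u + g * l \<in> P \<and> l + 5 \<le> 2 * int (card P)) \<or>
     (\<exists>Q d::int. Q \<subseteq> P \<and> d \<ge> 2 \<and> card P \<le> card Q + K \<and> (\<forall>x\<in>Q. \<forall>y\<in>Q. g * d dvd x - y))"
    proof cases
      case 1
      have "P \<subseteq> (\<lambda>y. u + g * y) ` {0..l}" unfolding S(1) using S(2) by (rule image_mono)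
      then show ?thesis using 1 uP S(5) by auto
    next
      case 2
      define Q' where "Q' = (\<lambda>y. u + g * y) ` Q"
      have "Q' \<subseteq> P" unfolding Q'_def S(1) using 2(1) by (rule image_mono)
      moreover have "card Q' = card Q" unfolding Q'_def using g by (intro card_image) (simp add: inj_on_def)
      moreover have "g * d dvd x - y" if xy: "x \<in> Q'" "y \<in> Q'" for x y
      proof -
        obtain x' y' where *: "x' \<in> Q" "y' \<in> Q" "x = u + g * x'" "y = u + g * y'"
          using xy unfolding Q'_def by blast
        then have "x - y = g * (x' - y')" by (simp add: algebra_simps)
        then show ?thesis using 2(4) * by (simp add: mult_dvd_mono)
      qed
      ultimately show ?thesis using 2 S(5) by metis
    qed
  qed
qed

text \<open>
  If most of P lies in one class to a modulus d \<ge> 2, rescaling by d halves the diameter at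
  least, and the previous result applies again, with 2q in place of q because the lost elements
  weaken the hypothesis. If this yields a second modulus d' \<ge> 2, then d d' \<ge> 4, and the
  bound 4|P| on the elements already makes the rescaled diameter at most |P|.
\<close>

theorem small_rsum_progression:
  fixes q :: nat
  assumes q: "q \<ge> 1"
  obtains K :: nat where "\<forall>P::int set. finite P \<longrightarrow> K \<le> card P \<longrightarrow> P \<subseteq> {0..4 * int (card P)} \<longrightarrow>
     q * card (rsum P) + card P \<le> 3 * q * card P \<longrightarrow>
     (\<exists>Q g u l. Q \<subseteq> P \<and> 0 < g \<and> card P \<le> card Q + K \<and> Q \<subseteq> (\<lambda>y. u + g * y) ` {0..l} \<and> u \<in> Q \<and> u + g * l \<in> Q \<and>
       l + 5 \<le> 2 * int (card Q))"
proof -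
  obtain K1 where K1: "\<forall>P g D. finite P \<longrightarrow> P \<noteq> {} \<longrightarrow> 0 < g \<longrightarrow> (\<forall>x\<in>P. \<forall>y\<in>P. g dvd x - y) \<longrightarrow>
     K1 \<le> card P \<longrightarrow> P \<subseteq> {0..0 + g * D} \<longrightarrow> D \<le> 5 * int (card P) \<longrightarrow>
     q * card (rsum P) + card P \<le> 3 * q * card P \<longrightarrow>
     (\<exists>u l. P \<subseteq> (\<lambda>y. u + g * y) ` {0..l} \<and> u \<in> P \<and> u + g * l \<in> P \<and> l + 5 \<le> 2 * int (card P)) \<or>
     (\<exists>Q d::int. Q \<subseteq> P \<and> d \<ge> 2 \<and> card P \<le> card Q + K1 \<and> (\<forall>x\<in>Q. \<forall>y\<in>Q. g * d dvd x - y))"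
    by (rule progression_or_subclass[OF q, where a = 0]) (rule that)
  have q2: "2 * q \<ge> 1" using q by simp
  obtain K2 where K2: "\<forall>P g D. finite P \<longrightarrow> P \<noteq> {} \<longrightarrow> 0 < g \<longrightarrow> (\<forall>x\<in>P. \<forall>y\<in>P. g dvd x - y) \<longrightarrow>
     K2 \<le> card P \<longrightarrow> P \<subseteq> {0..0 + g * D} \<longrightarrow> D \<le> 5 * int (card P) \<longrightarrow>
     2 * q * card (rsum P) + card P \<le> 3 * (2 * q) * card P \<longrightarrow>
     (\<exists>u l. P \<subseteq> (\<lambda>y. u + g * y) ` {0..l} \<and> u \<in> P \<and> u + g * l \<in> P \<and> l + 5 \<le> 2 * int (card P)) \<or>
     (\<exists>Q d::int. Q \<subseteq> P \<and> d \<ge> 2 \<and> card P \<le> card Q + K2 \<and> (\<forall>x\<in>Q. \<forall>y\<in>Q. g * d dvd x - y))"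
    by (rule progression_or_subclass[OF q2, where a = 0]) (rule that)
  \<comment> \<open>6 * q * K1 pays for the elements lost in the first step when q is replaced by 2q, and 2 * K1 + 2
    * K2 + 5 for the final density.\<close>
  define K where "K = 2 * K1 + 2 * K2 + 6 * (q * K1) + 5"
  have "\<exists>Q g u l. Q \<subseteq> P \<and> 0 < g \<and> card P \<le> card Q + K \<and> Q \<subseteq> (\<lambda>y. u + g * y) ` {0..l} \<and> u \<in> Q \<and> u + g * l \<in> Q \<and>
       l + 5 \<le> 2 * int (card Q)"
    if fin: "finite P" and cK: "K \<le> card P" and rng: "P \<subseteq> {0..4 * int (card P)}"
     and sm: "q * card (rsum P) + card P \<le> 3 * q * card P" for P :: "int set"
  proof -
    have ne: "P \<noteq> {}" using cK unfolding K_def by auto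
    have "K1 \<le> card P" using cK unfolding K_def by linarith
    then consider (prog) u l where "P \<subseteq> (\<lambda>y. u + 1 * y) ` {0..l}" "u \<in> P" "u + 1 * l \<in> P" "l + 5 \<le> 2 * int (card P)" |
      (sub) Q d where "Q \<subseteq> P" "d \<ge> 2" "card P \<le> card Q + K1" "\<forall>x\<in>Q. \<forall>y\<in>Q. 1 * d dvd x - y"
      using K1[rule_format, of P 1 "4 * int (card P)"] fin ne rng sm by auto
    then show ?thesis
    proof cases
      case prog
      then show ?thesis by (intro exI[of _ P] exI[of _ 1] exI[of _ u] exI[of _ l]) simp
    next
      case sub
      define c where "c = card Q"
      have fQ: "finite Q" using sub(1) fin finite_subset by blast
      have cQ: "c \<le> card P" unfolding c_def using fin sub(1) by (rule card_mono)
      have "0 < c" using sub(3) cK unfolding K_def c_def by linarith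
      then have Qne: "Q \<noteq> {}" unfolding c_def by auto
      have K2c: "K2 \<le> card Q" using sub(3) cK unfolding K_def by linarith
      have rQ: "Q \<subseteq> {0..0 + d * (2 * int (card P))}"
      proof -
        have "2 * (2 * int (card P)) \<le> d * (2 * int (card P))" using sub(2) by (intro mult_right_mono) auto
        then show ?thesis using sub(1) rng by auto
      qed
      have D: "2 * int (card P) \<le> 5 * int (card Q)" using sub(3) cK unfolding K_def by linarith
      have sQ: "2 * q * card (rsum Q) + card Q \<le> 3 * (2 * q) * card Q"
      proof -
        have "card (rsum Q) \<le> card (rsum P)" using finite_rsum[OF fin] rsum_mono[OF sub(1)] by (rule card_mono)
        then have "q * card (rsum Q) \<le> q * card (rsum P)" by simp
        moreover have "q * card P \<le> q * card Q + q * K1"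
          using mult_left_mono[OF sub(3), of q] by (simp add: algebra_simps)
        moreover have "6 * (q * K1) \<le> card P" using cK unfolding K_def by linarith
        ultimately have "2 * (q * card (rsum Q)) + card Q \<le> 6 * (q * card Q)"
          using sm cQ unfolding c_def mult.assoc by linarith
        then show ?thesis by (simp add: algebra_simps)
      qed
      have d0: "0 < d" using sub(2) by simp
      have dv: "d dvd x - y" if "x \<in> Q" "y \<in> Q" for x y using sub(4) that by simp
      consider (prog') u l where "Q \<subseteq> (\<lambda>y. u + d * y) ` {0..l}" "u \<in> Q" "u + d * l \<in> Q" "l + 5 \<le> 2 * int (card Q)" |
        (sub') Q' d' where "Q' \<subseteq> Q" "d' \<ge> 2" "card Q \<le> card Q' + K2" "\<forall>x\<in>Q'. \<forall>y\<in>Q'. d * d' dvd x - y"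
        using K2[rule_format, OF fQ Qne d0 dv K2c rQ D sQ] by blast
      then show ?thesis
      proof cases
        case prog'
        moreover have "card P \<le> card Q + K" using sub(3) unfolding K_def by linarith
        ultimately show ?thesis using sub(1) d0 by blast
      next
        case sub'
        define g where "g = d * d'"
        have g4: "4 \<le> g" unfolding g_def using mult_mono[of 2 d 2 d'] sub(2) sub'(2) by simp
        have fQ': "finite Q'" using sub'(1) fQ finite_subset by blast
        have big: "card P \<le> card Q' + K1 + K2" using sub(3) sub'(3) by linarith
        have "0 < card Q'" using big cK unfolding K_def by linarith
        then have ne': "Q' \<noteq> {}" by auto
        have g0: "0 < g" using g4 by simp
        have dv': "\<forall>x\<in>Q'. \<forall>y\<in>Q'. g dvd x - y" using sub'(4) unfolding g_def .
        obtain S u l where S: "Q' = (\<lambda>y. u + g * y) ` S" "S \<subseteq> {0..l}" "0 \<in> S" "l \<in> S"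
          "card S = card Q'" "card (rsum S) = card (rsum Q')"
          by (rule normal_form[OF fQ' ne' g0 dv']) (rule that)
        have u: "u \<in> Q'" "u + g * l \<in> Q'" using S(1,3,4) by (auto intro: image_eqI[of _ _ 0])
        have "0 \<le> l" using S(2,4) by auto
        then have "4 * l \<le> g * l" using g4 by (intro mult_right_mono) auto
        moreover have "u \<in> {0..4 * int (card P)}" "u + g * l \<in> {0..4 * int (card P)}"
          using u sub'(1) sub(1) rng by blast+
        then have "0 \<le> u" "u + g * l \<le> 4 * int (card P)" by simp_all
        ultimately have "l \<le> int (card P)" by linarith
        then have "l + 5 \<le> 2 * int (card Q')" using big cK unfolding K_def by linarith
        moreover have "Q' \<subseteq> (\<lambda>y. u + g * y) ` {0..l}" by (subst S(1)) (rule image_mono[OF S(2)])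
        moreover have "Q' \<subseteq> P" using sub(1) sub'(1) by blast
        moreover have "card P \<le> card Q' + K" using big unfolding K_def by linarith
        ultimately show ?thesis using g0 u by blast
      qed
    qed
  qed
  then show ?thesis by (intro that[of K] allI impI)
qed

lemma card_rsum_int: "card (rsum (int ` P)) = card (rsum P)"
proof -
  have "rsum (int ` P) = int ` rsum P"
  proof (intro equalityI subsetI)
    fix t assume "t \<in> rsum (int ` P)"
    then obtain x y where "x \<in> P" "y \<in> P" "int x \<noteq> int y" "t = int x + int y" unfolding rsum_def by blast
    then have "x + y \<in> rsum P" "t = int (x + y)" by (auto intro: rsumI)
    then show "t \<in> int ` rsum P" by blast
  next
    fix t assume "t \<in> int ` rsum P"
    then obtain x y where "x \<in> P" "y \<in> P" "x \<noteq> y" "t = int (x + y)" unfolding rsum_def by blast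
    then show "t \<in> rsum (int ` P)" using rsumI[of "int x" "int ` P" "int y"] by simp
  qed
  then show ?thesis by (simp add: card_image)
qed

text \<open>
  The last inequality comes from dense_rsum, applied to Q after rescaling its progression to an
  interval.
\<close>

corollary small_rsum_progression_nat:
  fixes q :: nat
  assumes q: "q \<ge> 1"
  obtains K :: nat where "\<forall>P::nat set. finite P \<longrightarrow> K \<le> card P \<longrightarrow> P \<subseteq> {0..4 * card P} \<longrightarrow>
     q * card (rsum P) + card P \<le> 3 * q * card P \<longrightarrow>
     (\<exists>Q g u l. Q \<subseteq> P \<and> 0 < g \<and> card P \<le> card Q + K \<and> Q \<subseteq> (\<lambda>y. u + g * y) ` {0..l} \<and> u \<in> Q \<and> u + g * l \<in> Q \<and>
       l + 5 \<le> 2 * card Q \<and> card Q + l \<le> card (rsum Q) + 2)"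
proof -
  obtain K where K: "\<forall>P::int set. finite P \<longrightarrow> K \<le> card P \<longrightarrow> P \<subseteq> {0..4 * int (card P)} \<longrightarrow>
     q * card (rsum P) + card P \<le> 3 * q * card P \<longrightarrow>
     (\<exists>Q g u l. Q \<subseteq> P \<and> 0 < g \<and> card P \<le> card Q + K \<and> Q \<subseteq> (\<lambda>y. u + g * y) ` {0..l} \<and> u \<in> Q \<and> u + g * l \<in> Q \<and>
       l + 5 \<le> 2 * int (card Q))"
    by (rule small_rsum_progression[OF q]) (rule that)
  have "\<exists>Q g u l. Q \<subseteq> P \<and> 0 < g \<and> card P \<le> card Q + K \<and> Q \<subseteq> (\<lambda>y. u + g * y) ` {0..l} \<and> u \<in> Q \<and> u + g * l \<in> Q \<and>
       l + 5 \<le> 2 * card Q \<and> card Q + l \<le> card (rsum Q) + 2"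
    if fin: "finite P" and cK: "K \<le> card P" and rng: "P \<subseteq> {0..4 * card P}"
     and sm: "q * card (rsum P) + card P \<le> 3 * q * card P" for P :: "nat set"
  proof -
    have cP: "card (int ` P) = card P" by (simp add: card_image)
    have "int ` P \<subseteq> {0..4 * int (card (int ` P))}" unfolding cP using rng by fastforce
    then obtain Q0 g0 u0 l0 where Q0: "Q0 \<subseteq> int ` P" "0 < g0" "card (int ` P) \<le> card Q0 + K"
      "Q0 \<subseteq> (\<lambda>y. u0 + g0 * y) ` {0..l0}" "u0 \<in> Q0" "u0 + g0 * l0 \<in> Q0" "l0 + 5 \<le> 2 * int (card Q0)"
      using K[rule_format, of "int ` P"] fin cK sm unfolding cP card_rsum_int by blast
    define Q where "Q = nat ` Q0"
    have nn: "0 \<le> x" if "x \<in> Q0" for x using that Q0(1) by auto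
    have iQ: "Q0 = int ` Q" unfolding Q_def image_image using nn by force
    have cQ: "card Q0 = card Q" unfolding iQ by (simp add: card_image)
    have QP: "Q \<subseteq> P" using Q0(1) unfolding Q_def by auto
    have u0: "0 \<le> u0" using nn Q0(5) by simp
    have l0: "0 \<le> l0" using Q0(4,5) by auto
    define u where "u = nat u0"
    define g where "g = nat g0"
    define l where "l = nat l0"
    have ii: "int u = u0" "int g = g0" "int l = l0" using u0 l0 Q0(2) unfolding u_def g_def l_def by auto
    have uQ: "u \<in> Q" unfolding Q_def u_def using Q0(5) by blast
    have zQ: "u + g * l \<in> Q"
    proof -
      have "int (u + g * l) \<in> int ` Q" using Q0(6) unfolding ii[symmetric] iQ by simp
      then show ?thesis by (simp only: inj_image_mem_iff[OF inj_of_nat])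
    qed
    have sub: "Q \<subseteq> (\<lambda>y. u + g * y) ` {0..l}"
    proof
      fix x assume "x \<in> Q"
      then obtain y where y: "y \<in> {0..l0}" "int x = u0 + g0 * y" using Q0(4) unfolding iQ by blast
      then have "int x = int (u + g * nat y)" by (simp add: ii)
      then have "x = u + g * nat y" by (simp only: of_nat_eq_iff)
      moreover have "nat y \<in> {0..l}" using y(1) unfolding l_def by auto
      ultimately show "x \<in> (\<lambda>y. u + g * y) ` {0..l}" by blast
    qed
    have "card Q + l \<le> card (rsum Q) + 2"
    proof -
      have fQ0: "finite Q0" using Q0(1) fin finite_subset by blast
      define S where "S = {y \<in> {0..l0}. u0 + g0 * y \<in> Q0}"
      have im: "Q0 = (\<lambda>y. u0 + g0 * y) ` S" unfolding S_def using Q0(4) by blast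
      have "card Q0 = card S" by (subst im) (use Q0(2) in \<open>simp add: card_image inj_on_def\<close>)
      moreover have "card (rsum Q0) = card (rsum S)" by (subst im) (simp add: card_rsum_affine Q0(2))
      moreover have "S \<subseteq> {0..l0}" "0 \<in> S" "l0 \<in> S" unfolding S_def using Q0(5,6) l0 by auto
      ultimately have "int (card Q0) + l0 \<le> int (card (rsum Q0)) + 2"
        using dense_rsum[of S l0] Q0(7) by simp
      then have "int (card Q + l) \<le> int (card (rsum Q) + 2)" unfolding iQ card_rsum_int ii[symmetric] by (simp add: card_image)
      then show ?thesis by (simp only: of_nat_le_iff)
    qed
    moreover have "l + 5 \<le> 2 * card Q"
    proof -
      have "int (l + 5) \<le> int (2 * card Q)" using Q0(7) unfolding cQ ii[symmetric] by simp
      then show ?thesis by (simp only: of_nat_le_iff)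
    qed
    moreover have "0 < g" using Q0(2) ii(2) by simp
    moreover have "card P \<le> card Q + K" using Q0(3) unfolding cP cQ .
    ultimately show ?thesis using QP uQ zQ sub by blast
  qed
  then show ?thesis by (intro that[of K] allI impI)
qed

section \<open>Missing elements of a triple-free set\<close>

lemma has_pairwise_sum_triple_mono:
  "has_pairwise_sum_triple B \<Longrightarrow> B \<subseteq> A \<Longrightarrow> has_pairwise_sum_triple A"
  unfolding has_pairwise_sum_triple_def by blast

text \<open>
  Regard V as a graph whose edges are the pairs with sum in A. The hypothesis says that it has no
  triangle, so the neighbourhood of the minimum a and that of the maximum z have all their
  restricted sums missing. The sums of a and of z with their non-neighbours are missing as well, and
  they coincide at most in a + z. Whatever the degrees of a and z are, one of these three sources is
  large enough.
\<close>

lemma card_le_missing_sums: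
  fixes V A :: "nat set"
  assumes fin: "finite V"
    and no: "\<And>a b c. a \<in> V \<Longrightarrow> b \<in> V \<Longrightarrow> c \<in> V \<Longrightarrow> a \<noteq> b \<Longrightarrow> a \<noteq> c \<Longrightarrow> b \<noteq> c \<Longrightarrow>
      a + b \<in> A \<Longrightarrow> a + c \<in> A \<Longrightarrow> b + c \<in> A \<Longrightarrow> False"
  shows "card V \<le> card (rsum V - A) + 3"
proof (cases "V = {}")
  case False
  define a where "a = Min V"
  define z where "z = Max V"
  have a: "a \<in> V" "\<And>x. x \<in> V \<Longrightarrow> a \<le> x" unfolding a_def using fin False by auto
  have z: "z \<in> V" "\<And>x. x \<in> V \<Longrightarrow> x \<le> z" unfolding z_def using fin False by auto
  define Nb where "Nb v = {c \<in> V. c \<noteq> v \<and> v + c \<in> A}" for v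
  define Ms where "Ms v = {c \<in> V. c \<noteq> v \<and> v + c \<notin> A}" for v
  have fN: "finite (Nb v)" "finite (Ms v)" for v unfolding Nb_def Ms_def using fin by simp_all
  have fR: "finite (rsum V - A)" using finite_rsum[OF fin] by simp
  have split: "card V = card (Nb v) + card (Ms v) + 1" if v: "v \<in> V" for v
  proof -
    have "Nb v \<inter> Ms v = {}" "Nb v \<union> Ms v = V - {v}" unfolding Nb_def Ms_def by auto
    then have "card (V - {v}) = card (Nb v) + card (Ms v)" using card_Un_disjoint[OF fN] by metis
    then show ?thesis using card.remove[OF fin v] by simp
  qed
  have nb: "2 * card (Nb v) \<le> card (rsum V - A) + 3" if v: "v \<in> V" for v
  proof -
    have "rsum (Nb v) \<subseteq> rsum V - A"
    proof
      fix s assume "s \<in> rsum (Nb v)"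
      then obtain x y where xy: "x \<in> Nb v" "y \<in> Nb v" "x \<noteq> y" "s = x + y" unfolding rsum_def by blast
      then have "x \<in> V" "y \<in> V" "x \<noteq> v" "y \<noteq> v" "v + x \<in> A" "v + y \<in> A" unfolding Nb_def by auto
      then have "s \<notin> A" using no[OF v, of x y] xy(3,4) by metis
      moreover have "s \<in> rsum V" using \<open>x \<in> V\<close> \<open>y \<in> V\<close> xy(3,4) by (auto intro: rsumI)
      ultimately show "s \<in> rsum V - A" by simp
    qed
    then have "card (rsum (Nb v)) \<le> card (rsum V - A)" using fR by (rule card_mono[rotated])
    then show ?thesis using card_rsum_ge[OF fN(1), of v] by linarith
  qed
  have "card ((\<lambda>c. a + c) ` Ms a \<union> (\<lambda>c. z + c) ` Ms z) \<le> card (rsum V - A)"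
    using fR by (rule card_mono) (use a(1) z(1) in \<open>auto simp: Ms_def intro: rsumI\<close>)
  moreover have "card ((\<lambda>c. a + c) ` Ms a) + card ((\<lambda>c. z + c) ` Ms z)
      = card ((\<lambda>c. a + c) ` Ms a \<union> (\<lambda>c. z + c) ` Ms z) + card ((\<lambda>c. a + c) ` Ms a \<inter> (\<lambda>c. z + c) ` Ms z)"
    by (rule card_Un_Int) (use fN in auto)
  moreover have "(\<lambda>c. a + c) ` Ms a \<inter> (\<lambda>c. z + c) ` Ms z \<subseteq> {a + z}"
  proof
    fix s assume "s \<in> (\<lambda>c. a + c) ` Ms a \<inter> (\<lambda>c. z + c) ` Ms z"
    then obtain c c' where "c \<in> V" "c' \<in> V" "s = a + c" "s = z + c'" unfolding Ms_def by blast
    then show "s \<in> {a + z}" using a(2)[of c'] z(2)[of c] by simp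
  qed
  then have "card ((\<lambda>c. a + c) ` Ms a \<inter> (\<lambda>c. z + c) ` Ms z) \<le> 1" using card_mono[of "{a + z}"] by fastforce
  moreover have "card ((\<lambda>c. a + c) ` Ms a) = card (Ms a)" "card ((\<lambda>c. z + c) ` Ms z) = card (Ms z)"
    by (simp_all add: card_image)
  ultimately have "card (Ms a) + card (Ms z) \<le> card (rsum V - A) + 1" by linarith
  then show ?thesis using split[OF a(1)] split[OF z(1)] nb[OF a(1)] nb[OF z(1)] by linarith
qed simp

text \<open>
  For z = max X there are enough elements x < z in X to force z - x \<in> X for some x with 2x
  \<noteq> z.
\<close>

lemma schur_pair:
  fixes X :: "nat set"
  assumes X: "X \<subseteq> {1..n}" and c: "n + 3 \<le> 2 * card X"
  obtains a b where "a < b" "a \<in> X" "b \<in> X" "a + b \<in> X"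
proof -
  have fX: "finite X" using X finite_subset by blast
  have ne: "X \<noteq> {}" using c by auto
  define z where "z = Max X"
  have z: "z \<in> X" "\<And>x. x \<in> X \<Longrightarrow> x \<le> z" unfolding z_def using fX ne by auto
  define Y where "Y = X - {z}"
  define Y' where "Y' = (\<lambda>x. z - x) ` Y"
  have Yr: "0 < x" "x < z" if "x \<in> Y" for x
  proof -
    have "x \<in> X" "x \<noteq> z" using that unfolding Y_def by auto
    then show "0 < x" "x < z" using X z(2)[of x] by auto
  qed
  have fY: "finite Y" "finite Y'" unfolding Y'_def Y_def using fX by auto
  have cY: "card X = card Y + 1" unfolding Y_def using card.remove[OF fX z(1)] by simp
  have "inj_on (\<lambda>x. z - x) Y" using Yr(2) by (intro inj_onI) (metis diff_diff_cancel less_imp_le_nat)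
  then have cY': "card Y' = card Y" unfolding Y'_def by (rule card_image)
  have "Y \<union> Y' \<subseteq> {1..<z}" unfolding Y'_def using Yr by force
  then have "card (Y \<union> Y') \<le> card {1..<z}" by (intro card_mono) auto
  moreover have "card Y + card Y' = card (Y \<union> Y') + card (Y \<inter> Y')" by (rule card_Un_Int[OF fY])
  moreover have "1 \<le> z" "z \<le> n" using z(1) X by auto
  ultimately have "2 \<le> card (Y \<inter> Y')" using c cY cY' by simp
  moreover have "card (Y \<inter> Y') \<le> 1" if "Y \<inter> Y' \<subseteq> {z div 2}" using card_mono[OF _ that] by simp
  ultimately obtain y where y: "y \<in> Y" "y \<in> Y'" "y \<noteq> z div 2" by force
  then obtain x where x: "x \<in> Y" "y = z - x" unfolding Y'_def by blast
  then have s: "x + y = z" using Yr(2)[of x] by simp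
  then have "x \<noteq> y" using y(3) by auto
  then consider "x < y" | "y < x" by linarith
  then show ?thesis
  proof cases
    case 1
    then show ?thesis using that[of x y] x(1) y(1) s z(1) unfolding Y_def by simp
  next
    case 2
    then show ?thesis using that[of y x] x(1) y(1) s z(1) unfolding Y_def by (simp add: add.commute)
  qed
qed

text \<open>
  Each c in (s, e - b] has c, c + a or c + b missing, and a missing element serves for at most three
  c. If e \<le> s + 2b, it cannot serve both as some c and as some c + b, which leaves two.
\<close>

lemma missing_of_forbidden_pattern:
  fixes a b s e :: nat
  assumes ab: "a < b" and no: "\<And>c. s < c \<Longrightarrow> c \<in> A \<Longrightarrow> c + a \<in> A \<Longrightarrow> c + b \<in> A \<Longrightarrow> False"
  shows "e \<le> s + b + 3 * card ({s<..e} - A)"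
    and "e \<le> s + 2 * b \<Longrightarrow> e \<le> s + b + 2 * card ({s<..e} - A)"
proof -
  define M where "M = {s<..e} - A"
  define M1 where "M1 = {m \<in> M. m + b \<le> e}"
  define M2 where "M2 = {m \<in> M. s + b < m}"
  have fM: "finite M" "finite M1" "finite M2" unfolding M1_def M2_def M_def by auto
  have sub: "M1 \<subseteq> M" "M2 \<subseteq> M" unfolding M1_def M2_def by auto
  have "{s<..e - b} \<subseteq> M1 \<union> ((\<lambda>m. m - a) ` M \<union> (\<lambda>m. m - b) ` M2)"
  proof
    fix c assume "c \<in> {s<..e - b}"
    then have c: "s < c" "c + b \<le> e" by auto
    consider "c \<notin> A" | "c + a \<notin> A" | "c + b \<notin> A" using no[OF c(1)] by blast
    then show "c \<in> M1 \<union> ((\<lambda>m. m - a) ` M \<union> (\<lambda>m. m - b) ` M2)"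
    proof cases
      case 1
      then show ?thesis using c unfolding M1_def M_def by simp
    next
      case 2
      then have "c + a \<in> M" using c ab unfolding M_def by simp
      then have "c \<in> (\<lambda>m. m - a) ` M" by (intro image_eqI[of _ _ "c + a"]) auto
      then show ?thesis by blast
    next
      case 3
      then have "c + b \<in> M2" using c unfolding M2_def M_def by simp
      then have "c \<in> (\<lambda>m. m - b) ` M2" by (intro image_eqI[of _ _ "c + b"]) auto
      then show ?thesis by blast
    qed
  qed
  then have "card {s<..e - b} \<le> card (M1 \<union> ((\<lambda>m. m - a) ` M \<union> (\<lambda>m. m - b) ` M2))"
    using fM by (intro card_mono) auto
  also have "\<dots> \<le> card M1 + card ((\<lambda>m. m - a) ` M \<union> (\<lambda>m. m - b) ` M2)" by (rule card_Un_le)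
  also have "\<dots> \<le> card M1 + (card ((\<lambda>m. m - a) ` M) + card ((\<lambda>m. m - b) ` M2))"
    using card_Un_le[of "(\<lambda>m. m - a) ` M" "(\<lambda>m. m - b) ` M2"] by simp
  also have "\<dots> \<le> card M1 + (card M + card M2)"
    using card_image_le[OF fM(1), of "\<lambda>m. m - a"] card_image_le[OF fM(3), of "\<lambda>m. m - b"] by linarith
  finally have main: "e \<le> s + b + (card M1 + (card M + card M2))" by simp
  show "e \<le> s + b + 3 * card ({s<..e} - A)"
    using main card_mono[OF fM(1) sub(1)] card_mono[OF fM(1) sub(2)] unfolding M_def by linarith
  show "e \<le> s + b + 2 * card ({s<..e} - A)" if "e \<le> s + 2 * b"
  proof -
    have "M1 \<inter> M2 = {}" using that unfolding M1_def M2_def by auto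
    then have "card M1 + card M2 = card (M1 \<union> M2)" using fM by (simp add: card_Un_disjoint)
    also have "\<dots> \<le> card M" using fM sub by (intro card_mono) auto
    finally show ?thesis using main unfolding M_def by linarith
  qed
qed

text \<open>
  After division by g, the elements below the maximum and their reflections lie in {1..<z/g} and
  meet at most in the midpoint, since a common element would write z as a restricted sum.
\<close>

lemma max_not_sum:
  fixes Q :: "nat set"
  assumes fin: "finite Q" and g: "g > 0" and dv: "\<And>x. x \<in> Q \<Longrightarrow> g dvd x \<and> 0 < x \<and> x \<le> z"
    and z: "z \<in> Q" "z \<notin> rsum Q"
  shows "g * (2 * card Q) \<le> z + 2 * g"
proof -
  obtain k where k: "z = g * k" using dv[OF z(1)] by auto
  define X where "X = {y. g * y \<in> Q \<and> y < k}"
  have k0: "0 < k" using dv[OF z(1)] k by (cases k) auto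
  have Q: "Q = (\<lambda>y. g * y) ` insert k X"
  proof (intro equalityI subsetI)
    fix x assume x: "x \<in> Q"
    then obtain y where y: "x = g * y" using dv by blast
    have "g * y \<le> g * k" using dv[OF x] y k by simp
    then have "y \<le> k" using g by simp
    then show "x \<in> (\<lambda>y. g * y) ` insert k X" using x y unfolding X_def by (cases "y = k") auto
  qed (use z(1) k in \<open>auto simp: X_def\<close>)
  have fX: "finite X" by (rule finite_subset[of _ "{..<k}"]) (auto simp: X_def)
  have cQ: "card Q = card X + 1"
  proof -
    have "card ((\<lambda>y. g * y) ` insert k X) = card (insert k X)"
      by (rule card_image) (use g in \<open>simp add: inj_on_def\<close>)
    then have "card Q = card (insert k X)" unfolding Q[symmetric] .
    also have "\<dots> = card X + 1" using fX by (simp add: X_def)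
    finally show ?thesis .
  qed
  have Xr: "0 < y \<and> y < k" if "y \<in> X" for y using that dv[of "g * y"] unfolding X_def by (cases y) auto
  define X' where "X' = (\<lambda>y. k - y) ` X"
  have fX': "finite X'" unfolding X'_def using fX by simp
  have "inj_on (\<lambda>y. k - y) X" using Xr by (intro inj_onI) (metis diff_diff_cancel less_imp_le_nat)
  then have cX': "card X' = card X" unfolding X'_def by (rule card_image)
  have "X \<inter> X' \<subseteq> {k div 2}"
  proof
    fix y assume "y \<in> X \<inter> X'"
    then obtain y' where y: "y \<in> X" "y' \<in> X" "y = k - y'" unfolding X'_def by blast
    then have s: "y + y' = k" using Xr[of y'] by simp
    then have "g * y + g * y' = z" unfolding k by (simp only: distrib_left[symmetric])
    then have "g * y = g * y'" using rsumI[of "g * y" Q "g * y'"] y(1,2) z(2) unfolding X_def by auto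
    then have "y = y'" using g by simp
    then show "y \<in> {k div 2}" using s by auto
  qed
  then have "card (X \<inter> X') \<le> 1" using card_mono[of "{k div 2}" "X \<inter> X'"] by simp
  moreover have "X \<union> X' \<subseteq> {1..<k}" unfolding X'_def using Xr by force
  then have "card (X \<union> X') \<le> card {1..<k}" by (intro card_mono) auto
  moreover have "card X + card X' = card (X \<union> X') + card (X \<inter> X')" by (rule card_Un_Int[OF fX fX'])
  ultimately have "2 * card Q \<le> k + 2" using cQ cX' k0 by simp
  then have "g * (2 * card Q) \<le> g * (k + 2)" by (rule mult_le_mono2)
  then show ?thesis by (simp only: k add_mult_distrib2 mult.commute[of 2 g])
qed

section \<open>A minimal counterexample contains no independent progression\<close>

locale minimal_counterexample =
  fixes N C :: nat and A :: "nat set"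
  assumes A_sub: "A \<subseteq> {1..N}" and free: "\<not> has_pairwise_sum_triple A"
    and large: "5 * N + 8 * C \<le> 8 * card A"
    and IH: "\<And>n B. n < N \<Longrightarrow> B \<subseteq> {1..n} \<Longrightarrow> \<not> has_pairwise_sum_triple B \<Longrightarrow> 8 * card B < 5 * n + 8 * C"
    and C_large: "1000000 \<le> C"
begin

definition M :: "nat set" where "M = {1..N} - A"

lemma fin_A: "finite A" and fin_M: "finite M"
  using A_sub finite_subset unfolding M_def by auto

lemma card_A_M: "card A + card M = N"
proof -
  have "card (A \<union> M) = card A + card M"
    by (rule card_Un_disjoint) (use fin_A fin_M in \<open>auto simp: M_def\<close>)
  moreover have "A \<union> M = {1..N}" using A_sub unfolding M_def by blast
  ultimately show ?thesis by simp
qed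

lemma card_M: "8 * card M + 8 * C \<le> 3 * N"
  using card_A_M large by linarith

lemma no_triple:
  "a \<in> A \<Longrightarrow> b \<in> A \<Longrightarrow> c \<in> A \<Longrightarrow> a \<noteq> b \<Longrightarrow> a \<noteq> c \<Longrightarrow> b \<noteq> c \<Longrightarrow>
    a + b \<in> A \<Longrightarrow> a + c \<in> A \<Longrightarrow> b + c \<in> A \<Longrightarrow> False"
  using free unfolding has_pairwise_sum_triple_def by blast

lemma card_le_missing: "V \<subseteq> A \<Longrightarrow> card V \<le> card (rsum V - A) + 3"
proof (rule card_le_missing_sums)
  assume V: "V \<subseteq> A"
  then show "finite V" using fin_A by (rule finite_subset)
  show False if "a \<in> V" "b \<in> V" "c \<in> V" "a \<noteq> b" "a \<noteq> c" "b \<noteq> c" "a + b \<in> A" "a + c \<in> A" "b + c \<in> A" for a b c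
    using no_triple[of a b c] that V by blast
qed

lemma missing_of_pair:
  assumes ab: "a < b" "a \<in> A" "b \<in> A" "a + b \<in> A" and s: "b \<le> s"
  shows "e \<le> s + b + 3 * card ({s<..e} - A)"
    and "e \<le> s + 2 * b \<Longrightarrow> e \<le> s + b + 2 * card ({s<..e} - A)"
proof -
  have no: "False" if "s < c" "c \<in> A" "c + a \<in> A" "c + b \<in> A" for c
    using no_triple[of a b c] ab s that by (simp add: add.commute)
  show "e \<le> s + b + 3 * card ({s<..e} - A)"
    by (rule missing_of_forbidden_pattern(1)[OF ab(1)]) (rule no)
  show "e \<le> s + b + 2 * card ({s<..e} - A)" if "e \<le> s + 2 * b"
    by (rule missing_of_forbidden_pattern(2)[OF ab(1) _ that]) (rule no)
qed

lemma initial_missing: "n < N \<Longrightarrow> 3 * n < 8 * card (M \<inter> {1..n}) + 8 * C"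
proof -
  assume n: "n < N"
  have "\<not> has_pairwise_sum_triple (A \<inter> {1..n})" using free has_pairwise_sum_triple_mono by blast
  then have "8 * card (A \<inter> {1..n}) < 5 * n + 8 * C" using IH[OF n] by simp
  moreover have "card {1..n} = card (A \<inter> {1..n}) + card (M \<inter> {1..n})"
  proof -
    have "{1..n} = (A \<inter> {1..n}) \<union> (M \<inter> {1..n})" unfolding M_def using n by auto
    moreover have "(A \<inter> {1..n}) \<inter> (M \<inter> {1..n}) = {}" unfolding M_def by auto
    ultimately show ?thesis by (metis card_Un_disjoint finite_Int finite_atLeastAtMost)
  qed
  ultimately show ?thesis by simp
qed

text \<open>
  Q is a large independent set in the lower half of {1..N} that lies in an arithmetic progression of
  step g. The parameter l is the diameter of Q in units of g, and K is a bound for the number of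
  elements by which Q falls short of N/8 + C. The following lemmas exclude every value of g.
\<close>

context
  fixes Q :: "nat set" and g u l K :: nat
  assumes QA: "Q \<subseteq> A" and ind: "rsum Q \<inter> A = {}" and g: "0 < g"
    and sub: "Q \<subseteq> (\<lambda>y. u + g * y) ` {0..l}" and uQ: "u \<in> Q" and zQ: "u + g * l \<in> Q"
    and zN: "2 * u + 2 * (g * l) \<le> N" and dense: "l + 5 \<le> 2 * card Q"
    and rs: "card Q + l \<le> card (rsum Q) + 2"
    and big: "N + 8 * C \<le> 8 * card Q + 8 * K" and CK: "K + 1000 \<le> C"
begin

lemma fin_Q: "finite Q"
  using QA fin_A finite_subset by blast

lemma card_Q: "card Q \<le> l + 1"
proof -
  have "card Q \<le> card ((\<lambda>y. u + g * y) ` {0..l})" using sub by (intro card_mono) auto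
  also have "\<dots> \<le> card {0..l}" by (rule card_image_le) simp
  finally show ?thesis by simp
qed

lemma u_pos: "1 \<le> u"
  using uQ QA A_sub by auto

lemma Q_range: "x \<in> Q \<Longrightarrow> u \<le> x \<and> x \<le> u + g * l"
  using sub by auto

lemma rsum_Q_range: "s \<in> rsum Q \<Longrightarrow> 2 * u < s \<and> s < 2 * u + 2 * (g * l)"
proof -
  assume "s \<in> rsum Q"
  then obtain x y where "x \<in> Q" "y \<in> Q" "x \<noteq> y" "s = x + y" unfolding rsum_def by blast
  then have "u \<le> x" "u \<le> y" "x \<le> u + g * l" "y \<le> u + g * l" "x \<noteq> y" "s = x + y" using Q_range by blast+
  then show ?thesis by linarith
qed

lemma rsum_Q_M: "rsum Q \<subseteq> M"
proof
  fix s assume s: "s \<in> rsum Q"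
  then have "1 \<le> s" "s \<le> N" using rsum_Q_range[OF s] zN by auto
  then show "s \<in> M" using s ind unfolding M_def by auto
qed

lemma multiples_bound: "g dvd u \<Longrightarrow> g * (2 * card Q) \<le> u + g * l + 2 * g"
proof (rule max_not_sum[OF fin_Q g _ zQ])
  assume "g dvd u"
  then show "g dvd x \<and> 0 < x \<and> x \<le> u + g * l" if "x \<in> Q" for x
    using that sub Q_range[OF that] u_pos by auto
  show "u + g * l \<notin> rsum Q" using ind zQ QA by blast
qed

lemma g_le_3: "g \<le> 3"
proof (rule ccontr)
  assume "\<not> g \<le> 3"
  then have "4 * l \<le> g * l" by (intro mult_right_mono) auto
  moreover define G where "G = g * l"
  ultimately have "4 * l \<le> G" "2 * u + 2 * G \<le> N" using zN by simp_all
  then show False using card_Q big CK by linarith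
qed

lemma g_dvd_u: "g dvd u \<Longrightarrow> g = 1"
proof (rule ccontr)
  assume d: "g dvd u" and "g \<noteq> 1"
  then have g2: "2 \<le> g" using g by linarith
  have p: "1 \<le> card Q" using dense by linarith
  define r where "r = 2 * card Q - 2"
  define W where "W = g * r"
  define z where "z = u + g * l"
  have r: "2 * card Q = r + 2" using p unfolding r_def by simp
  have "W + 2 * g \<le> z + 2 * g" using multiples_bound[OF d] unfolding r W_def z_def by (simp add: algebra_simps)
  moreover have "2 * r \<le> W" unfolding W_def using g2 by (intro mult_right_mono) auto
  moreover have "2 * z \<le> N" using zN unfolding z_def by simp
  ultimately show False using big CK r by linarith
qed

text \<open>
  All restricted sums of Q lie in the class of 2u modulo 3, which is not 0. Minimality of N for {x.
  3x \<in> A} yields about N/8 missing multiples of 3 in addition to the at least N/4 restricted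
  sums.
\<close>

lemma g_not_3: "g \<noteq> 3"
proof
  assume g3: "g = 3"
  then have u3: "\<not> 3 dvd u" using g_dvd_u by auto
  define A3 where "A3 = {x. 3 * x \<in> A}"
  have A3s: "A3 \<subseteq> {1..N div 3}" unfolding A3_def using A_sub by force
  have N0: "0 < N" using zN u_pos by simp
  have "\<not> has_pairwise_sum_triple A3"
  proof
    assume "has_pairwise_sum_triple A3"
    then obtain a b c where "a \<in> A3" "b \<in> A3" "c \<in> A3" "a \<noteq> b" "a \<noteq> c" "b \<noteq> c"
      "a + b \<in> A3" "a + c \<in> A3" "b + c \<in> A3" unfolding has_pairwise_sum_triple_def by blast
    then show False using no_triple[of "3 * a" "3 * b" "3 * c"] unfolding A3_def by (simp add: distrib_left)
  qed
  then have 1: "8 * card A3 < 5 * (N div 3) + 8 * C" using IH[of "N div 3" A3] A3s N0 by simp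
  define M3 where "M3 = (\<lambda>x. 3 * x) ` ({1..N div 3} - A3)"
  have fA3: "finite A3" using A3s finite_subset by blast
  have cM3: "card M3 + card A3 = N div 3"
  proof -
    have "card M3 = card ({1..N div 3} - A3)" unfolding M3_def by (rule card_image) (simp add: inj_on_def)
    moreover have "card {1..N div 3} = card ({1..N div 3} \<inter> A3) + card ({1..N div 3} - A3)"
      by (rule card_Int_Diff) simp
    moreover have "{1..N div 3} \<inter> A3 = A3" using A3s by blast
    ultimately show ?thesis by simp
  qed
  have "M3 \<inter> rsum Q = {}"
  proof (rule ccontr)
    assume "M3 \<inter> rsum Q \<noteq> {}"
    then obtain t where t: "t \<in> M3" "t \<in> rsum Q" by blast
    then obtain x y where xy: "x \<in> Q" "y \<in> Q" "t = x + y" unfolding rsum_def by blast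
    obtain i j where "x = u + 3 * i" "y = u + 3 * j" using sub xy(1,2) g3 by blast
    then have "t = 2 * u + 3 * (i + j)" using xy(3) by simp
    moreover have "3 dvd t" using t(1) unfolding M3_def by auto
    ultimately have "3 dvd 2 * u" by (metis dvd_add_left_iff dvd_triv_left)
    then show False using u3 by presburger
  qed
  then have "card M3 + card (rsum Q) = card (M3 \<union> rsum Q)"
    by (intro card_Un_disjoint[symmetric]) (auto simp: M3_def finite_rsum fin_Q)
  also have "\<dots> \<le> card M" using rsum_Q_M fin_M
    by (intro card_mono) (auto simp: M3_def A3_def M_def)
  finally have "card M3 + card (rsum Q) \<le> card M" .
  moreover have "N \<le> 3 * (N div 3) + 2" by linarith
  ultimately show False using 1 cM3 card_M rs card_Q big CK by linarith
qed

text \<open>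
  All of Q is odd. Among the odd numbers below u each one is missing or lies in A, and
  card_le_missing for the latter produces missing even numbers below 2u; likewise for the odd
  numbers between z and N/2, with even numbers above 2z. The restricted sums of Q lie strictly
  between 2u and 2z. Together with them N/4 + |Q| elements are missing, up to a constant.
\<close>

lemma g_not_2: "g \<noteq> 2"
proof
  assume g2: "g = 2"
  then have ou: "odd u" using g_dvd_u by auto
  define z where "z = u + 2 * l"
  have oz: "odd z" unfolding z_def using ou by simp
  define O1 where "O1 = {x. odd x \<and> x < u}"
  define O2 where "O2 = {x. odd x \<and> z < x \<and> 2 * x \<le> N}"
  have fO: "finite O1" "finite O2"
    by (rule finite_subset[of _ "{..u}"], auto simp: O1_def)
      (rule finite_subset[of _ "{..N}"], auto simp: O2_def)
  have cO1: "u \<le> 2 * card O1 + 1"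
  proof -
    have "card ((\<lambda>i. 2 * i + 1) ` {..<u div 2}) \<le> card O1"
      using fO(1) by (rule card_mono) (use ou in \<open>auto simp: O1_def elim!: oddE\<close>)
    then show ?thesis by (simp add: card_image inj_on_def)
  qed
  have cO2: "N \<le> 4 * card O2 + 2 * z + 4"
  proof -
    have "card ((\<lambda>i. z + 2 + 2 * i) ` {..<(N - 2 * z) div 4}) \<le> card O2"
      using fO(2) by (rule card_mono) (use oz in \<open>auto simp: O2_def\<close>)
    then have "(N - 2 * z) div 4 \<le> card O2" by (simp add: card_image inj_on_def)
    then show ?thesis by linarith
  qed
  define V1 where "V1 = O1 \<inter> A"
  define V2 where "V2 = O2 \<inter> A"
  have fV: "finite V1" "finite V2" unfolding V1_def V2_def using fO by auto
  have m1: "card V1 \<le> card (rsum V1 - A) + 3" and m2: "card V2 \<le> card (rsum V2 - A) + 3"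
    by (rule card_le_missing; simp add: V1_def V2_def)+
  have d1: "card O1 = card V1 + card (O1 - A)" unfolding V1_def using fO(1) by (rule card_Int_Diff)
  have d2: "card O2 = card V2 + card (O2 - A)" unfolding V2_def using fO(2) by (rule card_Int_Diff)
  have r1: "even s \<and> 0 < s \<and> s < 2 * u" if "s \<in> rsum V1" for s
    using that unfolding rsum_def V1_def O1_def by (auto elim!: oddE)
  have r2: "even s \<and> 2 * z < s \<and> s \<le> N" if "s \<in> rsum V2" for s
    using that unfolding rsum_def V2_def O2_def by auto
  have r: "even s \<and> 2 * u < s \<and> s < 2 * z" if s: "s \<in> rsum Q" for s
  proof -
    obtain x y where xy: "x \<in> Q" "y \<in> Q" "s = x + y" using s unfolding rsum_def by blast
    obtain i j where "x = u + 2 * i" "y = u + 2 * j" using sub xy(1,2) g2 by blast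
    then have "even s" using xy(3) by simp
    then show ?thesis using rsum_Q_range[OF s] g2 unfolding z_def by simp
  qed
  have uz: "u \<le> z" "2 * z \<le> N" using zN g2 unfolding z_def by auto
  define E where "E = rsum V1 - A"
  define E' where "E' = rsum V2 - A"
  have fE: "finite E" "finite E'" "finite (rsum Q)" unfolding E_def E'_def using fV fin_Q by (simp_all add: finite_rsum)
  have Er: "even s \<and> 0 < s \<and> s < 2 * u \<and> s \<notin> A" if "s \<in> E" for s using that r1 unfolding E_def by blast
  have Er': "even s \<and> 2 * z < s \<and> s \<le> N \<and> s \<notin> A" if "s \<in> E'" for s using that r2 unfolding E'_def by blast
  have "card ((O1 - A) \<union> ((O2 - A) \<union> (E \<union> (E' \<union> rsum Q)))) \<le> card M"
  proof (rule card_mono[OF fin_M])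
    have "O1 - A \<subseteq> M" unfolding O1_def M_def using uz by (auto elim!: oddE)
    moreover have "O2 - A \<subseteq> M" unfolding O2_def M_def by (auto elim!: oddE)
    moreover have "E \<subseteq> M" using Er uz unfolding M_def by fastforce
    moreover have "E' \<subseteq> M" using Er' uz unfolding M_def by fastforce
    ultimately show "(O1 - A) \<union> ((O2 - A) \<union> (E \<union> (E' \<union> rsum Q))) \<subseteq> M" using rsum_Q_M by blast
  qed
  moreover have "card ((O1 - A) \<union> ((O2 - A) \<union> (E \<union> (E' \<union> rsum Q))))
     = card (O1 - A) + card ((O2 - A) \<union> (E \<union> (E' \<union> rsum Q)))"
  proof (rule card_Un_disjoint)
    have "x \<notin> O2 - A" if "x \<in> O1" for x using that uz unfolding O1_def O2_def by auto
    moreover have "x \<notin> E \<union> (E' \<union> rsum Q)" if "x \<in> O1" for x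
      using that Er[of x] Er'[of x] r[of x] unfolding O1_def by blast
    ultimately show "(O1 - A) \<inter> ((O2 - A) \<union> (E \<union> (E' \<union> rsum Q))) = {}" by blast
  qed (use fO fE in auto)
  moreover have "card ((O2 - A) \<union> (E \<union> (E' \<union> rsum Q))) = card (O2 - A) + card (E \<union> (E' \<union> rsum Q))"
  proof (rule card_Un_disjoint)
    have "x \<notin> E \<union> (E' \<union> rsum Q)" if "x \<in> O2" for x
      using that Er[of x] Er'[of x] r[of x] unfolding O2_def by blast
    then show "(O2 - A) \<inter> (E \<union> (E' \<union> rsum Q)) = {}" by blast
  qed (use fO fE in auto)
  moreover have "card (E \<union> (E' \<union> rsum Q)) = card E + card (E' \<union> rsum Q)"
  proof (rule card_Un_disjoint)
    have "x \<notin> E' \<union> rsum Q" if "x \<in> E" for x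
      using Er[OF that] Er'[of x] r[of x] uz by force
    then show "E \<inter> (E' \<union> rsum Q) = {}" by blast
  qed (use fE in auto)
  moreover have "card (E' \<union> rsum Q) = card E' + card (rsum Q)"
  proof (rule card_Un_disjoint)
    have "x \<notin> rsum Q" if "x \<in> E'" for x using Er'[OF that] r[of x] by force
    then show "E' \<inter> rsum Q = {}" by blast
  qed (use fE in auto)
  ultimately have "card (O1 - A) + card (O2 - A) + card E + card E' + card (rsum Q) \<le> card M" by linarith
  then show False
    using m1 m2 d1 d2 cO1 cO2 rs big card_M CK card_Q z_def unfolding E_def E'_def by linarith
qed

text \<open>
  Few elements of {1..2u} are missing, because the restricted sums of Q already account for almost
  all of M. So there are a < b with a, b, a + b in A and a + b \<le> 2u, and by missing_of_pair many
  elements above 2z are missing. Minimality of N for {1..2u} bounds the missing elements there from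
  below. The three ranges are disjoint, and their total exceeds |M|.
\<close>

lemma g_not_1: "g \<noteq> 1"
proof
  assume g1: "g = 1"
  define z where "z = u + l"
  have uz: "2 * z \<le> N" "u < z" using zN g1 card_Q big CK unfolding z_def by simp_all
  have z2: "2 * card Q \<le> z + 2" using multiples_bound g1 unfolding z_def by simp
  define A2 where "A2 = A \<inter> {1..2 * u}"
  define L where "L = M \<inter> {1..2 * u}"
  define T where "T = {2 * z<..N} - A"
  have fin: "finite L" "finite T" "finite (rsum Q)"
    unfolding L_def T_def using fin_M fin_Q by (auto simp: finite_rsum)
  have A2: "card A2 + card L = 2 * u"
  proof -
    have "{1..2 * u} = A2 \<union> L" unfolding A2_def L_def M_def using uz by auto
    moreover have "A2 \<inter> L = {}" unfolding A2_def L_def M_def by auto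
    moreover have "finite A2" unfolding A2_def by simp
    ultimately have "card {1..2 * u} = card A2 + card L" using fin by (simp add: card_Un_disjoint)
    then show ?thesis by simp
  qed
  have rng: "2 * u < s \<and> s < 2 * z" if "s \<in> rsum Q" for s using rsum_Q_range[OF that] g1 unfolding z_def by simp
  have "card L + card T + card (rsum Q) = card (L \<union> T \<union> rsum Q)"
  proof -
    have "L \<inter> T = {}" unfolding L_def T_def using uz by auto
    moreover have "(L \<union> T) \<inter> rsum Q = {}" unfolding L_def T_def using rng by fastforce
    ultimately show ?thesis using fin by (simp add: card_Un_disjoint)
  qed
  also have "\<dots> \<le> card M"
    using fin_M by (rule card_mono) (use rsum_Q_M in \<open>auto simp: L_def T_def M_def\<close>)
  finally have tot: "card L + card T + card (rsum Q) \<le> card M" .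
  have ih: "3 * (2 * u) < 8 * card L + 8 * C" using initial_missing[of "2 * u"] uz unfolding L_def by simp
  have "2 * u + 3 \<le> 2 * card A2"
    using tot rs z2 big card_M CK A2 z_def by linarith
  moreover have "A2 \<subseteq> {1..2 * u}" unfolding A2_def by simp
  ultimately obtain a b where ab: "a < b" "a \<in> A2" "b \<in> A2" "a + b \<in> A2" using schur_pair by metis
  have b: "b < 2 * u" using ab(2,4) unfolding A2_def by auto
  have ab': "a < b" "a \<in> A" "b \<in> A" "a + b \<in> A" using ab unfolding A2_def by auto
  have "b \<le> 2 * z" using b uz by linarith
  note S = missing_of_pair[OF ab' this, of N, folded T_def]
  show False
  proof (cases "N \<le> 2 * z + 2 * b")
    case True
    then show False using S(2) b tot rs big card_M CK ih card_Q z_def by linarith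
  next
    case False
    then show False using S(1) b tot rs big card_M CK ih card_Q z2 z_def by linarith
  qed
qed

lemma no_progression: False
  using g g_le_3 g_not_1 g_not_2 g_not_3 by linarith

end

end

section \<open>Independent sets with many restricted sums\<close>

text \<open>
  Inclusion-exclusion for the c in A and the c with v + c in A.
\<close>

lemma card_common_neighbours:
  fixes A :: "nat set" and v y :: nat
  defines "P \<equiv> {c \<in> {1..y}. c \<in> A \<and> v + c \<in> A}" and "Z \<equiv> {c \<in> {1..y}. c \<notin> A \<and> v + c \<notin> A}"
  shows "card (A \<inter> {1..y}) + card (A \<inter> {v<..v + y}) + card Z = y + card P"
proof -
  define X where "X = A \<inter> {1..y}"
  define Y where "Y = {c \<in> {1..y}. v + c \<in> A}"
  have "A \<inter> {v<..v + y} = (\<lambda>c. v + c) ` Y"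
  proof (intro equalityI subsetI)
    fix s assume "s \<in> A \<inter> {v<..v + y}"
    then have "s = v + (s - v)" "s - v \<in> Y" unfolding Y_def by auto
    then show "s \<in> (\<lambda>c. v + c) ` Y" by blast
  qed (auto simp: Y_def)
  then have cY: "card (A \<inter> {v<..v + y}) = card Y" by (simp add: card_image)
  have fin: "finite X" "finite Y" "finite Z" unfolding X_def Y_def Z_def by auto
  have "card X + card Y = card (X \<union> Y) + card (X \<inter> Y)" by (rule card_Un_Int[OF fin(1,2)])
  moreover have "X \<inter> Y = P" unfolding X_def Y_def P_def by auto
  moreover have "card ((X \<union> Y) \<union> Z) = card (X \<union> Y) + card Z"
    by (rule card_Un_disjoint) (use fin in \<open>auto simp: X_def Y_def Z_def\<close>)
  moreover have "(X \<union> Y) \<union> Z = {1..y}" unfolding X_def Y_def Z_def by auto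
  ultimately show ?thesis using cY unfolding X_def by simp
qed

context minimal_counterexample
begin

text \<open>
  The restriction to the lower half of {1..N} ensures that all restricted sums are missing elements,
  not merely elements outside A.
\<close>

definition independent :: "nat set \<Rightarrow> bool" where
  "independent P \<longleftrightarrow> P \<subseteq> A \<and> (\<forall>x\<in>P. 2 * x \<le> N) \<and> rsum P \<inter> A = {}"

lemma independent_finite: "independent P \<Longrightarrow> finite P"
  unfolding independent_def using fin_A finite_subset by blast

lemma independent_rsum: "independent P \<Longrightarrow> rsum P \<subseteq> M"
proof
  fix s assume i: "independent P" and s: "s \<in> rsum P"
  then obtain x y where xy: "x \<in> P" "y \<in> P" "x \<noteq> y" "s = x + y" unfolding rsum_def by blast
  then have "2 * x \<le> N" "2 * y \<le> N" "x \<in> A" using i unfolding independent_def by auto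
  then have "s \<in> {1..N}" using xy(4) A_sub by auto
  then show "s \<in> M" using s i unfolding independent_def M_def by auto
qed

lemma neighbours_independent:
  assumes "v \<in> A" "\<And>c. c \<in> P \<Longrightarrow> c \<in> A \<and> c \<noteq> v \<and> v + c \<in> A \<and> 2 * c \<le> N"
  shows "independent P"
proof -
  have "s \<notin> A" if s: "s \<in> rsum P" for s
  proof -
    obtain x y where xy: "x \<in> P" "y \<in> P" "x \<noteq> y" "s = x + y" using s unfolding rsum_def by blast
    then show ?thesis using no_triple[of v x y] assms(1) assms(2)[of x] assms(2)[of y] by auto
  qed
  then show ?thesis unfolding independent_def using assms(2) by auto
qed

text \<open>
  The hypothesis freiman is the conclusion of small_rsum_progression_nat for q = 200, the value for
  which the numerical estimates below have ample room.
\<close>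

context
  fixes K :: nat
  assumes freiman: "\<forall>P::nat set. finite P \<longrightarrow> K \<le> card P \<longrightarrow> P \<subseteq> {0..4 * card P} \<longrightarrow>
     200 * card (rsum P) + card P \<le> 3 * 200 * card P \<longrightarrow>
     (\<exists>Q g u l. Q \<subseteq> P \<and> 0 < g \<and> card P \<le> card Q + K \<and> Q \<subseteq> (\<lambda>y. u + g * y) ` {0..l} \<and> u \<in> Q \<and> u + g * l \<in> Q \<and>
       l + 5 \<le> 2 * card Q \<and> card Q + l \<le> card (rsum Q) + 2)"
    and CK: "K + 2000 \<le> C"
begin

text \<open>
  Otherwise all but K elements of P form a dense piece of an arithmetic progression, which
  no_progression excludes.
\<close>

lemma large_independent_many_sums:
  assumes P: "independent P" and big: "N + 8 * C \<le> 8 * card P + 8"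
  shows "599 * card P < 200 * card (rsum P)"
proof (rule ccontr)
  assume "\<not> ?thesis"
  then have sm: "200 * card (rsum P) + card P \<le> 3 * 200 * card P" by simp
  have "K \<le> card P" using big CK by linarith
  moreover have "P \<subseteq> {0..4 * card P}"
  proof
    fix x assume "x \<in> P"
    then have "2 * x \<le> N" using P unfolding independent_def by blast
    then have "x \<le> 4 * card P" using big CK by linarith
    then show "x \<in> {0..4 * card P}" by simp
  qed
  ultimately obtain Q g u l where Q: "Q \<subseteq> P" "0 < g" "card P \<le> card Q + K" "Q \<subseteq> (\<lambda>y. u + g * y) ` {0..l}"
      "u \<in> Q" "u + g * l \<in> Q" "l + 5 \<le> 2 * card Q" "card Q + l \<le> card (rsum Q) + 2"
    using freiman[rule_format, OF independent_finite[OF P] _ _ sm] by blast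
  have "Q \<subseteq> A" "rsum Q \<inter> A = {}" using Q(1) rsum_mono[OF Q(1)] P unfolding independent_def by blast+
  moreover have "2 * (u + g * l) \<le> N" using Q(1,6) P unfolding independent_def by blast
  then have "2 * u + 2 * (g * l) \<le> N" by simp
  moreover have "N + 8 * C \<le> 8 * card Q + 8 * (K + 1)" using big Q(3) by simp
  moreover have "K + 1 + 1000 \<le> C" using CK by linarith
  ultimately show False using no_progression Q by blast
qed

lemma independent_card:
  assumes P: "independent P"
  shows "8 * card P + 8 < N + 8 * C \<or> 599 * card P + 200 * C \<le> 75 * N"
proof -
  have "card (rsum P) \<le> card M" by (rule card_mono[OF fin_M independent_rsum[OF P]])
  then show ?thesis using large_independent_many_sums[OF P] card_M by linarith
qed

text \<open>
  v is the least element of A in the upper half. P is its neighbourhood in {1..x} and Z the set of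
  those c for which both members of the pair (c, v + c) are missing. As v + x = N, these pairs, the
  interval between x and v, and v itself make up {1..N}.
\<close>

definition H :: nat where "H = N div 2"
definition v :: nat where "v = Min (A \<inter> {H<..N})"
definition x :: nat where "x = N - v"
definition P where "P = {c \<in> {1..x}. c \<in> A \<and> v + c \<in> A}"
definition Z where "Z = {c \<in> {1..x}. c \<notin> A \<and> v + c \<notin> A}"

lemma H_bounds: "2 * H \<le> N" "N \<le> 2 * H + 1"
  unfolding H_def by auto

lemma N_large: "2000000 \<le> N"
  using C_large card_M by linarith

lemma v_least: "v \<in> A" "H < v" "v \<le> N" "s \<in> A \<Longrightarrow> H < s \<Longrightarrow> v \<le> s"
proof -
  have "\<not> A \<subseteq> {1..H}"
  proof
    assume "A \<subseteq> {1..H}"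
    then have "card A \<le> H" using card_mono[of "{1..H}" A] by simp
    then show False using large H_bounds(1) C_large by linarith
  qed
  then have ne: "A \<inter> {H<..N} \<noteq> {}" using A_sub by fastforce
  have fin: "finite (A \<inter> {H<..N})" by simp
  have "v \<in> A \<inter> {H<..N}" unfolding v_def by (rule Min_in[OF fin ne])
  then show "v \<in> A" "H < v" "v \<le> N" by auto
  show "v \<le> s" if "s \<in> A" "H < s"
    unfolding v_def using fin that A_sub by (intro Min_le) auto
qed

lemma x_bounds: "v + x = N" "2 * x < N" "x < v" "x \<le> H"
  using v_least(2,3) H_bounds unfolding x_def by linarith+

lemma P_independent: "independent P"
  by (rule neighbours_independent[OF v_least(1)]) (use x_bounds in \<open>auto simp: P_def\<close>)

lemma P_Z_card: "card A + card Z = card P + card (A \<inter> {x<..H}) + x + 1"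
proof -
  have "A = (A \<inter> {1..x}) \<union> ((A \<inter> {x<..H}) \<union> ({v} \<union> (A \<inter> {v<..v + x})))"
  proof (intro equalityI subsetI)
    fix s assume s: "s \<in> A"
    then have "1 \<le> s" "s \<le> N" using A_sub by auto
    then show "s \<in> (A \<inter> {1..x}) \<union> ((A \<inter> {x<..H}) \<union> ({v} \<union> (A \<inter> {v<..v + x})))"
      using v_least(4)[OF s] s x_bounds(1) by (cases "H < s") auto
  qed (use v_least(1) in auto)
  also have "card \<dots> = card (A \<inter> {1..x}) + (card (A \<inter> {x<..H}) + (1 + card (A \<inter> {v<..v + x})))"
    by (subst card_Un_disjoint, (use v_least x_bounds in auto)[3])+ simp
  finally have "card A = card (A \<inter> {1..x}) + (card (A \<inter> {x<..H}) + (1 + card (A \<inter> {v<..v + x})))" .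
  then show ?thesis using card_common_neighbours[of A x v] unfolding P_def Z_def by linarith
qed

lemma P_card: "N + 8 * C + 8 * card Z \<le> 8 * card P + 8"
proof -
  have "card (A \<inter> {x<..H}) \<le> card {x<..H}" by (rule card_mono) auto
  then have "card (A \<inter> {x<..H}) + x \<le> H" using x_bounds(4) by simp
  then show ?thesis using P_Z_card large H_bounds by linarith
qed

text \<open>
  P has at least N/8 + C - 1 + |Z| elements and, like every large independent set, at most 75N/599 =
  N/8 + N/4792.
\<close>

lemma C_Z_small: "4792 * C + 4792 * card Z \<le> N"
  using independent_card[OF P_independent] P_card C_large by linarith

lemma independent_upper: "independent S \<Longrightarrow> 599 * card S \<le> 75 * N"
  using independent_card[of S] C_Z_small by linarith

definition e :: nat where "e = card (M - rsum P)"

lemma e_small: "1600 * e \<le> N"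
proof -
  have "card M = card (M \<inter> rsum P) + e" unfolding e_def by (rule card_Int_Diff[OF fin_M])
  moreover have "M \<inter> rsum P = rsum P" using independent_rsum[OF P_independent] by blast
  ultimately have "card M = card (rsum P) + e" by simp
  moreover have "599 * card P < 200 * card (rsum P)"
    using large_independent_many_sums[OF P_independent] P_card by linarith
  ultimately show ?thesis using P_card card_M C_large by linarith
qed

text \<open>
  Restricted sums of elements above x exceed all restricted sums of P. Those that are missing are
  therefore among the exceptional elements counted by e.
\<close>

lemma few_elements_below_half: "card (A \<inter> {x<..H}) \<le> e + 3"
proof -
  have "rsum (A \<inter> {x<..H}) - A \<subseteq> M - rsum P"
  proof
    fix s assume s: "s \<in> rsum (A \<inter> {x<..H}) - A"
    then obtain a b where ab: "a \<in> A" "a \<le> H" "b \<le> H" "x < a" "x < b" "s = a + b"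
      unfolding rsum_def by auto
    then have "s \<in> {1..N}" using H_bounds(1) by auto
    moreover have "s \<notin> rsum P"
    proof
      assume "s \<in> rsum P"
      then obtain c d where "c \<le> x" "d \<le> x" "s = c + d" unfolding rsum_def P_def by auto
      then show False using ab by linarith
    qed
    ultimately show "s \<in> M - rsum P" using s unfolding M_def by blast
  qed
  then have "card (rsum (A \<inter> {x<..H}) - A) \<le> e" unfolding e_def using fin_M by (intro card_mono) auto
  moreover have "card (A \<inter> {x<..H}) \<le> card (rsum (A \<inter> {x<..H}) - A) + 3" by (rule card_le_missing) auto
  ultimately show ?thesis by linarith
qed

text \<open>
  Triple-freeness in (N/4, N/2] makes |A \<inter> (N/4, N/2]| essentially at most the number t of
  elements missing above N/2. The other two parts of A then leave enough elements in {1..N/4} for a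
  Schur pair a, b, a + b, and such a pair forces t to be at least about N/12.
\<close>

lemma many_missing_above: "N \<le> 12 * card ({H<..N} - A) + 12"
proof -
  define q where "q = N div 4"
  define t where "t = card ({H<..N} - A)"
  have q: "4 * q \<le> N" "N \<le> 4 * q + 3" "q \<le> H" "H \<le> 2 * q + 1" unfolding q_def H_def by linarith+
  have "card (A \<inter> {q<..H}) \<le> card (rsum (A \<inter> {q<..H}) - A) + 3" by (rule card_le_missing) auto
  also have "card (rsum (A \<inter> {q<..H}) - A) \<le> t"
    unfolding t_def
  proof (rule card_mono)
    show "rsum (A \<inter> {q<..H}) - A \<subseteq> {H<..N} - A"
    proof
      fix s assume s: "s \<in> rsum (A \<inter> {q<..H}) - A"
      then obtain a b where "a \<le> H" "b \<le> H" "q < a" "q < b" "a \<noteq> b" "s = a + b" unfolding rsum_def by auto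
      then have "s \<in> {H<..N}" using q H_bounds by auto
      then show "s \<in> {H<..N} - A" using s by simp
    qed
  qed simp
  finally have 1: "card (A \<inter> {q<..H}) \<le> t + 3" by simp
  have "card {H<..N} = card ({H<..N} \<inter> A) + t" unfolding t_def by (rule card_Int_Diff) simp
  then have 2: "N = H + card (A \<inter> {H<..N}) + t" using H_bounds by (simp add: Int_commute)
  have "A = (A \<inter> {1..q}) \<union> ((A \<inter> {q<..H}) \<union> (A \<inter> {H<..N}))" using A_sub by fastforce
  also have "card \<dots> = card (A \<inter> {1..q}) + (card (A \<inter> {q<..H}) + card (A \<inter> {H<..N}))"
    by (subst card_Un_disjoint, (use q in auto)[3])+ simp
  finally have 3: "card A = card (A \<inter> {1..q}) + (card (A \<inter> {q<..H}) + card (A \<inter> {H<..N}))" .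
  have "q + 3 \<le> 2 * card (A \<inter> {1..q})" using 1 2 3 large C_large H_bounds q by linarith
  moreover have "A \<inter> {1..q} \<subseteq> {1..q}" by simp
  ultimately obtain a b where ab: "a < b" "a \<in> A \<inter> {1..q}" "b \<in> A \<inter> {1..q}" "a + b \<in> A \<inter> {1..q}"
    using schur_pair by metis
  then have "a \<in> A" "b \<in> A" "a + b \<in> A" "b \<le> q" by auto
  then have "N \<le> H + b + 3 * t" unfolding t_def using ab(1) q by (intro missing_of_pair(1)[of a]) auto
  then show ?thesis using \<open>b \<le> q\<close> q H_bounds unfolding t_def by linarith
qed

definition u :: nat where "u = Min P"

lemma u_least: "u \<in> P" "\<And>c. c \<in> P \<Longrightarrow> u \<le> c"
proof -
  have "card P \<noteq> 0" using P_card C_large by linarith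
  then have "P \<noteq> {}" "finite P" by (auto simp: P_def)
  then show "u \<in> P" "\<And>c. c \<in> P \<Longrightarrow> u \<le> c" unfolding u_def by auto
qed

lemma u_bounds: "1 \<le> u" "u \<le> x" "u \<in> A" "v + u \<in> A" "u < v"
  using u_least(1) x_bounds unfolding P_def by auto

text \<open>
  Restricted sums of P exceed 2u, so at most e elements of {1..2u} are missing, while minimality of
  N for {1..2u} requires about 3u/4 of them.
\<close>

lemma u_small: "3 * u \<le> 4 * e + 4 * C"
proof -
  have "M \<inter> {1..2 * u} \<subseteq> M - rsum P"
  proof
    fix s assume s: "s \<in> M \<inter> {1..2 * u}"
    have "s \<notin> rsum P"
    proof
      assume "s \<in> rsum P"
      then obtain a b where "a \<in> P" "b \<in> P" "a \<noteq> b" "s = a + b" unfolding rsum_def by blast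
      then show False using u_least(2)[of a] u_least(2)[of b] s by auto
    qed
    then show "s \<in> M - rsum P" using s by simp
  qed
  then have "card (M \<inter> {1..2 * u}) \<le> e" unfolding e_def using fin_M by (intro card_mono) auto
  moreover have "3 * (2 * u) < 8 * card (M \<inter> {1..2 * u}) + 8 * C"
    by (rule initial_missing) (use u_bounds(2) x_bounds(2) in linarith)
  ultimately show ?thesis by linarith
qed

text \<open>
  The element v + u of A plays the same part as v, on the interval {1..D}.
\<close>

definition D :: nat where "D = x - u"
definition Z' where "Z' = {c \<in> {1..D}. c \<notin> A \<and> v + u + c \<notin> A}"

lemma D_add_u: "D + u = x"
  unfolding D_def using u_bounds(2) by simp

text \<open>
  The count that determined the size of P, now for v + u. The elements of A that it leaves out lie
  in (D, H] or in [v, v + u].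
\<close>

lemma Z'_small: "8 * card A + 8 * card Z' \<le> 8 * H + 8 * u + 8 + 8 * card {c \<in> {1..D}. c \<in> A \<and> v + u + c \<in> A}"
proof -
  have DN: "v + u + D = N" using D_add_u x_bounds(1) by linarith
  have "A \<subseteq> (A \<inter> {1..D}) \<union> ({D<..H} \<union> ({v..v + u} \<union> (A \<inter> {v + u<..v + u + D})))"
  proof
    fix s assume s: "s \<in> A"
    then have "1 \<le> s" "s \<le> N" using A_sub by auto
    then show "s \<in> (A \<inter> {1..D}) \<union> ({D<..H} \<union> ({v..v + u} \<union> (A \<inter> {v + u<..v + u + D})))"
      using v_least(4)[OF s] s DN by (cases "H < s") auto
  qed
  then have "card A \<le> card ((A \<inter> {1..D}) \<union> ({D<..H} \<union> ({v..v + u} \<union> (A \<inter> {v + u<..v + u + D}))))"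
    by (intro card_mono) auto
  also have "\<dots> \<le> card (A \<inter> {1..D}) + (card {D<..H} + (card {v..v + u} + card (A \<inter> {v + u<..v + u + D})))"
    by (intro order.trans[OF card_Un_le] add_left_mono order.refl)
  finally have "card A + D \<le> card (A \<inter> {1..D}) + H + u + 1 + card (A \<inter> {v + u<..v + u + D})"
    using D_add_u x_bounds(4) by simp
  then show ?thesis using card_common_neighbours[of A D "v + u"] unfolding Z'_def by linarith
qed

text \<open>
  The pairs (c, c + u) that lie in A form Dl, the low ones, and those whose translate by v lies in A
  form Dh, the high ones. The set F collects the exceptional c, for which neither happens. Rq
  catches the case that c and v + c + u lie in A while v + c does not.
\<close>

definition Dl where "Dl = {c \<in> {1..D}. c \<in> A \<and> c + u \<in> A \<and> c \<noteq> u}"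
definition Dh where "Dh = {c \<in> {1..D}. v + c \<in> A \<and> v + c + u \<in> A}"
definition Zs where "Zs = {c \<in> {1..D}. c + u \<in> Z}"
definition Rq where "Rq = {c \<in> {1..D}. c \<in> A \<and> v + c \<notin> A \<and> v + c + u \<in> A}"
definition F where "F = Z \<union> (Z' \<union> (Zs \<union> (Rq \<union> {u})))"

lemma fin_sets: "finite Dl" "finite Z" "finite Z'" "finite Zs" "finite Rq" "finite F"
  unfolding F_def Dl_def Z_def Z'_def Zs_def Rq_def by auto

lemma interval_cover: "c \<in> {1..D} \<Longrightarrow> c \<in> Dl \<or> c \<in> Dh \<or> c \<in> F"
  using D_add_u unfolding Dl_def Dh_def F_def Z_def Z'_def Zs_def Rq_def by (auto simp: ac_simps)

lemma card_Zs: "card Zs \<le> card Z"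
proof -
  have "card ((\<lambda>c. c + u) ` Zs) \<le> card Z" using fin_sets(2) by (rule card_mono) (auto simp: Zs_def)
  then show ?thesis by (simp add: card_image)
qed

text \<open>
  Along the shift by u the number of c with v + c missing but v + c + u present exceeds the number
  of c with the opposite behaviour by at most u. The opposite behaviour puts c into Z' unless c lies
  in A; and then, as u, v and u + v lie in A, c + u is missing for c \<noteq> u, so that c + u
  belongs to Z.
\<close>

lemma card_Rq: "card Rq \<le> card Z + card Z' + 1 + u"
proof -
  define B where "B = {c \<in> {1..D}. v + c \<in> A}"
  define B' where "B' = {c \<in> {1..D}. v + c + u \<in> A}"
  have fB: "finite B" "finite B'" unfolding B_def B'_def by auto
  have "card ((\<lambda>c. c + u) ` B') \<le> card (B \<union> {D<..D + u})"
  proof (rule card_mono)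
    show "(\<lambda>c. c + u) ` B' \<subseteq> B \<union> {D<..D + u}"
    proof
      fix s assume "s \<in> (\<lambda>c. c + u) ` B'"
      then obtain c where "s = c + u" "1 \<le> c" "c \<le> D" "v + c + u \<in> A" unfolding B'_def by auto
      then show "s \<in> B \<union> {D<..D + u}" unfolding B_def by (auto simp: ac_simps)
    qed
  qed (use fB in auto)
  also have "\<dots> \<le> card B + u" using card_Un_le[of B "{D<..D + u}"] by simp
  finally have "card B' \<le> card B + u" by (simp add: card_image)
  moreover have "card B' = card (B' \<inter> B) + card (B' - B)" "card B = card (B \<inter> B') + card (B - B')"
    by (rule card_Int_Diff[OF fB(2)], rule card_Int_Diff[OF fB(1)])
  moreover have "B \<inter> B' = B' \<inter> B" by blast
  ultimately have 1: "card (B' - B) \<le> card (B - B') + u" by simp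
  have "Rq \<subseteq> B' - B" unfolding Rq_def B_def B'_def by auto
  then have 2: "card Rq \<le> card (B' - B)" using fB by (intro card_mono) auto
  have "B - B' \<subseteq> Z' \<union> (Zs \<union> {u})"
  proof
    fix c assume "c \<in> B - B'"
    then have c: "c \<in> {1..D}" "v + c \<in> A" "v + c + u \<notin> A" unfolding B_def B'_def by auto
    show "c \<in> Z' \<union> (Zs \<union> {u})"
    proof (cases "c \<in> A \<and> c \<noteq> u")
      case True
      have "c < v" using c(1) D_add_u x_bounds(3) by auto
      then have "c + u \<notin> A"
        using no_triple[of u v c] True c(2) u_bounds v_least(1) by (auto simp: ac_simps)
      then have "c + u \<in> Z" using c D_add_u unfolding Z_def by (auto simp: ac_simps)
      then show ?thesis using c(1) unfolding Zs_def by simp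
    next
      case False
      then show ?thesis using c unfolding Z'_def by (auto simp: ac_simps)
    qed
  qed
  then have "card (B - B') \<le> card (Z' \<union> (Zs \<union> {u}))" using fin_sets by (intro card_mono) auto
  also have "\<dots> \<le> card Z' + (card Zs + card {u})"
    by (intro order.trans[OF card_Un_le] add_left_mono order.refl)
  finally show ?thesis using 1 2 card_Zs by simp
qed

lemma card_F: "card F \<le> 3 * card Z + 2 * card Z' + u + 2"
proof -
  have "card F \<le> card Z + (card Z' + (card Zs + (card Rq + card {u})))"
    unfolding F_def by (intro order.trans[OF card_Un_le] add_left_mono order.refl)
  then show ?thesis using card_Zs card_Rq by simp
qed

lemma Dl_independent: "independent Dl"
  by (rule neighbours_independent[OF u_bounds(3)]) (use D_add_u x_bounds(2) in \<open>auto simp: Dl_def ac_simps\<close>)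

text \<open>
  If c and c + d are both high, then d, u and v + c form a pairwise-sum triple. So one of c and c +
  d is low or exceptional, for each c \<le> D - d.
\<close>

lemma Dl_min:
  assumes d: "d \<in> Dl"
  shows "D \<le> d + 2 * (card Dl + card F)"
proof -
  have d': "d \<in> A" "d + u \<in> A" "d \<noteq> u" "1 \<le> d" "d \<le> D" using d unfolding Dl_def by auto
  let ?S = "Dl \<union> F"
  have fS: "finite ?S" using fin_sets by simp
  have "{1..D - d} \<subseteq> ?S \<union> (\<lambda>m. m - d) ` ?S"
  proof
    fix c assume c: "c \<in> {1..D - d}"
    then have cD: "c \<in> {1..D}" "c + d \<in> {1..D}" by auto
    have "\<not> (c \<in> Dh \<and> c + d \<in> Dh)"
    proof
      assume "c \<in> Dh \<and> c + d \<in> Dh"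
      then have h: "v + c \<in> A" "v + c + u \<in> A" "v + (c + d) \<in> A" "v + (c + d) + u \<in> A" unfolding Dh_def by auto
      show False
        using no_triple[of d u "v + c"] h d' u_bounds D_add_u x_bounds(3) by (auto simp: ac_simps)
    qed
    then consider "c \<in> ?S" | "c + d \<in> ?S" using interval_cover[OF cD(1)] interval_cover[OF cD(2)] by blast
    then show "c \<in> ?S \<union> (\<lambda>m. m - d) ` ?S"
    proof cases
      case 2
      then have "c \<in> (\<lambda>m. m - d) ` ?S" by (intro image_eqI[of _ _ "c + d"]) auto
      then show ?thesis by blast
    qed simp
  qed
  then have "card {1..D - d} \<le> card (?S \<union> (\<lambda>m. m - d) ` ?S)" using fS by (intro card_mono) auto
  also have "\<dots> \<le> card ?S + card ?S"
    using card_Un_le[of ?S "(\<lambda>m. m - d) ` ?S"] card_image_le[OF fS, of "\<lambda>m. m - d"] by linarith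
  finally show ?thesis using card_Un_le[of Dl F] by simp
qed

text \<open>
  If v + c is missing then c is not high.
\<close>

lemma missing_above_v: "card ({v<..N} - A) \<le> card Dl + card F + u"
proof -
  have "{v<..N} - A \<subseteq> (\<lambda>c. v + c) ` (Dl \<union> F) \<union> {v + D<..v + x}"
  proof
    fix s assume s: "s \<in> {v<..N} - A"
    then obtain c where c: "s = v + c" "1 \<le> c" "c \<le> x" using x_bounds(1) less_imp_add_positive[of v s] by auto
    show "s \<in> (\<lambda>c. v + c) ` (Dl \<union> F) \<union> {v + D<..v + x}"
    proof (cases "c \<le> D")
      case True
      then have "c \<in> Dl \<union> F" using interval_cover[of c] c s unfolding Dh_def by auto
      then show ?thesis using c(1) by blast
    qed (use c in simp)
  qed
  then have "card ({v<..N} - A) \<le> card ((\<lambda>c. v + c) ` (Dl \<union> F) \<union> {v + D<..v + x})"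
    using fin_sets by (intro card_mono) auto
  also have "\<dots> \<le> card ((\<lambda>c. v + c) ` (Dl \<union> F)) + card {v + D<..v + x}" by (rule card_Un_le)
  also have "\<dots> \<le> card (Dl \<union> F) + u" using D_add_u by (simp add: card_image)
  finally show ?thesis using card_Un_le[of Dl F] by linarith
qed

text \<open>
  Restricted sums of Dl are missing elements above 2d, and those between 2d and v are counted
  crudely.
\<close>

lemma Dl_upper:
  assumes d: "\<And>c. c \<in> Dl \<Longrightarrow> d \<le> c"
  shows "2 * card Dl \<le> card ({v<..N} - A) + (v - 2 * d) + 3"
proof -
  have "rsum Dl \<subseteq> ({v<..N} - A) \<union> {2 * d<..v}"
  proof
    fix s assume s: "s \<in> rsum Dl"
    then obtain a b where ab: "a \<in> Dl" "b \<in> Dl" "a \<noteq> b" "s = a + b" unfolding rsum_def by blast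
    then have "2 * d < s" using d[of a] d[of b] by linarith
    moreover have "s \<in> M" using independent_rsum[OF Dl_independent] s by blast
    ultimately show "s \<in> ({v<..N} - A) \<union> {2 * d<..v}" unfolding M_def by auto
  qed
  then have "card (rsum Dl) \<le> card (({v<..N} - A) \<union> {2 * d<..v})" by (intro card_mono) auto
  also have "\<dots> \<le> card ({v<..N} - A) + card {2 * d<..v}" by (rule card_Un_le)
  finally show ?thesis using card_rsum_ge[OF fin_sets(1)] by simp
qed

text \<open>
  All quantities w, u, |Z'| and |F| are small multiples of N. Then Dl_min gives d \<ge> N/4 up to
  small multiples, as |Dl| is at most about N/8, so v - 2d is small. The number t' of elements
  missing above v satisfies t' \<le> |Dl| and 2|Dl| \<le> t' up to small errors, whereas t' is at
  least about N/12.
\<close>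

lemma no_minimal_counterexample: False
proof -
  define t where "t = card ({H<..N} - A)"
  define t' where "t' = card ({v<..N} - A)"
  define pp where "pp = card {c \<in> {1..D}. c \<in> A \<and> v + u + c \<in> A}"
  define w where "w = v - H - 1"
  have w: "v = H + 1 + w" unfolding w_def using v_least(2) by simp
  have tt': "t \<le> t' + w"
  proof -
    have "{H<..N} - A \<subseteq> {H<..<v} \<union> ({v<..N} - A)"
    proof
      fix s assume "s \<in> {H<..N} - A"
      then have "s \<noteq> v" "H < s" "s \<le> N" "s \<notin> A" using v_least(1) by auto
      then show "s \<in> {H<..<v} \<union> ({v<..N} - A)" by auto
    qed
    then have "t \<le> card ({H<..<v} \<union> ({v<..N} - A))" unfolding t_def by (intro card_mono) auto
    also have "\<dots> \<le> card {H<..<v} + t'" unfolding t'_def by (rule card_Un_le)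
    finally show ?thesis using w by simp
  qed
  have "independent {c \<in> {1..D}. c \<in> A \<and> v + u + c \<in> A}"
    by (rule neighbours_independent[OF u_bounds(4)]) (use D_add_u x_bounds in auto)
  then have pp: "599 * pp \<le> 75 * N" unfolding pp_def by (rule independent_upper)
  note Z' = Z'_small[folded pp_def]
  have t: "N \<le> 12 * t + 12" using many_missing_above unfolding t_def .
  note Pb = independent_upper[OF P_independent]
  \<comment> \<open>The denominators in the following bounds are roundings with ample room.\<close>
  have wb: "200 * w \<le> N"
    using P_Z_card few_elements_below_half e_small Pb large x_bounds(1) w H_bounds C_large N_large by linarith
  have ub: "200 * u \<le> N" using u_small e_small C_Z_small by linarith
  have Zb': "500 * card Z' \<le> N" using Z' pp large H_bounds u_small e_small C_Z_small N_large C_large by linarith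
  have Fb: "180 * card F \<le> N" using card_F Zb' u_small e_small C_Z_small C_large N_large by linarith
  have Dlb: "599 * card Dl \<le> 75 * N" by (rule independent_upper[OF Dl_independent])
  have low: "t' \<le> card Dl + card F + u" using missing_above_v unfolding t'_def .
  have Dl_ne: "Dl \<noteq> {}"
  proof
    assume "Dl = {}"
    then have "t' \<le> card F + u" using low by simp
    then show False using tt' t wb ub Fb N_large by linarith
  qed
  define d where "d = Min Dl"
  have d: "d \<in> Dl" "\<And>c. c \<in> Dl \<Longrightarrow> d \<le> c" unfolding d_def using fin_sets(1) Dl_ne by auto
  have 1: "D \<le> d + 2 * card Dl + 2 * card F" using Dl_min[OF d(1)] by simp
  have 2: "2 * card Dl \<le> t' + (v - 2 * d) + 3" using Dl_upper[OF d(2)] unfolding t'_def .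
  have 3: "D + u = x" "v + x = N" by (rule D_add_u, rule x_bounds(1))
  show False
  proof (cases "v \<le> 2 * d")
    case True
    then have "2 * card Dl \<le> t' + 3" using 2 by simp
    then show False using low tt' t wb ub Fb N_large by linarith
  next
    case False
    then have "2 * card Dl + 2 * d \<le> t' + v + 3" using 2 by linarith
    then show False using low tt' t wb ub Fb N_large 1 3 w Dlb H_bounds by linarith
  qed
qed

end

end

section \<open>The bound for sets without pairwise-sum triples\<close>

theorem theorem1p1:
  shows "\<exists>C::real. C > 0 \<and>
    (\<forall>N::nat. N \<ge> 1 \<longrightarrow>
      (\<forall>A::nat set. A \<subseteq> {1..N} \<longrightarrow> real (card A) \<ge> 5 / 8 * real N + C \<longrightarrow>
        has_pairwise_sum_triple A))"
proof -
  obtain K where K: "\<forall>P::nat set. finite P \<longrightarrow> K \<le> card P \<longrightarrow> P \<subseteq> {0..4 * card P} \<longrightarrow>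
     200 * card (rsum P) + card P \<le> 3 * 200 * card P \<longrightarrow>
     (\<exists>Q g u l. Q \<subseteq> P \<and> 0 < g \<and> card P \<le> card Q + K \<and> Q \<subseteq> (\<lambda>y. u + g * y) ` {0..l} \<and> u \<in> Q \<and> u + g * l \<in> Q \<and>
       l + 5 \<le> 2 * card Q \<and> card Q + l \<le> card (rsum Q) + 2)"
    by (rule small_rsum_progression_nat[of 200]) simp_all
  \<comment> \<open>K absorbs the elements lost in the Freiman-type theorem; the large summand makes N exceed all
    rounding errors.\<close>
  define C where "C = K + 1000000"
  have bound: "A \<subseteq> {1..N} \<Longrightarrow> \<not> has_pairwise_sum_triple A \<Longrightarrow> 8 * card A < 5 * N + 8 * C" for N A
  proof (induction N arbitrary: A rule: less_induct)
    case (less N)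
    show ?case
    proof (rule ccontr)
      assume "\<not> ?thesis"
      then have "minimal_counterexample N C A"
        using less by unfold_locales (auto simp: C_def)
      then show False
        by (rule minimal_counterexample.no_minimal_counterexample[OF _ K]) (simp add: C_def)
    qed
  qed
  have "has_pairwise_sum_triple A"
    if A: "A \<subseteq> {1..N}" and big: "real (card A) \<ge> 5 / 8 * real N + real C" for N A
  proof (rule ccontr)
    assume "\<not> has_pairwise_sum_triple A"
    then have "8 * card A < 5 * N + 8 * C" using bound A by blast
    then have "real (8 * card A) < real (5 * N + 8 * C)" by (simp only: of_nat_less_iff)
    then show False using big by simp
  qed
  moreover have "real C > 0" unfolding C_def by simp
  ultimately show ?thesis by blast
qed

end
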